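(* Let $n\ge 1$, $s\ge 1$, and $H=(-\Delta)^{\frac s2}$ on $L^2(\mathbb{R}^n)$. There exist a fixed constant $\sigma>0$ and a large enough number $T_0>0$ such that the following holds for any $r>0$ and any $0<\tau_1<\tau_2<T$ with $\tau_2-\tau_1>r^sT_0$. Consider the impulse controlled Schrödinger equation $$\begin{cases} i\partial_tu-Hu=\delta_{t=\tau_1}\chi(|x|\ge r)h_1+\delta_{t=\tau_2}\chi\left(|x|\ge\sigma(\tau_2-\tau_1)/r^{s-1}\right)h_2,\quad (x,t)\in\mathbb{R}^n\times(0,T),\\ u(x,0)=u_0\in L^2(\mathbb{R}^n),\end{cases}$$ and denote its solution by $u(\cdot,\cdot,u_0,h_1,h_2)$. There is a constant $C>0$ such that for any $u_0,u_T\in L^2(\mathbb{R}^n)$ there exists a pair of controls $(h_1,h_2)\in L^2(\mathbb{R}^n)\times L^2(\mathbb{R}^n)$ such that $$u(x,T,u_0,h_1,h_2)=u_T$$ and $$\|h_1\|^2+\|h_2\|^2\le C\|u_T-e^{-iTH}u_0\|^2.$$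
   Context: $\|\cdot\|$ is the norm of $L^2(\mathbb{R}^n)$. $(-\Delta)^{s/2}$ is the self-adjoint operator on $L^2(\mathbb{R}^n)$ with domain the Sobolev space $H^s(\mathbb{R}^n)$ given by the Fourier multiplier $|\xi|^s$. $\chi(|x|\ge\rho)$ is the characteristic function of $\{|x|\ge\rho\}$, and $\delta_{t=\tau}$ is the Dirac measure in time at $\tau$. The solution of the impulse controlled equation is understood by Duhamel's formula: with $\chi_1,\chi_2$ the two characteristic functions in the equation, $u(t)=e^{-itH}u_0-i\sum_{j:\,\tau_j\le t}e^{-i(t-\tau_j)H}\chi_jh_j$. *)

theory Defs
  imports "HOL-Analysis.Analysis"
begin

text \<open>
  Elements of \<open>L\<^sup>2(\<real>\<^sup>n)\<close> are represented by Borel functions (every Lebesgue class contains one);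
  equality in \<open>L\<^sup>2\<close> is equality almost everywhere.
\<close>

definition L2 :: "(real^'n \<Rightarrow> complex) set" where
  "L2 = {f. f \<in> borel_measurable lborel \<and> integrable lborel (\<lambda>x. (norm (f x))\<^sup>2)}"

definition L2_norm :: "(real^'n \<Rightarrow> complex) \<Rightarrow> real" where
  "L2_norm f = sqrt (\<integral>x. (norm (f x))\<^sup>2 \<partial>lborel)"

text \<open>
  Membership of the approximants in \<open>L2\<close> is demanded because \<^const>\<open>L2_norm\<close> is a Bochner integral,
  which takes the junk value 0 on functions that are not square integrable.
\<close>

definition L2_tendsto ::
    "('a \<Rightarrow> real^'n \<Rightarrow> complex) \<Rightarrow> (real^'n \<Rightarrow> complex) \<Rightarrow> 'a filter \<Rightarrow> bool" where
  "L2_tendsto f g F \<longleftrightarrow> g \<in> L2 \<and> (\<forall>\<^sub>F k in F. f k \<in> L2)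
     \<and> ((\<lambda>k. L2_norm (\<lambda>x. f k x - g x)) \<longlongrightarrow> 0) F"

text \<open>
  The Fourier integral over the ball of radius \<open>R\<close>, in the unitary normalisation, with the sign
  \<open>c = -1\<close> for the Fourier transform and \<open>c = 1\<close> for its inverse. A function in \<open>L2\<close> need not be
  integrable, so its transform is the limit in \<open>L\<^sup>2\<close> for \<open>R \<rightarrow> \<infinity>\<close> (Plancherel), which is
  determined up to a null set.
\<close>

definition fourier_integral :: "real \<Rightarrow> real \<Rightarrow> (real^'n \<Rightarrow> complex) \<Rightarrow> real^'n \<Rightarrow> complex" where
  "fourier_integral c R f \<xi> =
     ((2 * pi) powr (- (real CARD('n) / 2))) *\<^sub>R
       (\<integral>x. indicator (cball 0 R) x *\<^sub>R (cis (c * (x \<bullet> \<xi>)) * f x) \<partial>lborel)"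

definition fourier :: "(real^'n \<Rightarrow> complex) \<Rightarrow> real^'n \<Rightarrow> complex" where
  "fourier f = (SOME g. L2_tendsto (\<lambda>R. fourier_integral (-1) R f) g at_top)"

definition inv_fourier :: "(real^'n \<Rightarrow> complex) \<Rightarrow> real^'n \<Rightarrow> complex" where
  "inv_fourier f = (SOME g. L2_tendsto (\<lambda>R. fourier_integral 1 R f) g at_top)"

text \<open>
  The Fourier transform turns \<open>H = (-\<Delta>)\<^bsup>s/2\<^esup>\<close> into multiplication by \<open>\<bar>\<xi>\<bar>\<^sup>s\<close>, so that for a Borel
  function \<open>\<phi>\<close> on the spectrum the operator \<open>\<phi>(H)\<close> has the multiplier \<open>\<phi>(\<bar>\<xi>\<bar>\<^sup>s)\<close>. Its domain consists
  of the \<open>f \<in> L2\<close> whose transform stays in \<open>L2\<close> after multiplication; \<open>\<phi>(\<lambda>) = \<lambda>\<close> gives \<open>H\<close> itself,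
  with domain the Sobolev space \<open>H\<^sup>s\<close>.
\<close>

definition frac_laplacian_domain ::
    "real \<Rightarrow> (real \<Rightarrow> complex) \<Rightarrow> (real^'n \<Rightarrow> complex) set" where
  "frac_laplacian_domain s \<phi> = {f \<in> L2. (\<lambda>\<xi>. \<phi> (norm \<xi> powr s) * fourier f \<xi>) \<in> L2}"

definition frac_laplacian_calculus ::
    "real \<Rightarrow> (real \<Rightarrow> complex) \<Rightarrow> (real^'n \<Rightarrow> complex) \<Rightarrow> real^'n \<Rightarrow> complex" where
  "frac_laplacian_calculus s \<phi> f = inv_fourier (\<lambda>\<xi>. \<phi> (norm \<xi> powr s) * fourier f \<xi>)"

abbreviation sobolev_space :: "real \<Rightarrow> (real^'n \<Rightarrow> complex) set" where
  "sobolev_space s \<equiv> frac_laplacian_domain s complex_of_real"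

abbreviation frac_laplacian :: "real \<Rightarrow> (real^'n \<Rightarrow> complex) \<Rightarrow> real^'n \<Rightarrow> complex" where
  "frac_laplacian s \<equiv> frac_laplacian_calculus s complex_of_real"

text \<open>The unitary group: \<open>propagator s t\<close> is \<open>e\<^bsup>-itH\<^esup>\<close>.\<close>

definition propagator :: "real \<Rightarrow> real \<Rightarrow> (real^'n \<Rightarrow> complex) \<Rightarrow> real^'n \<Rightarrow> complex" where
  "propagator s t = frac_laplacian_calculus s (\<lambda>E. exp (- (\<i> * of_real t * of_real E)))"

definition restrict_to :: "(real^'n) set \<Rightarrow> (real^'n \<Rightarrow> complex) \<Rightarrow> real^'n \<Rightarrow> complex" where
  "restrict_to A h = (\<lambda>x. indicator A x * h x)"

text \<open>
  The solution of \<open>i \<partial>\<^sub>t u - H u = \<delta>\<^bsub>t=\<tau>1\<^esub> \<chi>\<^bsub>A1\<^esub> h1 + \<delta>\<^bsub>t=\<tau>2\<^esub> \<chi>\<^bsub>A2\<^esub> h2\<close>, \<open>u(0) = u0\<close>, at time \<open>t\<close>, given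
  by Duhamel's formula.
\<close>

definition impulse_solution ::
    "real \<Rightarrow> real \<Rightarrow> (real^'n) set \<Rightarrow> real \<Rightarrow> (real^'n) set \<Rightarrow>
     (real^'n \<Rightarrow> complex) \<Rightarrow> (real^'n \<Rightarrow> complex) \<Rightarrow> (real^'n \<Rightarrow> complex) \<Rightarrow>
     real \<Rightarrow> real^'n \<Rightarrow> complex" where
  "impulse_solution s \<tau>1 A1 \<tau>2 A2 u0 h1 h2 t = (\<lambda>x.
     propagator s t u0 x
     - \<i> * ((if \<tau>1 \<le> t then propagator s (t - \<tau>1) (restrict_to A1 h1) x else 0)
          + (if \<tau>2 \<le> t then propagator s (t - \<tau>2) (restrict_to A2 h2) x else 0)))"

end

theory Submission
  imports Defs "HOL-Probability.Characteristic_Functions"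
begin

text \<open>
Put \<open>\<tau> = \<tau>2 - \<tau>1\<close>, \<open>U = e\<^bsup>-i\<tau>H\<^esup>\<close>, and let \<open>B1\<close>, \<open>B2\<close> be the open balls around the origin of radius
\<open>r\<close> and \<open>R = \<sigma> \<tau> / r\<^bsup>s-1\<^esup>\<close>, in which the controls cannot act. Pulled back from time \<open>T\<close> to time \<open>\<tau>2\<close>,
Duhamel's formula turns the control problem into solving \<open>U (1 - \<chi>\<^bsub>B1\<^esub>) h1 + (1 - \<chi>\<^bsub>B2\<^esub>) h2 = z\<close>. Outside \<open>B2\<close> the
control \<open>h2\<close> does everything, so only the part of the equation in \<open>B2\<close> matters. The ansatz
\<open>h1 = (1 - \<chi>\<^bsub>B1\<^esub>) U\<^sup>* \<chi>\<^bsub>B2\<^esub> y\<close> makes it \<open>y = \<chi>\<^bsub>B2\<^esub> z + \<chi>\<^bsub>B2\<^esub> U \<chi>\<^bsub>B1\<^esub> U\<^sup>* \<chi>\<^bsub>B2\<^esub> y\<close>, a fixed point equation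
which is solvable with a bound on \<open>y\<close> as soon as the operator \<open>\<chi>\<^bsub>B2\<^esub> U \<chi>\<^bsub>B1\<^esub>\<close> has norm less than 1
(\<open>two_point_control\<close>).

That norm is at most \<open>3/4\<close> by \<open>propagator_escape\<close>: a state concentrated in \<open>B1\<close> cannot be concentrated in
\<open>B2\<close> a time \<open>\<tau>\<close> later. The reason is that a function supported in \<open>B1\<close> carries little mass at
frequencies below a small multiple of \<open>1/r\<close>, since its Fourier transform is bounded by its \<open>L\<^sup>2\<close> norm
times the square root of the volume of \<open>B1\<close> (\<open>raw_fourier_low_frequency\<close>), while the frequencies above
travel with group velocity \<open>s \<bar>\<xi>\<bar>\<^bsup>s-1\<^esup>\<close>, which for \<open>s \<ge> 1\<close> is at least of order \<open>r\<^bsup>1-s\<^esup>\<close>, hence leave \<open>B2\<close> if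
\<open>\<sigma>\<close> is small and \<open>\<tau> / r\<^sup>s\<close> is large. The second half is an integration by parts in frequency space
(\<open>escape_oscillatory_bound\<close>): with the vector field \<open>v(\<xi>) = \<xi> (\<delta>\<^sup>2 + \<bar>\<xi>\<bar>\<^sup>2)\<^bsup>-s/2\<^esup>\<close> one has
\<open>v \<cdot> \<nabla> e\<^bsup>-i\<tau>\<bar>\<xi>\<bar>\<^sup>s\<^esup> = - i \<tau> s m e\<^bsup>-i\<tau>\<bar>\<xi>\<bar>\<^sup>s\<^esup>\<close>, where the weight \<open>m\<close> lies between 0 and 1 and is close to 1 for
\<open>\<bar>\<xi>\<bar> \<gg> \<delta>\<close>. Derivatives that fall on the transform of a function supported in a ball cost
only the radius of that ball, which the gain \<open>1 / (\<tau> s)\<close> outweighs. To avoid differentiating the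
transforms, the integration by parts is carried out with difference quotients
(\<open>translation_derivative_bound\<close>).

All this needs Plancherel's theorem (\<open>L2_fourier_inverse\<close>, \<open>L2_fourier_norm\<close>). Inserting a Gaussian weight in
the frequency integral turns \<open>\<parallel>F f\<parallel>\<^sup>2\<close> into \<open>\<langle>f \<star> heat kernel, f\<rangle>\<close>, which is at most \<open>\<parallel>f\<parallel>\<^sup>2\<close>; so the transform
is a contraction and extends to \<open>L\<^sup>2\<close> by completeness. For the indicator of a bounded open set the
heat kernel average tends to 1 on the set, so there equality holds and the inverse transform inverts.
Since the transform is symmetric for the bilinear pairing \<open>\<integral> f g\<close>, inversion passes from these indicators to
all functions by duality.
\<close>

section \<open>Square integrable functions\<close>

lemma L2_measurable [measurable_dest]: "f \<in> L2 \<Longrightarrow> f \<in> borel_measurable borel"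
  by (simp add: L2_def)

lemma L2_iff_nn_integral:
  "f \<in> L2 \<longleftrightarrow> f \<in> borel_measurable borel \<and> (\<integral>\<^sup>+x. ennreal ((norm (f x))\<^sup>2) \<partial>lborel) < \<infinity>"
  by (auto simp: L2_def integrable_iff_bounded)

lemma L2_norm_nonneg [simp]: "0 \<le> L2_norm f"
  by (simp add: L2_norm_def)

lemma L2_norm_sq: "(L2_norm f)\<^sup>2 = (\<integral>x. (norm (f x))\<^sup>2 \<partial>lborel)"
  by (simp add: L2_norm_def)

lemma nn_integral_L2_norm:
  assumes "f \<in> L2"
  shows "(\<integral>\<^sup>+x. ennreal ((norm (f x))\<^sup>2) \<partial>lborel) = ennreal ((L2_norm f)\<^sup>2)"
  unfolding L2_norm_sq using assms by (intro nn_integral_eq_integral) (auto simp: L2_def)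

text \<open>
Working with the nonnegative integral proves membership in \<open>L2\<close> and the norm bound in one go, and is the
form in which Fatou's lemma delivers its conclusions.
\<close>

lemma L2_norm_le_nn:
  assumes [measurable]: "f \<in> borel_measurable borel" and "0 \<le> B"
    and le: "(\<integral>\<^sup>+x. ennreal ((norm (f x))\<^sup>2) \<partial>lborel) \<le> ennreal (B\<^sup>2)"
  shows "f \<in> L2" "L2_norm f \<le> B"
proof -
  show "f \<in> L2"
    using le by (auto simp: L2_iff_nn_integral intro: le_less_trans)
  then have "ennreal ((L2_norm f)\<^sup>2) \<le> ennreal (B\<^sup>2)"
    using le nn_integral_L2_norm by metis
  then show "L2_norm f \<le> B"
    using \<open>0 \<le> B\<close> by (simp add: ennreal_le_iff power2_le_iff_abs_le)
qed

lemma L2_norm_mono: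
  assumes "g \<in> L2" and [measurable]: "f \<in> borel_measurable borel" and "0 \<le> B"
    and le: "AE x in lborel. norm (f x) \<le> B * norm (g x)"
  shows "f \<in> L2" "L2_norm f \<le> B * L2_norm g"
proof -
  note [measurable] = L2_measurable[OF \<open>g \<in> L2\<close>]
  have "(\<integral>\<^sup>+x. ennreal ((norm (f x))\<^sup>2) \<partial>lborel) \<le> (\<integral>\<^sup>+x. ennreal (B\<^sup>2) * ennreal ((norm (g x))\<^sup>2) \<partial>lborel)"
    using le by (intro nn_integral_mono_AE)
      (auto elim!: eventually_mono simp flip: ennreal_mult power_mult_distrib intro!: ennreal_leI power_mono)
  also have "\<dots> = ennreal (B\<^sup>2) * ennreal ((L2_norm g)\<^sup>2)"
    by (simp add: nn_integral_cmult nn_integral_L2_norm[OF \<open>g \<in> L2\<close>])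
  also have "\<dots> = ennreal ((B * L2_norm g)\<^sup>2)"
    by (simp add: power_mult_distrib ennreal_mult)
  finally show "f \<in> L2" "L2_norm f \<le> B * L2_norm g"
    using L2_norm_le_nn[of f "B * L2_norm g"] \<open>0 \<le> B\<close> by auto
qed

lemma L2_norm_cong_AE:
  assumes "f \<in> L2" "g \<in> borel_measurable borel" "AE x in lborel. f x = g x"
  shows "g \<in> L2" "L2_norm g = L2_norm f"
proof -
  show "g \<in> L2"
    using assms by (intro L2_norm_mono(1)[of f g 1]) (auto elim!: eventually_mono)
  then show "L2_norm g = L2_norm f"
    using assms by (intro antisym order.trans[OF L2_norm_mono(2)[of f g 1]]
        order.trans[OF L2_norm_mono(2)[of g f 1]]) (auto elim!: eventually_mono simp: L2_measurable)
qed

lemma L2_norm_cong: "(\<And>x. norm (f x) = norm (g x)) \<Longrightarrow> L2_norm f = L2_norm g"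
  by (simp add: L2_norm_def)

lemma L2_zero [simp]: "(\<lambda>x. 0) \<in> L2" "L2_norm (\<lambda>x. 0) = 0"
  by (auto simp: L2_def L2_norm_def)

lemma L2_cmult:
  assumes "f \<in> L2"
  shows "(\<lambda>x. c * f x) \<in> L2" "L2_norm (\<lambda>x. c * f x) = norm c * L2_norm f"
  using assms by (auto simp: L2_def L2_norm_def norm_mult power_mult_distrib real_sqrt_mult)

lemma borel_measurable_cnj [measurable]: "cnj \<in> borel_measurable borel"
  by (intro borel_measurable_continuous_onI continuous_intros)

lemma L2_cnj:
  assumes "f \<in> L2"
  shows "(\<lambda>x. cnj (f x)) \<in> L2" "L2_norm (\<lambda>x. cnj (f x)) = L2_norm f"
  using assms by (auto simp: L2_def L2_norm_def)

lemma L2_mult_bounded: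
  assumes "f \<in> L2" "m \<in> borel_measurable borel" "\<And>x. norm (m x) \<le> B"
  shows "(\<lambda>x. m x * f x) \<in> L2" "L2_norm (\<lambda>x. m x * f x) \<le> B * L2_norm f"
proof -
  have B: "0 \<le> B" using assms(3)[of 0] norm_ge_zero order.trans by blast
  note [measurable] = L2_measurable[OF assms(1)] assms(2)
  have "AE x in lborel. norm (m x * f x) \<le> B * norm (f x)"
    using assms(3) by (intro AE_I2) (simp add: norm_mult mult_right_mono)
  with L2_norm_mono[OF assms(1) _ B this]
  show "(\<lambda>x. m x * f x) \<in> L2" "L2_norm (\<lambda>x. m x * f x) \<le> B * L2_norm f"
    by auto
qed

lemma L2_mult_unimodular:
  assumes "f \<in> L2" "m \<in> borel_measurable borel" "\<And>x. norm (m x) = 1"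
  shows "(\<lambda>x. m x * f x) \<in> L2" "L2_norm (\<lambda>x. m x * f x) = L2_norm f"
  using L2_mult_bounded(1)[of f m 1] assms by (auto simp: L2_norm_def norm_mult)

lemma L2_add:
  assumes "f \<in> L2" "g \<in> L2"
  shows "(\<lambda>x. f x + g x) \<in> L2"
proof -
  note [measurable] = L2_measurable[OF assms(1)] L2_measurable[OF assms(2)]
  have "integrable lborel (\<lambda>x. 2 * (norm (f x))\<^sup>2 + 2 * (norm (g x))\<^sup>2)"
    using assms by (auto simp: L2_def)
  moreover have "(norm (f x + g x))\<^sup>2 \<le> 2 * (norm (f x))\<^sup>2 + 2 * (norm (g x))\<^sup>2" for x
  proof -
    have "(norm (f x + g x))\<^sup>2 \<le> (norm (f x) + norm (g x))\<^sup>2"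
      by (intro power_mono norm_triangle_ineq) auto
    also have "\<dots> \<le> 2 * (norm (f x))\<^sup>2 + 2 * (norm (g x))\<^sup>2"
      using sum_squares_bound[of "norm (f x)" "norm (g x)"] by (simp add: power2_sum)
    finally show ?thesis .
  qed
  ultimately have "integrable lborel (\<lambda>x. (norm (f x + g x))\<^sup>2)"
    by (intro Bochner_Integration.integrable_bound[where g="\<lambda>x. (norm (f x + g x))\<^sup>2"
        and f="\<lambda>x. 2 * (norm (f x))\<^sup>2 + 2 * (norm (g x))\<^sup>2"]) auto
  then show ?thesis by (simp add: L2_def)
qed

lemma L2_diff:
  assumes "f \<in> L2" "g \<in> L2"
  shows "(\<lambda>x. f x - g x) \<in> L2"
  using L2_add[OF assms(1) L2_cmult(1)[OF assms(2), of "-1"]] by simp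

lemma L2_norm_diff_commute: "L2_norm (\<lambda>x. f x - g x) = L2_norm (\<lambda>x. g x - f x)"
  by (intro L2_norm_cong) (rule norm_minus_commute)

lemma L2_Cauchy_Schwarz:
  assumes "f \<in> L2" "g \<in> L2"
  shows L2_mult_integrable: "integrable lborel (\<lambda>x. f x * g x)"
    and L2_mult_norm_le: "(\<integral>x. norm (f x) * norm (g x) \<partial>lborel) \<le> L2_norm f * L2_norm g"
    and L2_mult_le: "norm (\<integral>x. f x * g x \<partial>lborel) \<le> L2_norm f * L2_norm g"
proof -
  note [measurable] = L2_measurable[OF assms(1)] L2_measurable[OF assms(2)]
  let ?I = "\<integral>\<^sup>+x. ennreal (norm (f x)) * ennreal (norm (g x)) \<partial>lborel"
  have "?I\<^sup>2 \<le> ennreal ((L2_norm f)\<^sup>2) * ennreal ((L2_norm g)\<^sup>2)"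
    using Cauchy_Schwarz_nn_integral[of "\<lambda>x. ennreal (norm (f x))" lborel "\<lambda>x. ennreal (norm (g x))"]
    by (simp add: ennreal_power nn_integral_L2_norm assms)
  also have "\<dots> = (ennreal (L2_norm f * L2_norm g))\<^sup>2"
    by (simp add: ennreal_mult ennreal_power power_mult_distrib)
  finally have le: "?I\<^sup>2 \<le> (ennreal (L2_norm f * L2_norm g))\<^sup>2" .
  have I: "?I \<le> ennreal (L2_norm f * L2_norm g)"
  proof (cases ?I rule: ennreal_cases)
    case (real a)
    with le show ?thesis
      using power2_le_imp_le[of a "L2_norm f * L2_norm g"] by (simp add: ennreal_power)
  qed (use le in \<open>simp add: ennreal_power top_unique\<close>)
  have eq: "?I = (\<integral>\<^sup>+x. ennreal (norm (f x) * norm (g x)) \<partial>lborel)"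
    by (simp add: ennreal_mult)
  have int: "integrable lborel (\<lambda>x. norm (f x) * norm (g x))"
    using I unfolding eq by (intro integrableI_bounded) (auto intro: le_less_trans)
  then show "integrable lborel (\<lambda>x. f x * g x)"
    by (rule Bochner_Integration.integrable_bound) (auto simp: norm_mult)
  have "ennreal (\<integral>x. norm (f x) * norm (g x) \<partial>lborel) \<le> ennreal (L2_norm f * L2_norm g)"
    using I unfolding eq by (subst (asm) nn_integral_eq_integral[OF int]) auto
  then show *: "(\<integral>x. norm (f x) * norm (g x) \<partial>lborel) \<le> L2_norm f * L2_norm g"
    by (subst (asm) ennreal_le_iff) auto
  have "norm (\<integral>x. f x * g x \<partial>lborel) \<le> (\<integral>x. norm (f x * g x) \<partial>lborel)"
    by (rule integral_norm_bound)
  with * show "norm (\<integral>x. f x * g x \<partial>lborel) \<le> L2_norm f * L2_norm g"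
    by (simp add: norm_mult)
qed

lemma L2_norm_add_sq:
  assumes "f \<in> L2" "g \<in> L2"
  shows "(L2_norm (\<lambda>x. f x + g x))\<^sup>2 =
    (L2_norm f)\<^sup>2 + 2 * Re (\<integral>x. f x * cnj (g x) \<partial>lborel) + (L2_norm g)\<^sup>2"
proof -
  have i: "integrable lborel (\<lambda>x. f x * cnj (g x))"
    by (intro L2_mult_integrable L2_cnj assms)
  define p where "p x = Re (f x * cnj (g x))" for x
  have p: "integrable lborel p" "(\<integral>x. p x \<partial>lborel) = Re (\<integral>x. f x * cnj (g x) \<partial>lborel)"
    using i unfolding p_def by (rule integrable_Re, simp only: integral_Re[OF i])
  have "(norm (f x + g x))\<^sup>2 = (norm (f x))\<^sup>2 + 2 * p x + (norm (g x))\<^sup>2" for x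
    unfolding p_def cmod_power2 by (simp add: power2_eq_square algebra_simps)
  then show ?thesis
    using assms p(1) by (simp add: L2_norm_sq L2_def flip: p(2))
qed

lemma L2_norm_triangle:
  assumes "f \<in> L2" "g \<in> L2"
  shows "L2_norm (\<lambda>x. f x + g x) \<le> L2_norm f + L2_norm g"
proof (rule power2_le_imp_le)
  have "Re (\<integral>x. f x * cnj (g x) \<partial>lborel) \<le> L2_norm f * L2_norm g"
    using L2_mult_le[OF assms(1) L2_cnj(1)[OF assms(2)]] L2_cnj(2)[OF assms(2)]
      complex_Re_le_cmod order.trans by metis
  then show "(L2_norm (\<lambda>x. f x + g x))\<^sup>2 \<le> (L2_norm f + L2_norm g)\<^sup>2"
    unfolding L2_norm_add_sq[OF assms] by (simp add: power2_sum)
qed simp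

lemma L2_norm_triangle_diff:
  assumes "f \<in> L2" "g \<in> L2"
  shows "L2_norm (\<lambda>x. f x - g x) \<le> L2_norm f + L2_norm g"
  using L2_norm_triangle[OF assms(1) L2_cmult(1)[OF assms(2), of "-1"]]
    L2_cmult(2)[OF assms(2), of "-1"] by simp

lemma L2_norm_triangle3:
  assumes "f \<in> L2" "g \<in> L2" "h \<in> L2"
  shows "L2_norm (\<lambda>x. f x - h x) \<le> L2_norm (\<lambda>x. f x - g x) + L2_norm (\<lambda>x. g x - h x)"
  using L2_norm_triangle[OF L2_diff[OF assms(1,2)] L2_diff[OF assms(2,3)]] by simp

lemma L2_norm_le_add_diff:
  assumes "f \<in> L2" "g \<in> L2"
  shows "L2_norm f \<le> L2_norm g + L2_norm (\<lambda>x. f x - g x)"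
  using L2_norm_triangle[OF assms(2) L2_diff[OF assms]] by simp

lemma L2_norm_eq_0_iff:
  assumes "f \<in> L2"
  shows "L2_norm f = 0 \<longleftrightarrow> (AE x in lborel. f x = 0)"
  using assms by (subst L2_norm_def) (auto simp: L2_def integral_nonneg_eq_0_iff_AE)

lemma L2_AE_eqI:
  assumes "f \<in> L2" "g \<in> L2" "L2_norm (\<lambda>x. f x - g x) \<le> 0"
  shows "AE x in lborel. f x = g x"
proof -
  have "L2_norm (\<lambda>x. f x - g x) = 0"
    using assms(3) L2_norm_nonneg[of "\<lambda>x. f x - g x"] by linarith
  then show ?thesis
    by (simp add: L2_norm_eq_0_iff L2_diff assms)
qed

lemma L2_indicator:
  fixes A :: "(real^'n) set"
  assumes [measurable]: "A \<in> sets borel" and "emeasure lborel A < \<infinity>"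
  shows "(\<lambda>x. indicator A x) \<in> L2" "(L2_norm (\<lambda>x. indicator A x))\<^sup>2 = measure lborel A"
proof -
  have eq: "(norm (indicator A x :: complex))\<^sup>2 = indicator A x" for x :: "real^'n"
    by (auto simp: indicator_def)
  show "(\<lambda>x. indicator A x) \<in> L2" "(L2_norm (\<lambda>x. indicator A x))\<^sup>2 = measure lborel A"
    using assms by (auto simp: L2_norm_sq L2_def eq)
qed

lemma L2_integrable_indicator:
  assumes "f \<in> L2" and "A \<in> sets borel" and "emeasure lborel A < \<infinity>"
  shows "integrable lborel (\<lambda>x. indicator A x * f x)"
  by (intro L2_mult_integrable L2_indicator assms)

section \<open>Completeness of \<open>L\<^sup>2\<close> and contractions\<close>

text \<open>
The weights \<open>2\<^sup>k\<close> make \<open>\<Sum> 2\<^sup>k \<parallel>d k\<parallel>\<^sup>2\<close> finite, hence \<open>\<Sum> 2\<^sup>k \<bar>d k x\<bar>\<^sup>2\<close> finite for almost every \<open>x\<close>, and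
\<open>2 \<bar>d\<bar> \<le> 2\<^sup>k \<bar>d\<bar>\<^sup>2 + 2\<^bsup>-k\<^esup>\<close> turns this into absolute convergence.
\<close>

lemma L2_summable_converges:
  fixes d :: "nat \<Rightarrow> real^'n \<Rightarrow> complex"
  assumes d: "\<And>k. d k \<in> L2" and le: "\<And>k. L2_norm (d k) \<le> (1/2)^k"
  shows "AE x in lborel. summable (\<lambda>k. d k x)"
proof -
  note [measurable] = L2_measurable[OF d]
  have "(\<integral>\<^sup>+x. (\<Sum>k. ennreal (2^k * (norm (d k x))\<^sup>2)) \<partial>lborel) = 
      (\<Sum>k. \<integral>\<^sup>+x. ennreal (2^k) * ennreal ((norm (d k x))\<^sup>2) \<partial>lborel)"
    by (subst nn_integral_suminf) (auto simp: ennreal_mult)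
  also have "\<dots> = (\<Sum>k. ennreal (2^k * (L2_norm (d k))\<^sup>2))"
    by (simp add: nn_integral_cmult nn_integral_L2_norm[OF d] ennreal_mult)
  also have "\<dots> \<le> (\<Sum>k. ennreal ((1/2)^k))"
  proof (intro suminf_le ennreal_leI)
    fix k
    have "2^k * (L2_norm (d k))\<^sup>2 \<le> 2^k * ((1/2)^k)\<^sup>2"
      by (intro mult_left_mono power_mono le) auto
    also have "\<dots> = (1/2::real)^k"
      by (simp add: power_divide power2_eq_square)
    finally show "2^k * (L2_norm (d k))\<^sup>2 \<le> (1/2::real)^k" .
  qed auto
  also have "\<dots> < \<infinity>"
    using summable_geometric[of "1/2::real"] by (subst suminf_ennreal2) auto
  finally have "AE x in lborel. (\<Sum>k. ennreal (2^k * (norm (d k x))\<^sup>2)) \<noteq> \<infinity>"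
    by (intro nn_integral_PInf_AE) auto
  then show ?thesis
  proof eventually_elim
    case (elim x)
    have "summable (\<lambda>k. 2^k * (norm (d k x))\<^sup>2)"
      using elim by (intro summable_suminf_not_top) auto
    moreover have "summable (\<lambda>k. (1/2::real)^k)"
      by (rule summable_geometric) auto
    ultimately have s: "summable (\<lambda>k. 2^k * (norm (d k x))\<^sup>2 + (1/2)^k)"
      by (rule summable_add)
    show "summable (\<lambda>k. d k x)"
    proof (rule summable_comparison_test'[OF s])
      fix k
      have "2 * norm (d k x) = 2 * (sqrt (2^k) * norm (d k x)) * sqrt ((1/2)^k)"
        by (simp add: real_sqrt_divide real_sqrt_power power_divide)
      also have "\<dots> \<le> (sqrt (2^k) * norm (d k x))\<^sup>2 + (sqrt ((1/2)^k))\<^sup>2"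
        by (rule sum_squares_bound)
      also have "\<dots> = 2^k * (norm (d k x))\<^sup>2 + (1/2)^k"
        by (simp add: power_mult_distrib)
      finally show "norm (d k x) \<le> 2^k * (norm (d k x))\<^sup>2 + (1/2)^k"
        by (smt (verit) norm_ge_zero)
    qed
  qed
qed

text \<open>
Riesz--Fischer. A subsequence with geometrically decreasing steps converges almost everywhere, and
Fatou's lemma bounds the distance of the original sequence to the limit.
\<close>

lemma L2_complete:
  fixes f :: "nat \<Rightarrow> real^'n \<Rightarrow> complex"
  assumes f: "\<And>k. f k \<in> L2"
    and Cauchy: "\<And>e. e > 0 \<Longrightarrow> \<exists>N. \<forall>i\<ge>N. \<forall>j\<ge>N. L2_norm (\<lambda>x. f i x - f j x) \<le> e"
  shows "\<exists>g\<in>L2. (\<lambda>k. L2_norm (\<lambda>x. f k x - g x)) \<longlonglongrightarrow> 0"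
proof -
  obtain N where N: "\<And>e i j. e > 0 \<Longrightarrow> i \<ge> N e \<Longrightarrow> j \<ge> N e \<Longrightarrow> L2_norm (\<lambda>x. f i x - f j x) \<le> e"
    using Cauchy by metis
  \<comment> \<open>a subsequence that is monotone and, at step \<open>k\<close>, past the index for the precision \<open>2\<^bsup>-k\<^esup>\<close>\<close>
  define n where "n k = (\<Sum>i\<le>k. N ((1/2)^i)) + k" for k
  have nN: "N ((1/2)^k) \<le> n k" for k
    unfolding n_def by (intro trans_le_add1 member_le_sum) auto
  have nk: "k \<le> n k" for k
    by (simp add: n_def)
  have nSuc: "n k \<le> n (Suc k)" for k
    by (simp add: n_def)
  define d where "d k = (\<lambda>x. f (n (Suc k)) x - f (n k) x)" for k
  have d: "d k \<in> L2" for k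
    unfolding d_def by (intro L2_diff f)
  have "L2_norm (d k) \<le> (1/2)^k" for k
    unfolding d_def using nN[of k] nSuc[of k] by (intro N) auto
  from L2_summable_converges[OF d this]
  have ae: "AE x in lborel. convergent (\<lambda>k. f (n k) x)"
  proof eventually_elim
    case (elim x)
    have "(\<Sum>i<k. d i x) = f (n k) x - f (n 0) x" for k
      unfolding d_def by (rule sum_lessThan_telescope)
    then have "convergent (\<lambda>k. f (n k) x - f (n 0) x)"
      using elim by (simp add: summable_iff_convergent)
    then show ?case
      using convergent_add[OF _ convergent_const[of "f (n 0) x"]] by fastforce
  qed
  define g where "g x = lim (\<lambda>k. f (n k) x)" for x
  note [measurable] = L2_measurable[OF f]
  have [measurable]: "g \<in> borel_measurable borel"
    unfolding g_def by measurable
  have lim: "AE x in lborel. (\<lambda>k. f (n k) x) \<longlonglongrightarrow> g x"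
    using ae unfolding g_def by (simp add: convergent_LIMSEQ_iff)
  have bound: "(\<lambda>x. f i x - g x) \<in> L2 \<and> L2_norm (\<lambda>x. f i x - g x) \<le> e"
    if "e > 0" "i \<ge> N e" for i e
  proof -
    have "(\<integral>\<^sup>+x. ennreal ((norm (f i x - g x))\<^sup>2) \<partial>lborel) =
      (\<integral>\<^sup>+x. liminf (\<lambda>k. ennreal ((norm (f i x - f (n k) x))\<^sup>2)) \<partial>lborel)"
      using lim
    proof (intro nn_integral_cong_AE, eventually_elim)
      case (elim x)
      then have "(\<lambda>k. ennreal ((norm (f i x - f (n k) x))\<^sup>2)) \<longlonglongrightarrow> ennreal ((norm (f i x - g x))\<^sup>2)"
        by (intro tendsto_intros)
      then show ?case
        by (intro lim_imp_Liminf[symmetric]) auto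
    qed
    also have "\<dots> \<le> liminf (\<lambda>k. \<integral>\<^sup>+x. ennreal ((norm (f i x - f (n k) x))\<^sup>2) \<partial>lborel)"
      by (rule nn_integral_liminf) auto
    also have "\<dots> = liminf (\<lambda>k. ennreal ((L2_norm (\<lambda>x. f i x - f (n k) x))\<^sup>2))"
      by (simp add: nn_integral_L2_norm L2_diff f)
    also have "\<dots> \<le> ennreal (e\<^sup>2)"
    proof (rule Liminf_le)
      show "\<forall>\<^sub>F k in sequentially. ennreal ((L2_norm (\<lambda>x. f i x - f (n k) x))\<^sup>2) \<le> ennreal (e\<^sup>2)"
        using eventually_ge_at_top[of "N e"]
      proof eventually_elim
        case (elim k)
        then show ?case using nk[of k] that
          by (intro ennreal_leI power_mono N) auto
      qed
    qed auto
    finally show ?thesis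
      using L2_norm_le_nn[of "\<lambda>x. f i x - g x" e] that by auto
  qed
  have "(\<lambda>x. f (N 1) x - (f (N 1) x - g x)) \<in> L2"
    by (intro L2_diff f bound[THEN conjunct1, of 1]) auto
  then have "g \<in> L2" by simp
  moreover have "(\<lambda>k. L2_norm (\<lambda>x. f k x - g x)) \<longlonglongrightarrow> 0"
  proof (rule LIMSEQ_I)
    fix r :: real assume "r > 0"
    then have "\<forall>i\<ge>N (r/2). norm (L2_norm (\<lambda>x. f i x - g x) - 0) < r"
      using bound[of "r/2"] by fastforce
    then show "\<exists>no. \<forall>n\<ge>no. norm (L2_norm (\<lambda>x. f n x - g x) - 0) < r" ..
  qed
  ultimately show ?thesis by blast
qed

text \<open>
Banach's fixed point theorem for the seminorm \<^const>\<open>L2_norm\<close> on \<^const>\<open>L2\<close>. It provides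
the Neumann series that solves the control problem; the bound on the fixed point becomes the cost of
the control.
\<close>

lemma L2_contraction_fixpoint:
  fixes \<Phi> :: "(real^'n \<Rightarrow> complex) \<Rightarrow> real^'n \<Rightarrow> complex"
  assumes \<Phi>: "\<And>f. f \<in> L2 \<Longrightarrow> \<Phi> f \<in> L2" and c: "0 \<le> c" "c < 1"
    and lip: "\<And>f g. f \<in> L2 \<Longrightarrow> g \<in> L2 \<Longrightarrow> L2_norm (\<lambda>x. \<Phi> f x - \<Phi> g x) \<le> c * L2_norm (\<lambda>x. f x - g x)"
  shows "\<exists>y\<in>L2. (AE x in lborel. \<Phi> y x = y x) \<and> L2_norm y \<le> L2_norm (\<Phi> (\<lambda>x. 0)) / (1 - c)"
proof -
  define y where "y k = (\<Phi> ^^ k) (\<lambda>x. 0)" for k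
  have y0: "y 0 = (\<lambda>x. 0)" and ySuc: "y (Suc k) = \<Phi> (y k)" for k
    by (auto simp: y_def)
  have y: "y k \<in> L2" for k
    by (induction k) (auto simp: y0 ySuc \<Phi>)
  define A where "A = L2_norm (\<Phi> (\<lambda>x. 0))"
  have step: "L2_norm (\<lambda>x. y (Suc k) x - y k x) \<le> A * c^k" for k
  proof (induction k)
    case 0 then show ?case by (simp add: ySuc y0 A_def)
  next
    case (Suc k)
    have "L2_norm (\<lambda>x. y (Suc (Suc k)) x - y (Suc k) x) \<le> c * L2_norm (\<lambda>x. y (Suc k) x - y k x)"
      unfolding ySuc[of "Suc k"] by (subst (2) ySuc) (intro lip y)
    also have "\<dots> \<le> c * (A * c^k)"
      by (intro mult_left_mono Suc c)
    finally show ?case by (simp add: ac_simps)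
  qed
  have A: "A \<ge> 0" by (simp add: A_def)
  have tail: "L2_norm (\<lambda>x. y (k + m) x - y k x) \<le> A * c^k / (1 - c) * (1 - c^m)" for k m
  proof (induction m)
    case 0 then show ?case by simp
  next
    case (Suc m)
    have "L2_norm (\<lambda>x. y (k + Suc m) x - y k x) \<le>
        L2_norm (\<lambda>x. y (Suc (k + m)) x - y (k + m) x) + L2_norm (\<lambda>x. y (k + m) x - y k x)"
      using L2_norm_triangle3[OF y y y] by simp
    also have "\<dots> \<le> A * c^(k+m) + A * c^k / (1 - c) * (1 - c^m)"
      by (intro add_mono step Suc)
    also have "\<dots> = A * c^k / (1 - c) * (1 - c^Suc m)"
      using c by (simp add: field_simps power_add)
    finally show ?case .
  qed
  have tail': "L2_norm (\<lambda>x. y (k + m) x - y k x) \<le> A / (1 - c) * c^k" for k m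
  proof -
    have "A * c^k / (1 - c) * (1 - c^m) \<le> A * c^k / (1 - c) * 1"
      using c A by (intro mult_left_mono) auto
    with tail[of k m] show ?thesis by simp
  qed
  have lim0: "(\<lambda>k. A / (1 - c) * c^k) \<longlonglongrightarrow> 0"
    using c by (intro tendsto_mult_right_zero LIMSEQ_power_zero) auto
  have "\<exists>g\<in>L2. (\<lambda>k. L2_norm (\<lambda>x. y k x - g x)) \<longlonglongrightarrow> 0"
  proof (rule L2_complete[OF y])
    fix e :: real assume "e > 0"
    have "\<forall>\<^sub>F k in sequentially. A / (1 - c) * c^k < e / 2"
      using lim0 \<open>e > 0\<close> by (intro order_tendstoD) auto
    then obtain N where N: "A / (1 - c) * c^N < e / 2"
      by (auto simp: eventually_sequentially)
    have *: "L2_norm (\<lambda>x. y i x - y N x) \<le> e / 2" if "i \<ge> N" for i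
      using order.trans[OF tail'[of N "i - N"] less_imp_le[OF N]] that by simp
    have "L2_norm (\<lambda>x. y i x - y j x) \<le> e" if "i \<ge> N" "j \<ge> N" for i j
      using *[OF that(1)] *[OF that(2)] L2_norm_triangle3[OF y[of i] y[of N] y[of j]]
        L2_norm_diff_commute[of "y N" "y j"] by simp
    then show "\<exists>N. \<forall>i\<ge>N. \<forall>j\<ge>N. L2_norm (\<lambda>x. y i x - y j x) \<le> e" by blast
  qed
  then obtain g where g: "g \<in> L2" and lim: "(\<lambda>k. L2_norm (\<lambda>x. y k x - g x)) \<longlonglongrightarrow> 0" by blast
  have "L2_norm (\<lambda>x. \<Phi> g x - g x) \<le> 0"
  proof (rule LIMSEQ_le_const)
    show "(\<lambda>k. c * L2_norm (\<lambda>x. y k x - g x) + L2_norm (\<lambda>x. y (Suc k) x - g x)) \<longlonglongrightarrow> 0"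
      using tendsto_add[OF tendsto_mult_right_zero[OF lim, of c] LIMSEQ_Suc[OF lim]] by simp
    have "L2_norm (\<lambda>x. \<Phi> g x - g x) \<le> c * L2_norm (\<lambda>x. y k x - g x) + L2_norm (\<lambda>x. y (Suc k) x - g x)" for k
      using L2_norm_triangle3[OF \<Phi>[OF g] y[of "Suc k"] g] lip[OF g y[of k]]
        L2_norm_diff_commute[of g "y k"] by (simp add: ySuc)
    then show "\<exists>N. \<forall>k\<ge>N. L2_norm (\<lambda>x. \<Phi> g x - g x) \<le>
        c * L2_norm (\<lambda>x. y k x - g x) + L2_norm (\<lambda>x. y (Suc k) x - g x)" by blast
  qed
  then have "AE x in lborel. \<Phi> g x = g x"
    by (intro L2_AE_eqI \<Phi> g)
  moreover have "L2_norm g \<le> A / (1 - c)"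
  proof (rule LIMSEQ_le_const)
    show "(\<lambda>k. A / (1 - c) + L2_norm (\<lambda>x. y k x - g x)) \<longlonglongrightarrow> A / (1 - c)"
      using tendsto_add[OF tendsto_const lim] by simp
    have "L2_norm g \<le> A / (1 - c) + L2_norm (\<lambda>x. y k x - g x)" for k
      using L2_norm_le_add_diff[OF g y[of k]] tail'[of 0 k] L2_norm_diff_commute[of g "y k"]
      by (simp add: y0)
    then show "\<exists>N. \<forall>k\<ge>N. L2_norm g \<le> A / (1 - c) + L2_norm (\<lambda>x. y k x - g x)" by blast
  qed
  ultimately show ?thesis using g A_def by blast
qed

section \<open>The Fourier integral of a Gaussian\<close>

lemma integral_lborel_prod:
  fixes f :: "'a::euclidean_space \<Rightarrow> real \<Rightarrow> complex"
  assumes f: "\<And>b. b \<in> Basis \<Longrightarrow> integrable lborel (f b)"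
  shows "integrable lborel (\<lambda>x. \<Prod>b\<in>Basis. f b (x \<bullet> b))"
    and "(\<integral>x. (\<Prod>b\<in>Basis. f b (x \<bullet> b)) \<partial>lborel) = (\<Prod>b\<in>Basis. \<integral>t. f b t \<partial>lborel)"
proof -
  interpret product_sigma_finite "\<lambda>_::'a. lborel :: real measure" ..
  have fb: "f b \<in> borel_measurable borel" if "b \<in> Basis" for b
    using borel_measurable_integrable[OF f[OF that]] by simp
  have 1: "integrable (\<Pi>\<^sub>M b\<in>Basis. lborel) (\<lambda>x. \<Prod>b\<in>Basis. f b (x b))"
    by (intro product_integrable_prod f) auto
  have 2: "(\<integral>x. (\<Prod>b\<in>Basis. f b (x b)) \<partial>(\<Pi>\<^sub>M b\<in>Basis. lborel)) = (\<Prod>b\<in>Basis. \<integral>t. f b t \<partial>lborel)"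
    by (intro product_integral_prod f) auto
  have m: "(\<lambda>g. \<Sum>b\<in>Basis. g b *\<^sub>R b) \<in> (\<Pi>\<^sub>M b\<in>Basis. lborel) \<rightarrow>\<^sub>M (borel :: 'a measure)"
    by measurable
  have m': "(\<lambda>x. \<Prod>b\<in>Basis. f b (x \<bullet> b)) \<in> borel_measurable borel"
  proof (intro borel_measurable_prod)
    fix b :: 'a assume "b \<in> Basis"
    from fb[OF this] show "(\<lambda>x. f b (x \<bullet> b)) \<in> borel_measurable borel"
      by (rule measurable_compose[rotated]) measurable
  qed
  show "integrable lborel (\<lambda>x. \<Prod>b\<in>Basis. f b (x \<bullet> b))"
    by (subst lborel_eq, subst integrable_distr_eq[OF m m']) (simp add: 1)
  show "(\<integral>x. (\<Prod>b\<in>Basis. f b (x \<bullet> b)) \<partial>lborel) = (\<Prod>b\<in>Basis. \<integral>t. f b t \<partial>lborel)"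
    by (subst lborel_eq, subst integral_distr[OF m m']) (simp add: 2)
qed

lemma borel_measurable_cis [measurable]: "cis \<in> borel_measurable borel"
  unfolding cis_conv_exp by (intro borel_measurable_continuous_onI continuous_intros)

text \<open>
This is the characteristic function of the standard normal distribution, rescaled by \<open>\<surd>e\<close>.
\<close>

lemma gaussian_fourier_real:
  fixes e y :: real
  assumes e: "e > 0"
  shows "integrable lborel (\<lambda>t. cis (y * t) * of_real (exp (- (e * t\<^sup>2 / 2))))" (is "integrable _ ?F")
    and "(\<integral>t. cis (y * t) * of_real (exp (- (e * t\<^sup>2 / 2))) \<partial>lborel) =
      of_real (sqrt (2 * pi / e) * exp (- (y\<^sup>2 / (2 * e))))"
proof -
  define z where "z = y / sqrt e"
  let ?f = "\<lambda>u. std_normal_density u *\<^sub>R iexp (z * u)"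
  have int: "integrable lborel ?f"
    by (rule Bochner_Integration.integrable_bound[OF integrable_normal_density[where \<mu>=0 and \<sigma>=1]]) auto
  have "(\<integral>u. ?f u \<partial>lborel) = char std_normal_distribution z"
    unfolding char_def by (subst integral_density) auto
  also have "\<dots> = of_real (exp (- (z\<^sup>2) / 2))"
    by (simp add: char_std_normal_distribution)
  finally have val: "(\<integral>u. ?f u \<partial>lborel) = of_real (exp (- (z\<^sup>2) / 2))" .
  have eq: "?F t = of_real (sqrt (2 * pi)) * ?f (0 + sqrt e * t)" for t
    using e by (simp add: z_def std_normal_density_def cis_conv_exp power_mult_distrib scaleR_conv_of_real)
  have se: "sqrt e \<noteq> 0" using e by simp
  show "integrable lborel ?F"
    unfolding eq by (intro integrable_mult_right lborel_integrable_real_affine[OF int se])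
  have "(\<integral>t. ?f (0 + sqrt e * t) \<partial>lborel) = (1 / sqrt e) *\<^sub>R (\<integral>u. ?f u \<partial>lborel)"
    using e by (subst lborel_integral_real_affine[OF se, of ?f 0]) simp
  then have "(\<integral>t. ?F t \<partial>lborel) = of_real (sqrt (2 * pi)) * ((1 / sqrt e) *\<^sub>R of_real (exp (- (z\<^sup>2) / 2)))"
    unfolding eq by (simp only: val integral_mult_right_zero)
  also have "\<dots> = of_real (sqrt (2 * pi / e) * exp (- (y\<^sup>2 / (2 * e))))"
    using e by (simp add: z_def real_sqrt_divide real_sqrt_mult power_divide scaleR_conv_of_real mult.commute)
  finally show "(\<integral>t. ?F t \<partial>lborel) = of_real (sqrt (2 * pi / e) * exp (- (y\<^sup>2 / (2 * e))))" .
qed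

lemma cis_sum: "cis (sum f A) = (\<Prod>a\<in>A. cis (f a))"
  by (induction A rule: infinite_finite_induct) (auto simp flip: cis_mult)

lemma gaussian_fourier:
  fixes x :: "'a::euclidean_space"
  assumes e: "e > 0"
  shows "integrable lborel (\<lambda>\<xi>::'a. cis (x \<bullet> \<xi>) * of_real (exp (- (e * (norm \<xi>)\<^sup>2 / 2))))" (is "integrable _ ?F")
    and "(\<integral>\<xi>. cis (x \<bullet> \<xi>) * of_real (exp (- (e * (norm \<xi>)\<^sup>2 / 2))) \<partial>lborel) =
      of_real ((2 * pi / e) powr (real DIM('a) / 2) * exp (- ((norm x)\<^sup>2 / (2 * e))))"
proof -
  let ?f = "\<lambda>b t. cis ((x \<bullet> b) * t) * of_real (exp (- (e * t\<^sup>2 / 2)))"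
  have n: "(norm v)\<^sup>2 = (\<Sum>b\<in>Basis. (v \<bullet> b)\<^sup>2)" for v :: 'a
    by (simp add: norm_eq_sqrt_inner euclidean_inner[of v v] power2_eq_square sum_nonneg)
  have eq: "?F \<xi> = (\<Prod>b\<in>Basis. ?f b (\<xi> \<bullet> b))" for \<xi> :: 'a
    unfolding n euclidean_inner[of x \<xi>]
    by (simp add: cis_sum prod.distrib exp_sum sum_distrib_left sum_divide_distrib flip: sum_negf)
  show "integrable lborel ?F"
    unfolding eq using e by (intro integral_lborel_prod gaussian_fourier_real)
  have "(\<integral>\<xi>. ?F \<xi> \<partial>lborel) = (\<Prod>b\<in>Basis. of_real (sqrt (2 * pi / e) * exp (- ((x \<bullet> b)\<^sup>2 / (2 * e)))))"
    unfolding eq by (subst integral_lborel_prod(2)) (intro gaussian_fourier_real e prod.cong refl)+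
  also have "\<dots> = of_real (sqrt (2 * pi / e) ^ DIM('a) * exp (- ((norm x)\<^sup>2 / (2 * e))))"
    unfolding n by (simp add: prod.distrib exp_sum sum_divide_distrib flip: sum_negf)
  also have "sqrt (2 * pi / e) ^ DIM('a) = (2 * pi / e) powr (real DIM('a) / 2)"
    using e by (subst powr_realpow[symmetric]) (auto simp: powr_powr simp flip: powr_half_sqrt)
  finally show "(\<integral>\<xi>. ?F \<xi> \<partial>lborel) =
      of_real ((2 * pi / e) powr (real DIM('a) / 2) * exp (- ((norm x)\<^sup>2 / (2 * e))))" .
qed

text \<open>
The probability density \<open>(2 \<pi> e)\<^bsup>-n/2\<^esup> e\<^bsup>-\<bar>z\<bar>\<^sup>2 / (2 e)\<^esup>\<close> of variance \<open>e\<close> in each coordinate. Up to the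
square of the unitary factor it is the Fourier integral of the Gaussian weight \<open>e\<^bsup>-e \<bar>\<xi>\<bar>\<^sup>2 / 2\<^esup>\<close>.
\<close>

definition heat_kernel :: "real \<Rightarrow> real^'n \<Rightarrow> real" where
  "heat_kernel e z = (2 * pi * e) powr (- (real CARD('n) / 2)) * exp (- ((norm z)\<^sup>2 / (2 * e)))"

lemma heat_kernel_nonneg [simp]: "0 \<le> heat_kernel e z"
  by (simp add: heat_kernel_def)

lemma heat_kernel_measurable [measurable]: "heat_kernel e \<in> borel_measurable borel"
  unfolding heat_kernel_def by measurable

lemma heat_kernel_integral:
  assumes e: "e > 0"
  shows "integrable lborel (heat_kernel e :: real^'n \<Rightarrow> real)"
    and "(\<integral>z. heat_kernel e (z :: real^'n) \<partial>lborel) = 1"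
proof -
  let ?h = "\<lambda>z::real^'n. of_real (exp (- ((norm z)\<^sup>2 / (2 * e)))) :: complex"
  have eq: "exp (- (1 / e * (norm z)\<^sup>2 / 2)) = exp (- ((norm z)\<^sup>2 / (2 * e)))" for z :: "real^'n"
    by simp
  have "integrable lborel ?h" and v: "(\<integral>z. ?h z \<partial>lborel) = of_real ((2 * pi * e) powr (real CARD('n) / 2))"
    using gaussian_fourier[of "1 / e" "0 :: real^'n", unfolded eq] e by simp_all
  from integrable_Re[OF this(1)] have i: "integrable lborel (\<lambda>z::real^'n. exp (- ((norm z)\<^sup>2 / (2 * e))))"
    by simp
  then show "integrable lborel (heat_kernel e :: real^'n \<Rightarrow> real)"
    unfolding heat_kernel_def by (intro integrable_mult_right)
  have "(\<integral>z. exp (- ((norm (z :: real^'n))\<^sup>2 / (2 * e))) \<partial>lborel) = (2 * pi * e) powr (real CARD('n) / 2)"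
    using v by (simp only: integral_complex_of_real of_real_eq_iff)
  then show "(\<integral>z. heat_kernel e (z :: real^'n) \<partial>lborel) = 1"
    using e i by (simp add: heat_kernel_def powr_minus)
qed

lemma lborel_nn_integral_translate:
  fixes t :: "'a::euclidean_space"
  assumes [measurable]: "f \<in> borel_measurable borel"
  shows "(\<integral>\<^sup>+x. f (t + x) \<partial>lborel) = (\<integral>\<^sup>+x. f x \<partial>lborel)"
  by (subst (2) lborel_distr_plus[symmetric, of t]) (simp add: nn_integral_distr)

lemma heat_kernel_nn_integral:
  fixes x :: "real^'n"
  assumes e: "e > 0"
  shows "(\<integral>\<^sup>+y. ennreal (heat_kernel e (x - y)) \<partial>lborel) = 1"
    and "(\<integral>\<^sup>+y. ennreal (heat_kernel e (y - x)) \<partial>lborel) = 1"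
proof -
  have "(\<integral>\<^sup>+y. ennreal (heat_kernel e (- x + y)) \<partial>lborel) = (\<integral>\<^sup>+y. ennreal (heat_kernel e (y :: real^'n)) \<partial>lborel)"
    by (rule lborel_nn_integral_translate[of "\<lambda>y::real^'n. ennreal (heat_kernel e y)"]) measurable
  also have "\<dots> = 1"
    using heat_kernel_integral[OF e] by (subst nn_integral_eq_integral) auto
  finally show *: "(\<integral>\<^sup>+y. ennreal (heat_kernel e (y - x)) \<partial>lborel) = 1"
    by simp
  then show "(\<integral>\<^sup>+y. ennreal (heat_kernel e (x - y)) \<partial>lborel) = 1"
    by (simp add: heat_kernel_def norm_minus_commute)
qed

section \<open>Fourier integrals of integrable functions\<close>

text \<open>
The Fourier integral with sign \<open>c\<close>, without the unitary factor. The kernel is symmetric in position and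
frequency, which is why the sign is a parameter: both directions of the transform are instances.
\<close>

definition raw_fourier :: "real \<Rightarrow> (real^'n \<Rightarrow> complex) \<Rightarrow> real^'n \<Rightarrow> complex" where
  "raw_fourier c f \<xi> = (\<integral>x. cis (c * (x \<bullet> \<xi>)) * f x \<partial>lborel)"

lemma raw_fourier_measurable [measurable]:
  assumes [measurable]: "f \<in> borel_measurable borel"
  shows "raw_fourier c f \<in> borel_measurable borel"
  unfolding raw_fourier_def by measurable

lemma raw_fourier_integrable:
  assumes "integrable lborel f"
  shows "integrable lborel (\<lambda>x. cis (c * (x \<bullet> \<xi>)) * f x)"
proof -
  note [measurable] = borel_measurable_integrable[OF assms]
  show ?thesis
    by (rule Bochner_Integration.integrable_bound[OF assms]) (auto simp: norm_mult)
qed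

lemma raw_fourier_le: "norm (raw_fourier c f \<xi>) \<le> (\<integral>x. norm (f x) \<partial>lborel)"
  unfolding raw_fourier_def using integral_norm_bound[of lborel "\<lambda>x. cis (c * (x \<bullet> \<xi>)) * f x"]
  by (simp add: norm_mult)

lemma integrable_raw_fourier_mult:
  assumes "f \<in> borel_measurable borel" and \<phi>: "integrable lborel \<phi>"
  shows "integrable lborel (\<lambda>\<xi>. raw_fourier c f \<xi> * \<phi> \<xi>)"
proof -
  note [measurable] = borel_measurable_integrable[OF \<phi>] assms(1)
  show ?thesis
  proof (rule Bochner_Integration.integrable_bound)
    show "integrable lborel (\<lambda>\<xi>. (\<integral>x. norm (f x) \<partial>lborel) * norm (\<phi> \<xi>))"
      using \<phi> by auto
    show "AE \<xi> in lborel. norm (raw_fourier c f \<xi> * \<phi> \<xi>) \<le> norm ((\<integral>x. norm (f x) \<partial>lborel) * norm (\<phi> \<xi>))"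
      by (intro AE_I2) (auto simp: norm_mult intro!: mult_right_mono raw_fourier_le)
  qed measurable
qed

text \<open>
The multiplication formula: Fubini's theorem for the symmetric kernel.
\<close>

lemma raw_fourier_swap:
  assumes f: "integrable lborel f" and \<phi>: "integrable lborel \<phi>"
  shows "(\<integral>\<xi>. raw_fourier c f \<xi> * \<phi> \<xi> \<partial>lborel) = (\<integral>x. f x * raw_fourier c \<phi> x \<partial>lborel)"
proof -
  note [measurable] = borel_measurable_integrable[OF f] borel_measurable_integrable[OF \<phi>]
  let ?K = "\<lambda>x \<xi>. cis (c * (x \<bullet> \<xi>)) * f x * \<phi> \<xi>"
  have K: "integrable (lborel \<Otimes>\<^sub>M lborel) (case_prod ?K)"
  proof (rule lborel_pair.Fubini_integrable)
    show "integrable lborel (\<lambda>x. \<integral>\<xi>. norm (case_prod ?K (x, \<xi>)) \<partial>lborel)"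
      using f by (simp add: norm_mult)
    show "AE x in lborel. integrable lborel (\<lambda>\<xi>. case_prod ?K (x, \<xi>))"
    proof (intro AE_I2)
      fix x
      have "integrable lborel (\<lambda>\<xi>. f x * \<phi> \<xi>)" using \<phi> by simp
      then show "integrable lborel (\<lambda>\<xi>. case_prod ?K (x, \<xi>))"
        by (rule Bochner_Integration.integrable_bound) (auto simp: norm_mult)
    qed
  qed measurable
  have "(\<integral>\<xi>. raw_fourier c f \<xi> * \<phi> \<xi> \<partial>lborel) = (\<integral>\<xi>. (\<integral>x. ?K x \<xi> \<partial>lborel) \<partial>lborel)"
    unfolding raw_fourier_def by (subst integral_mult_left_zero[symmetric]) simp
  also have "\<dots> = (\<integral>x. (\<integral>\<xi>. ?K x \<xi> \<partial>lborel) \<partial>lborel)"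
    by (rule lborel_pair.Fubini_integral[OF K])
  also have "\<dots> = (\<integral>x. f x * raw_fourier c \<phi> x \<partial>lborel)"
    unfolding raw_fourier_def by (subst integral_mult_right_zero[symmetric]) (simp add: ac_simps inner_commute)
  finally show ?thesis .
qed

lemma cnj_raw_fourier: "cnj (raw_fourier c f \<xi>) = raw_fourier (- c) (\<lambda>x. cnj (f x)) \<xi>"
  unfolding raw_fourier_def by (subst Bochner_Integration.integral_cnj[symmetric]) (simp add: cis_cnj)

text \<open>
The factor that makes the Fourier integral an isometry of \<open>L\<^sup>2(\<real>\<^sup>n)\<close>.
\<close>

abbreviation unitary_factor :: "'n::finite itself \<Rightarrow> real" where
  "unitary_factor _ \<equiv> (2 * pi) powr (- (real CARD('n) / 2))"

text \<open>
The multiplication formula is used twice, once for each factor in \<open>\<bar>F f\<bar>\<^sup>2 = F f \<cdot> cnj (F f)\<close>. The Gaussian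
makes everything absolutely integrable, and what remains of it is the heat kernel.
\<close>

lemma raw_fourier_gaussian_weight:
  fixes f :: "real^'n \<Rightarrow> complex"
  assumes f: "integrable lborel f" and c: "\<bar>c\<bar> = 1" and e: "e > 0"
  defines "\<kappa> \<equiv> unitary_factor TYPE('n)"
  shows "(\<integral>\<xi>. (norm (\<kappa> *\<^sub>R raw_fourier c f \<xi>))\<^sup>2 * exp (- (e * (norm \<xi>)\<^sup>2 / 2)) \<partial>lborel) =
    Re (\<integral>x. f x * (\<integral>y. cnj (f y) * heat_kernel e (x - y) \<partial>lborel) \<partial>lborel)"
    (is "?L = Re ?R")
    and "integrable lborel (\<lambda>\<xi>. (norm (\<kappa> *\<^sub>R raw_fourier c f \<xi>))\<^sup>2 * exp (- (e * (norm \<xi>)\<^sup>2 / 2)))"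
proof -
  note [measurable] = borel_measurable_integrable[OF f]
  define G where "G \<xi> = complex_of_real (exp (- (e * (norm \<xi>)\<^sup>2 / 2)))" for \<xi> :: "real^'n"
  have G: "integrable lborel G"
    using gaussian_fourier(1)[OF e, of "0::real^'n"] by (simp add: G_def[abs_def])
  have cf: "integrable lborel (\<lambda>y. cnj (f y))" using f by simp
  define \<phi> where "\<phi> \<xi> = raw_fourier (- c) (\<lambda>y. cnj (f y)) \<xi> * G \<xi>" for \<xi>
  have \<phi>: "integrable lborel \<phi>"
    unfolding \<phi>_def by (intro integrable_raw_fourier_mult G) measurable
  have k2: "\<kappa>\<^sup>2 * (2 * pi / e) powr (real CARD('n) / 2) = (2 * pi * e) powr (- (real CARD('n) / 2))"
    using e by (simp add: \<kappa>_def powr_minus powr_divide powr_mult power2_eq_square field_simps)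
  have raw_fourier\<phi>: "of_real (\<kappa>\<^sup>2) * raw_fourier c \<phi> x = (\<integral>y. cnj (f y) * heat_kernel e (x - y) \<partial>lborel)" for x
  proof -
    have "raw_fourier c \<phi> x = (\<integral>\<xi>. raw_fourier (- c) (\<lambda>y. cnj (f y)) \<xi> * (cis (c * (\<xi> \<bullet> x)) * G \<xi>) \<partial>lborel)"
      unfolding raw_fourier_def[of c \<phi>] \<phi>_def by (simp add: ac_simps)
    also have "\<dots> = (\<integral>y. cnj (f y) * raw_fourier (- c) (\<lambda>\<xi>. cis (c * (\<xi> \<bullet> x)) * G \<xi>) y \<partial>lborel)"
      by (intro raw_fourier_swap raw_fourier_integrable G cf)
    also have "\<dots> = (\<integral>y. cnj (f y) * of_real ((2 * pi / e) powr (real CARD('n) / 2) * exp (- ((norm (x - y))\<^sup>2 / (2 * e)))) \<partial>lborel)"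
    proof (intro Bochner_Integration.integral_cong refl arg_cong2[where f="(*)"])
      fix y
      have "raw_fourier (- c) (\<lambda>\<xi>. cis (c * (\<xi> \<bullet> x)) * G \<xi>) y = (\<integral>\<xi>. cis ((c *\<^sub>R (x - y)) \<bullet> \<xi>) * G \<xi> \<partial>lborel)"
        unfolding raw_fourier_def
      proof (intro Bochner_Integration.integral_cong refl)
        fix \<xi>
        have "- c * (\<xi> \<bullet> y) + c * (\<xi> \<bullet> x) = (c *\<^sub>R (x - y)) \<bullet> \<xi>"
          by (simp add: inner_diff_left inner_commute[of \<xi>] right_diff_distrib)
        then show "cis (- c * (\<xi> \<bullet> y)) * (cis (c * (\<xi> \<bullet> x)) * G \<xi>) = cis ((c *\<^sub>R (x - y)) \<bullet> \<xi>) * G \<xi>"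
          by (simp only: mult.assoc[symmetric] cis_mult)
      qed
      also have "\<dots> = of_real ((2 * pi / e) powr (real CARD('n) / 2) * exp (- ((norm (x - y))\<^sup>2 / (2 * e))))"
        unfolding G_def by (subst gaussian_fourier(2)[OF e]) (simp add: c)
      finally show "raw_fourier (- c) (\<lambda>\<xi>. cis (c * (\<xi> \<bullet> x)) * G \<xi>) y =
        of_real ((2 * pi / e) powr (real CARD('n) / 2) * exp (- ((norm (x - y))\<^sup>2 / (2 * e))))" .
    qed
    finally have "of_real (\<kappa>\<^sup>2) * raw_fourier c \<phi> x = (\<integral>y. of_real (\<kappa>\<^sup>2) * (cnj (f y) * 
      of_real ((2 * pi / e) powr (real CARD('n) / 2) * exp (- ((norm (x - y))\<^sup>2 / (2 * e))))) \<partial>lborel)"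
      by (simp only: integral_mult_right_zero)
    also have "\<dots> = (\<integral>y. cnj (f y) * heat_kernel e (x - y) \<partial>lborel)"
      unfolding heat_kernel_def k2[symmetric]
      by (intro Bochner_Integration.integral_cong refl) (simp only: of_real_mult ac_simps)
    finally show ?thesis .
  qed
  have eq: "of_real ((norm (\<kappa> *\<^sub>R raw_fourier c f \<xi>))\<^sup>2 * exp (- (e * (norm \<xi>)\<^sup>2 / 2))) =
      of_real (\<kappa>\<^sup>2) * (raw_fourier c f \<xi> * \<phi> \<xi>)" for \<xi>
    unfolding \<phi>_def G_def cnj_raw_fourier[symmetric]
    by (simp only: norm_scaleR power_mult_distrib power2_abs of_real_mult complex_norm_square ac_simps)
  have i: "integrable lborel (\<lambda>\<xi>. of_real (\<kappa>\<^sup>2) * (raw_fourier c f \<xi> * \<phi> \<xi>))"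
    by (intro integrable_mult_right integrable_raw_fourier_mult \<phi>) measurable
  then have "integrable lborel (\<lambda>\<xi>. complex_of_real ((norm (\<kappa> *\<^sub>R raw_fourier c f \<xi>))\<^sup>2 * exp (- (e * (norm \<xi>)\<^sup>2 / 2))))"
    unfolding eq .
  from integrable_Re[OF this] show "integrable lborel (\<lambda>\<xi>. (norm (\<kappa> *\<^sub>R raw_fourier c f \<xi>))\<^sup>2 * exp (- (e * (norm \<xi>)\<^sup>2 / 2)))"
    by simp
  have "of_real ?L = (\<integral>\<xi>. of_real (\<kappa>\<^sup>2) * (raw_fourier c f \<xi> * \<phi> \<xi>) \<partial>lborel)"
    unfolding eq[symmetric] by (rule integral_complex_of_real[symmetric])
  also have "\<dots> = of_real (\<kappa>\<^sup>2) * (\<integral>x. f x * raw_fourier c \<phi> x \<partial>lborel)"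
    by (simp only: integral_mult_right_zero raw_fourier_swap[OF f \<phi>])
  also have "\<dots> = (\<integral>x. of_real (\<kappa>\<^sup>2) * (f x * raw_fourier c \<phi> x) \<partial>lborel)"
    by (simp only: integral_mult_right_zero)
  also have "\<dots> = ?R"
    by (intro Bochner_Integration.integral_cong refl) (simp only: raw_fourier\<phi>[symmetric] ac_simps)
  finally have "Re (of_real ?L) = Re ?R" by (rule arg_cong)
  then show "?L = Re ?R" by (simp only: Re_complex_of_real)
qed

text \<open>
Schur's test: the kernel is nonnegative and has integral 1 in either variable, so
\<open>\<bar>f x f y\<bar> \<le> (\<bar>f x\<bar>\<^sup>2 + \<bar>f y\<bar>\<^sup>2) / 2\<close> suffices.
\<close>

lemma heat_kernel_schur:
  fixes f :: "real^'n \<Rightarrow> complex"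
  assumes f: "f \<in> L2" and e: "e > 0"
  shows "norm (\<integral>x. f x * (\<integral>y. cnj (f y) * heat_kernel e (x - y) \<partial>lborel) \<partial>lborel) \<le> (L2_norm f)\<^sup>2"
proof -
  note [measurable] = L2_measurable[OF f]
  define h :: real where "h = 1 / 2"
  have h: "0 \<le> h" "h + h = 1" by (simp_all add: h_def)
  let ?n = "\<lambda>x. ennreal (norm (f x))" and ?q = "\<lambda>x. ennreal ((norm (f x))\<^sup>2)"
  let ?k = "\<lambda>x y. ennreal (heat_kernel e (x - y))"
  have nb: "ennreal (norm (\<integral>x. h x \<partial>lborel)) \<le> (\<integral>\<^sup>+x. norm (h x) \<partial>lborel)" for h :: "real^'n \<Rightarrow> complex"
    by (cases "integrable lborel h") (auto simp: integral_norm_bound_ennreal not_integrable_integral_eq)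
  have "ennreal (norm (\<integral>x. f x * (\<integral>y. cnj (f y) * heat_kernel e (x - y) \<partial>lborel) \<partial>lborel)) \<le>
      (\<integral>\<^sup>+x. norm (f x * (\<integral>y. cnj (f y) * heat_kernel e (x - y) \<partial>lborel)) \<partial>lborel)"
    by (rule nb)
  also have "\<dots> = (\<integral>\<^sup>+x. ?n x * ennreal (norm (\<integral>y. cnj (f y) * heat_kernel e (x - y) \<partial>lborel)) \<partial>lborel)"
    by (simp add: norm_mult ennreal_mult)
  also have "\<dots> \<le> (\<integral>\<^sup>+x. ?n x * (\<integral>\<^sup>+y. norm (cnj (f y) * heat_kernel e (x - y)) \<partial>lborel) \<partial>lborel)"
    by (intro nn_integral_mono mult_left_mono nb) auto
  also have "\<dots> = (\<integral>\<^sup>+x. (\<integral>\<^sup>+y. ?n x * (?n y * ?k x y) \<partial>lborel) \<partial>lborel)"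
    by (simp add: norm_mult ennreal_mult nn_integral_cmult)
  also have "\<dots> \<le> (\<integral>\<^sup>+x. (\<integral>\<^sup>+y. ennreal h * (?q x * ?k x y) + ennreal h * (?q y * ?k x y) \<partial>lborel) \<partial>lborel)"
  proof (intro nn_integral_mono)
    fix x y
    have "norm (f x) * norm (f y) \<le> h * (norm (f x))\<^sup>2 + h * (norm (f y))\<^sup>2"
      using sum_squares_bound[of "norm (f x)" "norm (f y)"] by (simp add: h_def)
    then have "norm (f x) * (norm (f y) * heat_kernel e (x - y)) \<le>
      h * ((norm (f x))\<^sup>2 * heat_kernel e (x - y)) + h * ((norm (f y))\<^sup>2 * heat_kernel e (x - y))"
      by (simp only: mult.assoc[symmetric] distrib_right[symmetric]) (intro mult_right_mono, auto)
    then show "?n x * (?n y * ?k x y) \<le> ennreal h * (?q x * ?k x y) + ennreal h * (?q y * ?k x y)"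
      using h by (simp add: ennreal_mult[symmetric] ennreal_plus[symmetric] ennreal_leI del: ennreal_plus)
  qed
  also have "\<dots> = ennreal h * (\<integral>\<^sup>+x. (\<integral>\<^sup>+y. ?q x * ?k x y \<partial>lborel) \<partial>lborel) +
      ennreal h * (\<integral>\<^sup>+x. (\<integral>\<^sup>+y. ?q y * ?k x y \<partial>lborel) \<partial>lborel)"
    by (simp add: nn_integral_add nn_integral_cmult)
  also have "(\<integral>\<^sup>+x. (\<integral>\<^sup>+y. ?q y * ?k x y \<partial>lborel) \<partial>lborel) = (\<integral>\<^sup>+y. (\<integral>\<^sup>+x. ?q y * ?k x y \<partial>lborel) \<partial>lborel)"
    by (intro lborel_pair.Fubini') measurable
  finally have "ennreal (norm (\<integral>x. f x * (\<integral>y. cnj (f y) * heat_kernel e (x - y) \<partial>lborel) \<partial>lborel)) \<le>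
      ennreal h * ennreal ((L2_norm f)\<^sup>2) + ennreal h * ennreal ((L2_norm f)\<^sup>2)"
    by (simp add: nn_integral_cmult heat_kernel_nn_integral[OF e] nn_integral_L2_norm[OF f])
  also have "\<dots> = ennreal ((L2_norm f)\<^sup>2)"
    using h by (simp add: ennreal_mult[symmetric] ennreal_plus[symmetric] distrib_right[symmetric] del: ennreal_plus)
  finally show ?thesis by (simp add: ennreal_le_iff)
qed

text \<open>
Removing the Gaussian weight by Fatou's lemma keeps the Schur bound.
\<close>

lemma raw_fourier_contraction:
  fixes f :: "real^'n \<Rightarrow> complex"
  assumes f: "f \<in> L2" "integrable lborel f" and c: "\<bar>c\<bar> = 1"
  shows "(\<lambda>\<xi>. unitary_factor TYPE('n) *\<^sub>R raw_fourier c f \<xi>) \<in> L2"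
    and "L2_norm (\<lambda>\<xi>. unitary_factor TYPE('n) *\<^sub>R raw_fourier c f \<xi>) \<le> L2_norm f"
proof -
  note [measurable] = L2_measurable[OF f(1)]
  let ?F = "\<lambda>\<xi>. unitary_factor TYPE('n) *\<^sub>R raw_fourier c f \<xi>"
  define e where "e k = 1 / real (Suc k)" for k
  have e: "e k > 0" for k by (simp add: e_def)
  have e0: "e \<longlonglongrightarrow> 0"
    unfolding e_def using LIMSEQ_inverse_real_of_nat by (simp add: divide_inverse)
  let ?G = "\<lambda>k \<xi>. (norm (?F \<xi>))\<^sup>2 * exp (- (e k * (norm \<xi>)\<^sup>2 / 2))"
  have "(\<integral>\<^sup>+\<xi>. ennreal ((norm (?F \<xi>))\<^sup>2) \<partial>lborel) = (\<integral>\<^sup>+\<xi>. liminf (\<lambda>k. ennreal (?G k \<xi>)) \<partial>lborel)"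
  proof (intro nn_integral_cong lim_imp_Liminf[symmetric] tendsto_ennrealI)
    fix \<xi> :: "real^'n"
    have "(\<lambda>k. ?G k \<xi>) \<longlonglongrightarrow> (norm (?F \<xi>))\<^sup>2 * exp (- (0 * (norm \<xi>)\<^sup>2 / 2))"
      by (intro tendsto_intros e0) auto
    then show "(\<lambda>k. ?G k \<xi>) \<longlonglongrightarrow> (norm (?F \<xi>))\<^sup>2" by simp
  qed auto
  also have "\<dots> \<le> liminf (\<lambda>k. \<integral>\<^sup>+\<xi>. ennreal (?G k \<xi>) \<partial>lborel)"
    by (rule nn_integral_liminf) measurable
  also have "\<dots> \<le> ennreal ((L2_norm f)\<^sup>2)"
  proof (intro Liminf_le always_eventually allI)
    fix k
    have "(\<integral>\<^sup>+\<xi>. ennreal (?G k \<xi>) \<partial>lborel) = ennreal (\<integral>\<xi>. ?G k \<xi> \<partial>lborel)"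
      by (intro nn_integral_eq_integral raw_fourier_gaussian_weight f c e) auto
    also have "\<dots> \<le> ennreal ((L2_norm f)\<^sup>2)"
      unfolding raw_fourier_gaussian_weight(1)[OF f(2) c e[of k]]
      by (intro ennreal_leI order.trans[OF complex_Re_le_cmod heat_kernel_schur] f e)
    finally show "(\<integral>\<^sup>+\<xi>. ennreal (?G k \<xi>) \<partial>lborel) \<le> ennreal ((L2_norm f)\<^sup>2)" .
  qed auto
  finally show "?F \<in> L2" "L2_norm ?F \<le> L2_norm f"
    using L2_norm_le_nn[of ?F "L2_norm f"] by auto
qed

lemma heat_kernel_scaling:
  assumes "e > 0"
  shows "sqrt e ^ CARD('n) * heat_kernel e (sqrt e *\<^sub>R z) = heat_kernel 1 (z :: real^'n)"
proof -
  have "sqrt e ^ CARD('n) = e powr (real CARD('n) / 2)"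
    using assms by (subst powr_realpow[symmetric]) (auto simp: powr_powr simp flip: powr_half_sqrt)
  then show ?thesis
    using assms by (simp add: heat_kernel_def powr_mult powr_minus power_mult_distrib field_simps)
qed

text \<open>
After rescaling, the heat kernel average at \<open>x\<close> is a fixed Gaussian average of \<open>U\<close> seen through a
microscope at \<open>x\<close>, and an interior point sees only \<open>U\<close> in the limit.
\<close>

lemma heat_kernel_open_limit:
  fixes U :: "(real^'n) set"
  assumes U: "open U" and x: "x \<in> U"
  shows "(\<lambda>k. \<integral>y. indicator U y * heat_kernel (1 / real (Suc k)) (x - y) \<partial>lborel) \<longlonglongrightarrow> 1"
proof -
  have [measurable]: "U \<in> sets borel" using U by simp
  define e where "e k = 1 / real (Suc k)" for k
  have e: "e k > 0" for k by (simp add: e_def)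
  have e0: "e \<longlonglongrightarrow> 0"
    unfolding e_def using LIMSEQ_inverse_real_of_nat by (simp add: divide_inverse)
  have eq: "(\<integral>y. indicator U y * heat_kernel (e k) (x - y) \<partial>lborel) =
    (\<integral>z. indicator U (x + sqrt (e k) *\<^sub>R z) * heat_kernel 1 z \<partial>lborel)" for k
  proof -
    have "sqrt (e k) \<noteq> 0" using e[of k] by simp
    from lborel_affine[OF this, of x]
    have "(\<integral>y. indicator U y * heat_kernel (e k) (x - y) \<partial>lborel) =
      (\<integral>y. indicator U y * heat_kernel (e k) (x - y)
        \<partial>density (distr lborel borel (\<lambda>z. x + sqrt (e k) *\<^sub>R z)) (\<lambda>_. \<bar>sqrt (e k)\<bar> ^ CARD('n)))"
      by simp
    also have "\<dots> = (\<integral>z. \<bar>sqrt (e k)\<bar> ^ CARD('n) *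
        (indicator U (x + sqrt (e k) *\<^sub>R z) * heat_kernel (e k) (- (sqrt (e k) *\<^sub>R z))) \<partial>lborel)"
      by (subst integral_density) (auto simp: integral_distr)
    also have "\<dots> = (\<integral>z. indicator U (x + sqrt (e k) *\<^sub>R z) * heat_kernel 1 z \<partial>lborel)"
      unfolding heat_kernel_scaling[OF e[of k], symmetric] using e[of k]
      by (intro Bochner_Integration.integral_cong) (auto simp: heat_kernel_def)
    finally show ?thesis .
  qed
  have "(\<lambda>k. \<integral>z. indicator U (x + sqrt (e k) *\<^sub>R z) * heat_kernel 1 z \<partial>lborel) \<longlonglongrightarrow>
      (\<integral>z. heat_kernel 1 (z :: real^'n) \<partial>lborel)"
  proof (rule integral_dominated_convergence)
    show "integrable lborel (heat_kernel 1 :: real^'n \<Rightarrow> real)"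
      by (rule heat_kernel_integral) simp
    show "AE z in lborel. (\<lambda>k. indicator U (x + sqrt (e k) *\<^sub>R z) * heat_kernel 1 z) \<longlonglongrightarrow> heat_kernel 1 z"
    proof (intro AE_I2 tendsto_eventually)
      fix z
      have "(\<lambda>k. x + sqrt (e k) *\<^sub>R z) \<longlonglongrightarrow> x + sqrt 0 *\<^sub>R z"
        by (intro tendsto_intros e0)
      then have "\<forall>\<^sub>F k in sequentially. x + sqrt (e k) *\<^sub>R z \<in> U"
        using U x by (intro topological_tendstoD) auto
      then show "\<forall>\<^sub>F k in sequentially. indicator U (x + sqrt (e k) *\<^sub>R z) * heat_kernel 1 z = heat_kernel 1 z"
        by eventually_elim simp
    qed
  qed (auto simp: indicator_def)
  then have "(\<lambda>k. \<integral>y. indicator U y * heat_kernel (e k) (x - y) \<partial>lborel) \<longlonglongrightarrow> 1"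
    unfolding eq by (simp add: heat_kernel_integral)
  then show ?thesis
    by (simp only: e_def)
qed

text \<open>
The reverse of the contraction inequality comes from the Gaussian weight tending to 1, because every
point of an open set is interior and the heat kernel average tends to 1 there.
\<close>

lemma raw_fourier_isometry_open:
  fixes U :: "(real^'n) set"
  assumes U: "open U" "bounded U" and c: "\<bar>c\<bar> = 1"
  shows "L2_norm (\<lambda>\<xi>. unitary_factor TYPE('n) *\<^sub>R raw_fourier c (indicator U) \<xi>) = L2_norm (\<lambda>x. indicator U x)"
proof (rule antisym)
  have [measurable]: "U \<in> sets borel" using U by simp
  have fin: "emeasure lborel U < \<infinity>"
    using emeasure_bounded_finite[OF U(2)] by simp
  have ind: "integrable lborel (indicator U :: real^'n \<Rightarrow> complex)"
    using integrable_of_real[of lborel "indicator U", where 'a=complex] fin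
    by (simp add: integrable_indicator_iff of_real_indicator)
  have L2: "(\<lambda>x. indicator U x) \<in> L2" by (intro L2_indicator fin) measurable
  note oc = raw_fourier_contraction[OF L2 ind c]
  let ?F = "\<lambda>\<xi>. unitary_factor TYPE('n) *\<^sub>R raw_fourier c (indicator U) \<xi>"
  show "L2_norm ?F \<le> L2_norm (\<lambda>x. indicator U x)" by (rule oc(2))
  define e where "e k = 1 / real (Suc k)" for k
  have e: "e k > 0" for k by (simp add: e_def)
  define I where "I k x = (\<integral>y. indicator U y * heat_kernel (e k) (x - y) \<partial>lborel)" for k x
  have I[measurable]: "I k \<in> borel_measurable borel" for k
    unfolding I_def by measurable
  have I01: "0 \<le> I k x" "I k x \<le> 1" for k x
  proof -
    show "0 \<le> I k x" unfolding I_def by (intro integral_nonneg_AE) auto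
    have "integrable lborel (\<lambda>y. heat_kernel (e k) (x - y))"
      by (intro integrableI_bounded) (auto simp: heat_kernel_nn_integral e)
    then have "I k x \<le> (\<integral>y. heat_kernel (e k) (x - y) \<partial>lborel)"
      unfolding I_def by (rule integral_mono') (auto simp: indicator_def)
    also have "\<dots> = 1"
      by (subst integral_eq_nn_integral) (auto simp: heat_kernel_nn_integral e)
    finally show "I k x \<le> 1" .
  qed
  have le: "(\<integral>x. indicator U x * I k x \<partial>lborel) \<le> (L2_norm ?F)\<^sup>2" for k
  proof -
    have "(\<integral>x. indicator U x * (\<integral>y. cnj (indicator U y) * heat_kernel (e k) (x - y) \<partial>lborel) \<partial>lborel) =
       complex_of_real (\<integral>x. indicator U x * I k x \<partial>lborel)"
    proof -
      have "cnj (indicator U y) = indicator U y" for y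
        by (simp add: indicator_def)
      then show ?thesis
        unfolding I_def integral_complex_of_real[symmetric] of_real_mult
        by (simp add: of_real_indicator)
    qed
    then have "(\<integral>x. indicator U x * I k x \<partial>lborel) =
        (\<integral>\<xi>. (norm (?F \<xi>))\<^sup>2 * exp (- (e k * (norm \<xi>)\<^sup>2 / 2)) \<partial>lborel)"
      using raw_fourier_gaussian_weight(1)[OF ind c e[of k]] by simp
    also have "\<dots> \<le> (\<integral>\<xi>. (norm (?F \<xi>))\<^sup>2 \<partial>lborel)"
      using oc(1) e[of k] 
      by (intro integral_mono raw_fourier_gaussian_weight ind c e) (auto simp: L2_def intro!: mult_left_le)
    finally show ?thesis by (simp add: L2_norm_sq)
  qed
  have "(\<lambda>k. \<integral>x. indicator U x * I k x \<partial>lborel) \<longlonglongrightarrow> (\<integral>x. indicator U x \<partial>lborel)"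
  proof (rule integral_dominated_convergence)
    show "integrable lborel (indicator U :: real^'n \<Rightarrow> real)"
      using fin by (simp add: integrable_indicator_iff)
    show "AE x in lborel. (\<lambda>k. indicator U x * I k x) \<longlonglongrightarrow> indicator U x"
      using heat_kernel_open_limit[OF U(1)] by (intro AE_I2) (auto simp: indicator_def I_def e_def)
  qed (use I01 in \<open>auto simp: indicator_def\<close>)
  then have "measure lborel U \<le> (L2_norm ?F)\<^sup>2"
    using le fin by (intro LIMSEQ_le_const2[of _ "measure lborel U"]) auto
  then have "(L2_norm (\<lambda>x. indicator U x))\<^sup>2 \<le> (L2_norm ?F)\<^sup>2"
    by (subst L2_indicator(2)[OF \<open>U \<in> sets borel\<close> fin])
  then show "L2_norm (\<lambda>x. indicator U x) \<le> L2_norm ?F"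
    by (rule power2_le_imp_le) (rule L2_norm_nonneg)
qed

section \<open>Plancherel's theorem\<close>

definition truncation :: "real \<Rightarrow> (real^'n \<Rightarrow> complex) \<Rightarrow> real^'n \<Rightarrow> complex" where
  "truncation R f = (\<lambda>x. indicator (cball 0 R) x * f x)"

lemma truncation_L2:
  fixes f :: "real^'n \<Rightarrow> complex"
  assumes "f \<in> L2"
  shows "truncation R f \<in> L2" "integrable lborel (truncation R f)" "L2_norm (truncation R f) \<le> L2_norm f"
proof -
  have m: "indicator (cball 0 R) \<in> borel_measurable (borel :: (real^'n) measure)"
    by (intro borel_measurable_indicator) auto
  show "truncation R f \<in> L2" "L2_norm (truncation R f) \<le> L2_norm f"
    using L2_mult_bounded[OF assms m, of 1] unfolding truncation_def by (simp_all add: indicator_def)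
  show "integrable lborel (truncation R f)"
    unfolding truncation_def using emeasure_bounded_finite[of "cball 0 R :: (real^'n) set"]
    by (intro L2_integrable_indicator assms) auto
qed

lemma truncation_eq: "(\<And>x. norm x > R \<Longrightarrow> f x = 0) \<Longrightarrow> truncation R f = f"
  by (auto simp: truncation_def fun_eq_iff indicator_def not_le)

lemma truncation_trunc: "r \<le> R \<Longrightarrow> truncation R (truncation r f) = truncation r f"
  by (auto simp: truncation_def fun_eq_iff indicator_def)

lemma truncation_tendsto:
  fixes f :: "real^'n \<Rightarrow> complex"
  assumes f: "f \<in> L2"
  shows "L2_tendsto (\<lambda>R. truncation R f) f at_top"
proof -
  note [measurable] = L2_measurable[OF f]
  have [measurable]: "truncation R f \<in> borel_measurable borel" for R
    by (intro L2_measurable truncation_L2 f)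
  have "((\<lambda>R. \<integral>x. (norm (truncation R f x - f x))\<^sup>2 \<partial>lborel) \<longlongrightarrow> (\<integral>x. 0 \<partial>(lborel :: (real^'n) measure))) at_top"
  proof (rule integral_dominated_convergence_at_top[where w="\<lambda>x. (norm (f x))\<^sup>2"])
    show "integrable lborel (\<lambda>x. (norm (f x))\<^sup>2)" using f by (simp add: L2_def)
    show "AE x in lborel. ((\<lambda>R. (norm (truncation R f x - f x))\<^sup>2) \<longlongrightarrow> 0) at_top"
    proof (intro AE_I2 tendsto_eventually)
      fix x
      show "\<forall>\<^sub>F R in at_top. (norm (truncation R f x - f x))\<^sup>2 = 0"
        using eventually_ge_at_top[of "norm x"] by eventually_elim (auto simp: truncation_def)
    qed
    show "\<forall>\<^sub>F R in at_top. AE x in lborel. norm ((norm (truncation R f x - f x))\<^sup>2) \<le> (norm (f x))\<^sup>2"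
      by (intro always_eventually allI AE_I2) (auto simp: truncation_def indicator_def)
  qed auto
  from tendsto_real_sqrt[OF this] show ?thesis
    unfolding L2_tendsto_def L2_norm_def using f truncation_L2(1)[OF f] by auto
qed

lemma fourier_integral_eq_raw:
  fixes f :: "real^'n \<Rightarrow> complex"
  shows "fourier_integral c R f = (\<lambda>\<xi>. unitary_factor TYPE('n) *\<^sub>R raw_fourier c (truncation R f) \<xi>)"
  unfolding fourier_integral_def raw_fourier_def truncation_def
  by (intro ext arg_cong2[where f=scaleR] refl Bochner_Integration.integral_cong) (auto simp: indicator_def)

lemma fourier_integral_L2:
  assumes "f \<in> L2" "\<bar>c\<bar> = 1"
  shows "fourier_integral c R f \<in> L2" "L2_norm (fourier_integral c R f) \<le> L2_norm (truncation R f)"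
  unfolding fourier_integral_eq_raw by (intro raw_fourier_contraction truncation_L2 assms)+

lemma raw_fourier_lincomb:
  assumes "integrable lborel f" "integrable lborel g"
  shows "raw_fourier c (\<lambda>x. a * f x + b * g x) \<xi> = a * raw_fourier c f \<xi> + b * raw_fourier c g \<xi>"
proof -
  have "raw_fourier c (\<lambda>x. a * f x + b * g x) \<xi> =
    (\<integral>x. a * (cis (c * (x \<bullet> \<xi>)) * f x) + b * (cis (c * (x \<bullet> \<xi>)) * g x) \<partial>lborel)"
    unfolding raw_fourier_def by (simp add: algebra_simps)
  also have "\<dots> = a * raw_fourier c f \<xi> + b * raw_fourier c g \<xi>"
    unfolding raw_fourier_def using raw_fourier_integrable[OF assms(1)] raw_fourier_integrable[OF assms(2)]
    by (subst Bochner_Integration.integral_add) auto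
  finally show ?thesis .
qed

lemma fourier_integral_lincomb:
  assumes "f \<in> L2" "g \<in> L2"
  shows "fourier_integral c R (\<lambda>x. a * f x + b * g x) =
    (\<lambda>\<xi>. a * fourier_integral c R f \<xi> + b * fourier_integral c R g \<xi>)"
proof -
  have "truncation R (\<lambda>x. a * f x + b * g x) = (\<lambda>x. a * truncation R f x + b * truncation R g x)"
    by (auto simp: truncation_def fun_eq_iff algebra_simps)
  then show ?thesis
    unfolding fourier_integral_eq_raw using assms
    by (auto simp: raw_fourier_lincomb truncation_L2 scaleR_conv_of_real algebra_simps)
qed

text \<open>
The integrals over two balls differ by the transform of a difference of two truncations, so the
contraction property makes the family Cauchy.
\<close>

lemma fourier_integral_diff_le:
  assumes f: "f \<in> L2" and c: "\<bar>c\<bar> = 1"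
  shows "L2_norm (\<lambda>\<xi>. fourier_integral c R f \<xi> - fourier_integral c R' f \<xi>) \<le>
    L2_norm (\<lambda>x. truncation R f x - f x) + L2_norm (\<lambda>x. truncation R' f x - f x)"
proof -
  define M where "M = max R R'"
  have *: "fourier_integral c R f = fourier_integral c M (truncation R f)"
    "fourier_integral c R' f = fourier_integral c M (truncation R' f)"
    by (simp_all add: fourier_integral_eq_raw truncation_trunc M_def)
  have d: "(\<lambda>x. truncation R f x - truncation R' f x) \<in> L2"
    by (intro L2_diff truncation_L2 f)
  have "(\<lambda>\<xi>. fourier_integral c R f \<xi> - fourier_integral c R' f \<xi>) =
      fourier_integral c M (\<lambda>x. truncation R f x - truncation R' f x)"
    using fourier_integral_lincomb[OF truncation_L2(1)[OF f] truncation_L2(1)[OF f], of c M 1 R "-1" R']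
    unfolding * by simp
  then have "L2_norm (\<lambda>\<xi>. fourier_integral c R f \<xi> - fourier_integral c R' f \<xi>) \<le>
      L2_norm (\<lambda>x. truncation R f x - truncation R' f x)"
    using order.trans[OF fourier_integral_L2(2)[OF d c] truncation_L2(3)[OF d]] by simp
  also have "\<dots> \<le> L2_norm (\<lambda>x. truncation R f x - f x) + L2_norm (\<lambda>x. truncation R' f x - f x)"
    using L2_norm_triangle3[OF truncation_L2(1)[OF f] f truncation_L2(1)[OF f], of R R']
      L2_norm_diff_commute[of f "truncation R' f"] by simp
  finally show ?thesis .
qed

text \<open>
The common form of \<^const>\<open>fourier\<close> (\<open>c = -1\<close>) and \<^const>\<open>inv_fourier\<close> (\<open>c = 1\<close>).
\<close>

definition L2_fourier :: "real \<Rightarrow> (real^'n \<Rightarrow> complex) \<Rightarrow> real^'n \<Rightarrow> complex" where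
  "L2_fourier c f = (SOME g. L2_tendsto (\<lambda>R. fourier_integral c R f) g at_top)"

lemma fourier_eq_L2_fourier: "fourier = L2_fourier (-1)" and inv_fourier_eq_L2_fourier: "inv_fourier = L2_fourier 1"
  by (auto simp: fun_eq_iff fourier_def inv_fourier_def L2_fourier_def)

lemma L2_tendstoD:
  assumes "L2_tendsto u g F"
  shows "g \<in> L2" "\<forall>\<^sub>F k in F. u k \<in> L2" "((\<lambda>k. L2_norm (\<lambda>x. u k x - g x)) \<longlongrightarrow> 0) F"
  using assms by (auto simp: L2_tendsto_def)

lemma L2_fourier_tendsto:
  fixes f :: "real^'n \<Rightarrow> complex"
  assumes f: "f \<in> L2" and c: "\<bar>c\<bar> = 1"
  shows "L2_tendsto (\<lambda>R. fourier_integral c R f) (L2_fourier c f) at_top"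
proof -
  let ?t = "\<lambda>R. L2_norm (\<lambda>x. truncation R f x - f x)"
  have t: "(?t \<longlongrightarrow> 0) at_top"
    using truncation_tendsto[OF f] by (rule L2_tendstoD)
  then have ts: "(\<lambda>k. ?t (real k)) \<longlonglongrightarrow> 0"
    by (rule filterlim_compose[OF _ filterlim_real_sequentially])
  have "\<exists>g\<in>L2. (\<lambda>k. L2_norm (\<lambda>x. fourier_integral c (real k) f x - g x)) \<longlonglongrightarrow> 0"
  proof (rule L2_complete)
    show "fourier_integral c (real k) f \<in> L2" for k
      by (intro fourier_integral_L2 f c)
    fix e :: real assume "e > 0"
    then have "\<forall>\<^sub>F k in sequentially. ?t (real k) < e / 2"
      by (intro order_tendstoD[OF ts]) auto
    then obtain N where N: "\<And>k. k \<ge> N \<Longrightarrow> ?t (real k) < e / 2"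
      by (auto simp: eventually_sequentially)
    have "L2_norm (\<lambda>x. fourier_integral c (real i) f x - fourier_integral c (real j) f x) \<le> e"
      if "i \<ge> N" "j \<ge> N" for i j
      using fourier_integral_diff_le[OF f c, of "real i" "real j"] N[OF that(1)] N[OF that(2)] by linarith
    then show "\<exists>N. \<forall>i\<ge>N. \<forall>j\<ge>N.
        L2_norm (\<lambda>x. fourier_integral c (real i) f x - fourier_integral c (real j) f x) \<le> e" by blast
  qed
  then obtain g where g: "g \<in> L2"
    and lim: "(\<lambda>k. L2_norm (\<lambda>x. fourier_integral c (real k) f x - g x)) \<longlonglongrightarrow> 0" by blast
  have le: "L2_norm (\<lambda>x. fourier_integral c R f x - g x) \<le> ?t R" for R
  proof (rule LIMSEQ_le_const)
    show "(\<lambda>k. ?t R + ?t (real k) + L2_norm (\<lambda>x. fourier_integral c (real k) f x - g x)) \<longlonglongrightarrow> ?t R"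
      using tendsto_add[OF tendsto_add[OF tendsto_const ts] lim] by simp
    have "L2_norm (\<lambda>x. fourier_integral c R f x - g x) \<le>
        ?t R + ?t (real k) + L2_norm (\<lambda>x. fourier_integral c (real k) f x - g x)" for k
      using fourier_integral_diff_le[OF f c, of R "real k"]
        L2_norm_triangle3[OF fourier_integral_L2(1)[OF f c] fourier_integral_L2(1)[OF f c] g, of R "real k"]
      by linarith
    then show "\<exists>N. \<forall>k\<ge>N. L2_norm (\<lambda>x. fourier_integral c R f x - g x) \<le>
        ?t R + ?t (real k) + L2_norm (\<lambda>x. fourier_integral c (real k) f x - g x)" by blast
  qed
  have "((\<lambda>R. L2_norm (\<lambda>x. fourier_integral c R f x - g x)) \<longlongrightarrow> 0) at_top"
    by (rule tendsto_sandwich[OF _ _ tendsto_const t]) (auto simp: le)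
  then have "L2_tendsto (\<lambda>R. fourier_integral c R f) g at_top"
    using g f c by (auto simp: L2_tendsto_def fourier_integral_L2)
  then show ?thesis
    unfolding L2_fourier_def by (rule someI[where P="\<lambda>g. L2_tendsto (\<lambda>R. fourier_integral c R f) g at_top"])
qed

lemma L2_fourier_L2 [simp]: "f \<in> L2 \<Longrightarrow> \<bar>c\<bar> = 1 \<Longrightarrow> L2_fourier c f \<in> L2"
  using L2_fourier_tendsto L2_tendstoD(1) by blast

lemma L2_tendsto_unique:
  assumes u: "L2_tendsto u f F" and v: "L2_tendsto u g F" and F: "F \<noteq> bot"
  shows "AE x in lborel. f x = g x"
proof -
  note f = L2_tendstoD[OF u] and g = L2_tendstoD[OF v]
  have "L2_norm (\<lambda>x. f x - g x) \<le> 0"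
  proof (rule tendsto_le[OF F _ tendsto_const])
    show "((\<lambda>k. L2_norm (\<lambda>x. u k x - f x) + L2_norm (\<lambda>x. u k x - g x)) \<longlongrightarrow> 0) F"
      using tendsto_add[OF f(3) g(3)] by simp
    show "\<forall>\<^sub>F k in F. L2_norm (\<lambda>x. f x - g x) \<le> L2_norm (\<lambda>x. u k x - f x) + L2_norm (\<lambda>x. u k x - g x)"
      using f(2)
    proof eventually_elim
      case (elim k)
      show ?case
        using L2_norm_triangle3[OF f(1) elim g(1)] L2_norm_diff_commute[of f "u k"] by simp
    qed
  qed
  then show ?thesis by (intro L2_AE_eqI f g)
qed

lemma L2_tendsto_lincomb:
  assumes u: "L2_tendsto u f F" and v: "L2_tendsto v g F"
  shows "L2_tendsto (\<lambda>k x. a * u k x + b * v k x) (\<lambda>x. a * f x + b * g x) F"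
proof -
  note f = L2_tendstoD[OF u] and g = L2_tendstoD[OF v]
  have "((\<lambda>k. norm a * L2_norm (\<lambda>x. u k x - f x) + norm b * L2_norm (\<lambda>x. v k x - g x)) \<longlongrightarrow> 0) F"
    using tendsto_add[OF tendsto_mult_right_zero[OF f(3)] tendsto_mult_right_zero[OF g(3)]] by simp
  moreover have "\<forall>\<^sub>F k in F. norm (L2_norm (\<lambda>x. (a * u k x + b * v k x) - (a * f x + b * g x))) \<le>
      norm a * L2_norm (\<lambda>x. u k x - f x) + norm b * L2_norm (\<lambda>x. v k x - g x)"
    using f(2) g(2)
  proof eventually_elim
    case (elim k)
    have df: "(\<lambda>x. u k x - f x) \<in> L2" and dg: "(\<lambda>x. v k x - g x) \<in> L2"
      using elim f(1) g(1) by (auto intro: L2_diff)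
    have "(\<lambda>x. (a * u k x + b * v k x) - (a * f x + b * g x)) =
        (\<lambda>x. a * (u k x - f x) + b * (v k x - g x))"
      by (auto simp: fun_eq_iff algebra_simps)
    then show ?case
      using L2_norm_triangle[OF L2_cmult(1)[OF df, of a] L2_cmult(1)[OF dg, of b]]
        L2_cmult(2)[OF df, of a] L2_cmult(2)[OF dg, of b] by simp
  qed
  ultimately have "((\<lambda>k. L2_norm (\<lambda>x. (a * u k x + b * v k x) - (a * f x + b * g x))) \<longlongrightarrow> 0) F"
    by (rule Lim_null_comparison[rotated])
  moreover have "\<forall>\<^sub>F k in F. (\<lambda>x. a * u k x + b * v k x) \<in> L2"
    using f(2) g(2) by eventually_elim (intro L2_add L2_cmult)
  ultimately show ?thesis
    unfolding L2_tendsto_def using f(1) g(1) by (auto intro: L2_add L2_cmult)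
qed

lemma L2_tendsto_norm:
  assumes u: "L2_tendsto u f F"
  shows "((\<lambda>k. L2_norm (u k)) \<longlongrightarrow> L2_norm f) F"
proof -
  note f = L2_tendstoD[OF u]
  have "\<forall>\<^sub>F k in F. norm (L2_norm (u k) - L2_norm f) \<le> L2_norm (\<lambda>x. u k x - f x)"
    using f(2)
  proof eventually_elim
    case (elim k)
    show ?case
      using L2_norm_le_add_diff[OF elim f(1)] L2_norm_le_add_diff[OF f(1) elim]
        L2_norm_diff_commute[of f "u k"] by simp
  qed
  from Lim_null_comparison[OF this f(3)] show ?thesis
    by (rule LIM_zero_cancel)
qed

lemma L2_tendsto_integral:
  assumes u: "L2_tendsto u f F" and v: "L2_tendsto v g F"
  shows "((\<lambda>k. \<integral>x. u k x * v k x \<partial>lborel) \<longlongrightarrow> (\<integral>x. f x * g x \<partial>lborel)) F"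
proof -
  note f = L2_tendstoD[OF u] and g = L2_tendstoD[OF v]
  have ev: "\<forall>\<^sub>F k in F. norm ((\<integral>x. u k x * v k x \<partial>lborel) - (\<integral>x. f x * g x \<partial>lborel)) \<le>
      L2_norm (\<lambda>x. u k x - f x) * L2_norm (v k) + L2_norm f * L2_norm (\<lambda>x. v k x - g x)"
    using f(2) g(2)
  proof eventually_elim
    case (elim k)
    note i = L2_mult_integrable
    have du: "(\<lambda>x. u k x - f x) \<in> L2" and dv: "(\<lambda>x. v k x - g x) \<in> L2"
      using elim f(1) g(1) by (auto intro: L2_diff)
    have "(\<integral>x. u k x * v k x \<partial>lborel) - (\<integral>x. f x * g x \<partial>lborel) =
        (\<integral>x. u k x * v k x - f x * g x \<partial>lborel)"
      by (intro Bochner_Integration.integral_diff[symmetric] i elim f(1) g(1))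
    also have "\<dots> = (\<integral>x. (u k x - f x) * v k x + f x * (v k x - g x) \<partial>lborel)"
      by (simp add: algebra_simps)
    also have "\<dots> = (\<integral>x. (u k x - f x) * v k x \<partial>lborel) + (\<integral>x. f x * (v k x - g x) \<partial>lborel)"
      by (intro Bochner_Integration.integral_add i elim f(1) du dv)
    finally have eq: "(\<integral>x. u k x * v k x \<partial>lborel) - (\<integral>x. f x * g x \<partial>lborel) =
        (\<integral>x. (u k x - f x) * v k x \<partial>lborel) + (\<integral>x. f x * (v k x - g x) \<partial>lborel)" .
    show ?case
      unfolding eq by (intro order.trans[OF norm_triangle_ineq] add_mono L2_mult_le du dv elim f(1))
  qed
  have lim: "((\<lambda>k. L2_norm (\<lambda>x. u k x - f x) * L2_norm (v k) + L2_norm f * L2_norm (\<lambda>x. v k x - g x))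
      \<longlongrightarrow> 0 * L2_norm g + L2_norm f * 0) F"
    by (intro tendsto_intros f g L2_tendsto_norm[OF v])
  have "((\<lambda>k. (\<integral>x. u k x * v k x \<partial>lborel) - (\<integral>x. f x * g x \<partial>lborel)) \<longlongrightarrow> 0) F"
    by (rule Lim_null_comparison[OF ev]) (use lim in simp)
  then show ?thesis by (rule LIM_zero_cancel)
qed

lemma L2_fourier_unique:
  assumes "f \<in> L2" "\<bar>c\<bar> = 1" "L2_tendsto (\<lambda>R. fourier_integral c R f) g at_top"
  shows "AE x in lborel. L2_fourier c f x = g x"
  by (rule L2_tendsto_unique[OF L2_fourier_tendsto assms(3)]) (use assms in auto)

lemma L2_fourier_norm_le:
  assumes f: "f \<in> L2" and c: "\<bar>c\<bar> = 1"
  shows "L2_norm (L2_fourier c f) \<le> L2_norm f"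
proof (rule tendsto_upperbound)
  show "((\<lambda>R. L2_norm (fourier_integral c R f)) \<longlongrightarrow> L2_norm (L2_fourier c f)) at_top"
    by (intro L2_tendsto_norm L2_fourier_tendsto f c)
  show "\<forall>\<^sub>F R in at_top. L2_norm (fourier_integral c R f) \<le> L2_norm f"
    by (intro always_eventually allI order.trans[OF fourier_integral_L2(2) truncation_L2(3)] f c)
qed auto

lemma L2_fourier_bounded_support:
  fixes f :: "real^'n \<Rightarrow> complex"
  assumes f: "f \<in> L2" and c: "\<bar>c\<bar> = 1" and r: "\<And>x. norm x > r \<Longrightarrow> f x = 0"
  shows "AE \<xi> in lborel. L2_fourier c f \<xi> = unitary_factor TYPE('n) *\<^sub>R raw_fourier c f \<xi>"
proof (rule L2_fourier_unique[OF f c])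
  have eq: "\<forall>\<^sub>F R in at_top. fourier_integral c R f = (\<lambda>\<xi>. unitary_factor TYPE('n) *\<^sub>R raw_fourier c f \<xi>)"
    using eventually_ge_at_top[of r]
    by eventually_elim (auto simp: fourier_integral_eq_raw truncation_eq r)
  have L2: "(\<lambda>\<xi>. unitary_factor TYPE('n) *\<^sub>R raw_fourier c f \<xi>) \<in> L2"
    using fourier_integral_L2(1)[OF f c, of r] by (simp add: fourier_integral_eq_raw truncation_eq r)
  show "L2_tendsto (\<lambda>R. fourier_integral c R f) (\<lambda>\<xi>. unitary_factor TYPE('n) *\<^sub>R raw_fourier c f \<xi>) at_top"
    unfolding L2_tendsto_def
  proof (intro conjI L2 tendsto_eventually always_eventually[OF allI[OF fourier_integral_L2(1)[OF f c]]])
    show "\<forall>\<^sub>F R in at_top. L2_norm (\<lambda>x. fourier_integral c R f x - unitary_factor TYPE('n) *\<^sub>R raw_fourier c f x) = 0"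
      using eq by eventually_elim (simp only: diff_self L2_zero)
  qed
qed

lemma L2_fourier_lincomb:
  assumes f: "f \<in> L2" and g: "g \<in> L2" and c: "\<bar>c\<bar> = 1"
  shows "AE \<xi> in lborel. L2_fourier c (\<lambda>x. a * f x + b * g x) \<xi> = a * L2_fourier c f \<xi> + b * L2_fourier c g \<xi>"
proof (rule L2_fourier_unique[OF _ c])
  show "(\<lambda>x. a * f x + b * g x) \<in> L2" by (intro L2_add L2_cmult f g)
  show "L2_tendsto (\<lambda>R. fourier_integral c R (\<lambda>x. a * f x + b * g x)) (\<lambda>\<xi>. a * L2_fourier c f \<xi> + b * L2_fourier c g \<xi>) at_top"
    unfolding fourier_integral_lincomb[OF f g] by (intro L2_tendsto_lincomb L2_fourier_tendsto f g c)
qed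

text \<open>
Almost equal functions have identical Fourier integrals, so the choice operator returns the
same representative for both. This equality everywhere saves many almost-everywhere steps below.
\<close>

lemma L2_fourier_cong_AE:
  assumes fg: "AE x in lborel. f x = g x" and f: "f \<in> L2" and g: "g \<in> L2"
  shows "L2_fourier c f = L2_fourier c g"
proof -
  have "raw_fourier c (truncation R f) \<xi> = raw_fourier c (truncation R g) \<xi>" for R \<xi>
    unfolding raw_fourier_def
  proof (rule integral_cong_AE)
    show "AE x in lborel. cis (c * (x \<bullet> \<xi>)) * truncation R f x = cis (c * (x \<bullet> \<xi>)) * truncation R g x"
      using fg by eventually_elim (simp add: truncation_def)
  qed (intro borel_measurable_integrable raw_fourier_integrable truncation_L2 f g)+
  then show ?thesis
    by (simp only: L2_fourier_def fourier_integral_eq_raw)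
qed

lemma L2_fourier_cnj:
  assumes f: "f \<in> L2" and c: "\<bar>c\<bar> = 1"
  shows "AE \<xi> in lborel. L2_fourier (- c) (\<lambda>x. cnj (f x)) \<xi> = cnj (L2_fourier c f \<xi>)"
proof (rule L2_fourier_unique)
  have eq: "fourier_integral (- c) R (\<lambda>x. cnj (f x)) = (\<lambda>\<xi>. cnj (fourier_integral c R f \<xi>))" for R
  proof -
    have "truncation R (\<lambda>x. cnj (f x)) = (\<lambda>x. cnj (truncation R f x))"
      by (auto simp: truncation_def indicator_def)
    then show ?thesis
      unfolding fourier_integral_eq_raw by (intro ext) (simp add: cnj_raw_fourier scaleR_conv_of_real)
  qed
  have n: "L2_norm (\<lambda>x. cnj (u x) - cnj (v x)) = L2_norm (\<lambda>x. u x - v x)" for u v :: "real^'a \<Rightarrow> complex"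
    by (intro L2_norm_cong) (simp flip: complex_cnj_diff)
  show "L2_tendsto (\<lambda>R. fourier_integral (- c) R (\<lambda>x. cnj (f x))) (\<lambda>\<xi>. cnj (L2_fourier c f \<xi>)) at_top"
    unfolding eq using L2_fourier_tendsto[OF f c] f c
    by (auto simp: L2_tendsto_def n intro!: L2_cnj always_eventually fourier_integral_L2)
qed (use f c in \<open>auto intro: L2_cnj\<close>)

text \<open>
The multiplication formula survives the limit. Together with complex conjugation (\<open>L2_fourier_cnj\<close>) it says
that the transform of opposite sign is the adjoint.
\<close>

lemma L2_fourier_symmetric:
  fixes f :: "real^'n \<Rightarrow> complex"
  assumes f: "f \<in> L2" and g: "g \<in> L2" and c: "\<bar>c\<bar> = 1"
  shows "(\<integral>\<xi>. L2_fourier c f \<xi> * g \<xi> \<partial>lborel) = (\<integral>x. f x * L2_fourier c g x \<partial>lborel)"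
proof -
  have "(\<integral>\<xi>. fourier_integral c R f \<xi> * truncation R g \<xi> \<partial>lborel) =
      (\<integral>x. truncation R f x * fourier_integral c R g x \<partial>lborel)" for R
  proof -
    have "(\<integral>\<xi>. unitary_factor TYPE('n) *\<^sub>R (raw_fourier c (truncation R f) \<xi> * truncation R g \<xi>) \<partial>lborel) =
        (\<integral>x. unitary_factor TYPE('n) *\<^sub>R (truncation R f x * raw_fourier c (truncation R g) x) \<partial>lborel)"
      by (simp only: integral_scaleR_right raw_fourier_swap[OF truncation_L2(2)[OF f] truncation_L2(2)[OF g]])
    then show ?thesis by (simp add: fourier_integral_eq_raw)
  qed
  then have "((\<lambda>R. \<integral>x. truncation R f x * fourier_integral c R g x \<partial>lborel) \<longlongrightarrow>
      (\<integral>\<xi>. L2_fourier c f \<xi> * g \<xi> \<partial>lborel)) at_top"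
    using L2_tendsto_integral[OF L2_fourier_tendsto[OF f c] truncation_tendsto[OF g]] by simp
  then show ?thesis
    by (rule tendsto_unique[OF trivial_limit_at_top_linorder])
      (rule L2_tendsto_integral[OF truncation_tendsto[OF f] L2_fourier_tendsto[OF g c]])
qed

text \<open>
On a ball \<open>h\<close> is integrable, and the sets on which it integrates to zero form a Dynkin system
containing the open sets, which are stable under intersection and generate the Borel sets.
\<close>

lemma L2_ae_zero_of_integrals_open:
  fixes h :: "real^'n \<Rightarrow> complex"
  assumes h: "h \<in> L2"
    and 0: "\<And>U. open U \<Longrightarrow> bounded U \<Longrightarrow> (\<integral>x. h x * indicator U x \<partial>lborel) = 0"
  shows "AE x in lborel. h x = 0"
proof -
  note [measurable] = L2_measurable[OF h]
  have ball: "AE x in lborel. indicator (ball 0 (real k)) x * h x = 0" for k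
  proof (rule sigma_finite_measure.density_zero[OF sigma_finite_lborel])
    let ?h = "\<lambda>x. indicator (ball 0 (real k)) x * h x"
    show int: "integrable lborel ?h"
      using emeasure_bounded_finite[of "ball 0 (real k) :: (real^'n) set"]
      by (intro L2_integrable_indicator h) auto
    have si: "set_integrable lborel A ?h" if "A \<in> sets borel" for A
      unfolding set_integrable_def using that by (intro integrable_mult_indicator int) auto
    have op: "set_lebesgue_integral lborel U ?h = 0" if "open U" for U
    proof -
      have "set_lebesgue_integral lborel U ?h = (\<integral>x. h x * indicator (U \<inter> ball 0 (real k)) x \<partial>lborel)"
        unfolding set_lebesgue_integral_def
        by (intro Bochner_Integration.integral_cong) (auto simp: indicator_def)
      also have "\<dots> = 0"
        using that by (intro 0) auto
      finally show ?thesis .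
    qed
    have all: "set_lebesgue_integral lborel UNIV ?h = 0" by (rule op) simp
    fix A :: "(real^'n) set" assume "A \<in> sets lborel"
    then have A: "A \<in> sigma_sets UNIV {S. open S}"
      by (simp add: borel_def)
    have m: "B \<in> sets borel" if "B \<in> sigma_sets UNIV {S. open S}" for B :: "(real^'n) set"
      using that by (simp add: borel_def)
    show "set_lebesgue_integral lborel A ?h = 0"
    proof (rule sigma_sets_induct_disjoint[OF _ _ A])
      show "Int_stable {S :: (real^'n) set. open S}" by (auto simp: Int_stable_def)
      show "set_lebesgue_integral lborel B ?h = 0" if "B \<in> {S. open S}" for B
        using that op by simp
      show "set_lebesgue_integral lborel {} ?h = 0" by (rule op) simp
      show "set_lebesgue_integral lborel (UNIV - B) ?h = 0"
        if B: "B \<in> sigma_sets UNIV {S. open S}" and "set_lebesgue_integral lborel B ?h = 0" for B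
      proof -
        have "set_lebesgue_integral lborel (B \<union> (UNIV - B)) ?h =
            set_lebesgue_integral lborel B ?h + set_lebesgue_integral lborel (UNIV - B) ?h"
          using m[OF B] by (intro set_integral_Un si) auto
        with that all show ?thesis by simp
      qed
      show "set_lebesgue_integral lborel (\<Union>i. B i) ?h = 0"
        if "disjoint_family B" "range B \<subseteq> sigma_sets UNIV {S. open S}"
          and "\<And>i. set_lebesgue_integral lborel (B i) ?h = 0" for B :: "nat \<Rightarrow> _"
      proof -
        have Bm: "B i \<in> sets borel" for i using that(2) m by blast
        have "set_lebesgue_integral lborel (\<Union>i. B i) ?h = (\<Sum>i. set_lebesgue_integral lborel (B i) ?h)"
          using Bm that(1) by (intro lebesgue_integral_countable_add si) (auto simp: disjoint_family_on_def)
        with that(3) show ?thesis by simp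
      qed
    qed simp
  qed
  have "AE x in lborel. \<forall>k. indicator (ball 0 (real k)) x * h x = 0"
    by (intro AE_all_countable[THEN iffD2] allI ball)
  then show ?thesis
  proof eventually_elim
    case (elim x)
    obtain k where "norm x < real k" using reals_Archimedean2 by blast
    with elim show ?case by (auto simp: indicator_def dest!: spec[of _ k])
  qed
qed

text \<open>
With \<open>w\<close> the transform of \<open>u = 1\<^bsub>U\<^esub>\<close> transformed back, \<open>\<langle>w, u\<rangle> = \<parallel>F u\<parallel>\<^sup>2 = \<parallel>u\<parallel>\<^sup>2\<close> and \<open>\<parallel>w\<parallel> \<le> \<parallel>u\<parallel>\<close>. Hence
\<open>\<parallel>w - u\<parallel>\<^sup>2 = \<parallel>w\<parallel>\<^sup>2 - 2 Re \<langle>w, u\<rangle> + \<parallel>u\<parallel>\<^sup>2 \<le> 0\<close>.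
\<close>

lemma L2_fourier_inverse_open:
  fixes U :: "(real^'n) set"
  assumes U: "open U" "bounded U" and c: "\<bar>c\<bar> = 1"
  shows "AE x in lborel. L2_fourier (- c) (L2_fourier c (indicator U)) x = indicator U x"
proof -
  define u :: "real^'n \<Rightarrow> complex" where "u = indicator U"
  have [measurable]: "U \<in> sets borel" using U by simp
  have u: "u \<in> L2"
    using L2_indicator(1)[of U] emeasure_bounded_finite[OF U(2)] by (simp add: u_def)
  have c': "\<bar>- c\<bar> = 1" using c by simp
  \<comment> \<open>since \<open>u\<close> is real, the two transforms of \<open>u\<close> are conjugate to each other\<close>
  have cu: "(\<lambda>x. cnj (u x)) = u" by (auto simp: u_def indicator_def)
  obtain r where r: "\<And>x. x \<in> U \<Longrightarrow> norm x \<le> r"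
    using U(2) by (auto simp: bounded_iff)
  have "AE \<xi> in lborel. L2_fourier c u \<xi> = unitary_factor TYPE('n) *\<^sub>R raw_fourier c u \<xi>"
    by (rule L2_fourier_bounded_support[OF u c, of r]) (use r in \<open>force simp: u_def indicator_def\<close>)
  then have iso: "L2_norm (L2_fourier c u) = L2_norm u"
    using raw_fourier_isometry_open[OF U c] L2_norm_cong_AE(2)[OF L2_fourier_L2[OF u c], of "\<lambda>\<xi>. unitary_factor TYPE('n) *\<^sub>R raw_fourier c u \<xi>"]
    by (simp add: u_def)
  define w where "w = L2_fourier (- c) (L2_fourier c u)"
  have w: "w \<in> L2" unfolding w_def by (intro L2_fourier_L2 u c c')
  have wn: "L2_norm w \<le> L2_norm u"
    unfolding w_def using L2_fourier_norm_le[OF L2_fourier_L2[OF u c] c'] iso by simp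
  have "(\<integral>x. w x * cnj (- u x) \<partial>lborel) = - (\<integral>x. w x * cnj (u x) \<partial>lborel)"
    by simp
  also have "(\<integral>x. w x * cnj (u x) \<partial>lborel) = (\<integral>x. w x * u x \<partial>lborel)"
    using cu by metis
  also have "\<dots> = (\<integral>\<xi>. L2_fourier c u \<xi> * L2_fourier (- c) u \<xi> \<partial>lborel)"
    unfolding w_def by (intro L2_fourier_symmetric L2_fourier_L2 u c c')
  also have "\<dots> = (\<integral>\<xi>. complex_of_real ((norm (L2_fourier c u \<xi>))\<^sup>2) \<partial>lborel)"
  proof (intro integral_cong_AE)
    show "AE \<xi> in lborel. L2_fourier c u \<xi> * L2_fourier (- c) u \<xi> = complex_of_real ((norm (L2_fourier c u \<xi>))\<^sup>2)"
      using L2_fourier_cnj[OF u c] unfolding cu by eventually_elim (simp only: complex_norm_square)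
  qed (use L2_fourier_L2[OF u c] L2_fourier_L2[OF u c'] in \<open>auto dest!: L2_measurable\<close>)
  also have "\<dots> = of_real ((L2_norm u)\<^sup>2)"
    unfolding integral_complex_of_real L2_norm_sq[symmetric] iso ..
  finally have ip: "(\<integral>x. w x * cnj (- u x) \<partial>lborel) = - of_real ((L2_norm u)\<^sup>2)" .
  have "(L2_norm (\<lambda>x. w x - u x))\<^sup>2 = (L2_norm w)\<^sup>2 - 2 * (L2_norm u)\<^sup>2 + (L2_norm u)\<^sup>2"
    using L2_norm_add_sq[OF w L2_cmult(1)[OF u, of "-1"]] L2_cmult(2)[OF u, of "-1"] ip by simp
  also have "\<dots> \<le> 0"
    using power_mono[OF wn, of 2] by simp
  finally have "L2_norm (\<lambda>x. w x - u x) \<le> 0" by simp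
  then show ?thesis
    using L2_AE_eqI[OF w u] by (simp add: w_def u_def)
qed

text \<open>
Duality: by symmetry the composite tested against an indicator \<open>u\<close> equals \<open>f\<close> tested against the composite of
opposite order applied to \<open>u\<close>, which is \<open>u\<close> itself.
\<close>

theorem L2_fourier_inverse:
  fixes f :: "real^'n \<Rightarrow> complex"
  assumes f: "f \<in> L2" and c: "\<bar>c\<bar> = 1"
  shows "AE x in lborel. L2_fourier (- c) (L2_fourier c f) x = f x"
proof -
  have c': "\<bar>- c\<bar> = 1" using c by simp
  define w where "w = L2_fourier (- c) (L2_fourier c f)"
  have w: "w \<in> L2" unfolding w_def by (intro L2_fourier_L2 f c c')
  have "AE x in lborel. w x - f x = 0"
  proof (rule L2_ae_zero_of_integrals_open)
    show "(\<lambda>x. w x - f x) \<in> L2" by (intro L2_diff w f)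
    fix U :: "(real^'n) set" assume U: "open U" "bounded U"
    define u :: "real^'n \<Rightarrow> complex" where "u = indicator U"
    have u: "u \<in> L2"
      using L2_indicator(1)[of U] U emeasure_bounded_finite[OF U(2)] by (simp add: u_def)
    have "(\<integral>x. w x * u x \<partial>lborel) = (\<integral>x. L2_fourier c f x * L2_fourier (- c) u x \<partial>lborel)"
      unfolding w_def by (intro L2_fourier_symmetric L2_fourier_L2 u f c c')
    also have "\<dots> = (\<integral>x. f x * L2_fourier c (L2_fourier (- c) u) x \<partial>lborel)"
      by (intro L2_fourier_symmetric L2_fourier_L2 u f c c')
    also have "\<dots> = (\<integral>x. f x * u x \<partial>lborel)"
    proof (intro integral_cong_AE)
      show "AE x in lborel. f x * L2_fourier c (L2_fourier (- c) u) x = f x * u x"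
        using L2_fourier_inverse_open[OF U c'] by (auto simp: u_def)
    qed (use L2_fourier_L2[OF L2_fourier_L2[OF u c'] c] f u in \<open>auto dest!: L2_measurable\<close>)
    finally have "(\<integral>x. w x * u x \<partial>lborel) - (\<integral>x. f x * u x \<partial>lborel) = 0" by simp
    then show "(\<integral>x. (w x - f x) * indicator U x \<partial>lborel) = 0"
      using L2_mult_integrable[OF w u] L2_mult_integrable[OF f u]
      by (simp add: left_diff_distrib u_def)
  qed
  then show ?thesis by (simp add: w_def)
qed

lemma L2_fourier_norm:
  assumes f: "f \<in> L2" and c: "\<bar>c\<bar> = 1"
  shows "L2_norm (L2_fourier c f) = L2_norm f"
proof (rule antisym[OF L2_fourier_norm_le[OF f c]])
  have c': "\<bar>- c\<bar> = 1" using c by simp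
  have "L2_norm f = L2_norm (L2_fourier (- c) (L2_fourier c f))"
    by (intro L2_norm_cong_AE(2)[OF _ L2_measurable[OF f] L2_fourier_inverse[OF f c]] L2_fourier_L2 f c c')
  also have "\<dots> \<le> L2_norm (L2_fourier c f)"
    by (intro L2_fourier_norm_le L2_fourier_L2 f c c')
  finally show "L2_norm f \<le> L2_norm (L2_fourier c f)" .
qed

lemma L2_fourier_parseval:
  assumes f: "f \<in> L2" and g: "g \<in> L2" and c: "\<bar>c\<bar> = 1"
  shows "(\<integral>\<xi>. L2_fourier c f \<xi> * cnj (L2_fourier c g \<xi>) \<partial>lborel) = (\<integral>x. f x * cnj (g x) \<partial>lborel)"
proof -
  have c': "\<bar>- c\<bar> = 1" using c by simp
  have g': "(\<lambda>x. cnj (g x)) \<in> L2" by (intro L2_cnj g)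
  have "(\<integral>\<xi>. L2_fourier c f \<xi> * cnj (L2_fourier c g \<xi>) \<partial>lborel) = (\<integral>\<xi>. L2_fourier c f \<xi> * L2_fourier (- c) (\<lambda>x. cnj (g x)) \<xi> \<partial>lborel)"
    using L2_fourier_cnj[OF g c] L2_fourier_L2[OF f c] L2_fourier_L2[OF g' c'] L2_fourier_L2[OF g c]
    by (intro integral_cong_AE) (auto dest!: L2_measurable)
  also have "\<dots> = (\<integral>x. f x * L2_fourier c (L2_fourier (- c) (\<lambda>x. cnj (g x))) x \<partial>lborel)"
    by (intro L2_fourier_symmetric L2_fourier_L2 f g' c c')
  also have "\<dots> = (\<integral>x. f x * cnj (g x) \<partial>lborel)"
    using L2_fourier_inverse[OF g' c'] L2_fourier_L2[OF L2_fourier_L2[OF g' c'] c] f g'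
    by (intro integral_cong_AE) (auto dest!: L2_measurable)
  finally show ?thesis .
qed

section \<open>The unitary group\<close>

text \<open>
The multiplier of \<open>e\<^bsup>-itH\<^esup>\<close>.
\<close>

definition phase :: "real \<Rightarrow> real \<Rightarrow> real^'n \<Rightarrow> complex" where
  "phase s t \<xi> = cis (- (t * norm \<xi> powr s))"

lemma phase_measurable [measurable]: "phase s t \<in> borel_measurable borel"
  unfolding phase_def by measurable

lemma norm_phase [simp]: "norm (phase s t \<xi>) = 1"
  by (simp add: phase_def)

lemma phase_add: "phase s (a + b) \<xi> = phase s a \<xi> * phase s b \<xi>"
  by (simp add: phase_def cis_mult algebra_simps)

lemma phase_zero [simp]: "phase s 0 \<xi> = 1"
  by (simp add: phase_def)

lemma phase_mult_L2:
  assumes "f \<in> L2"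
  shows "(\<lambda>\<xi>. phase s t \<xi> * f \<xi>) \<in> L2" "L2_norm (\<lambda>\<xi>. phase s t \<xi> * f \<xi>) = L2_norm f"
  by (intro L2_mult_unimodular assms phase_measurable norm_phase)+

lemma propagator_eq:
  fixes f :: "real^'n \<Rightarrow> complex"
  shows "propagator s t f = L2_fourier 1 (\<lambda>\<xi>. phase s t \<xi> * L2_fourier (-1) f \<xi>)"
proof -
  have "exp (- (\<i> * of_real t * of_real (norm \<xi> powr s))) = phase s t \<xi>" for \<xi> :: "real^'n"
    by (simp add: phase_def cis_conv_exp ac_simps)
  then show ?thesis
    unfolding propagator_def frac_laplacian_calculus_def fourier_eq_L2_fourier inv_fourier_eq_L2_fourier by simp
qed

lemma propagator_L2 [simp]:
  assumes "f \<in> L2"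
  shows "propagator s t f \<in> L2" "L2_norm (propagator s t f) = L2_norm f"
  using assms by (simp_all add: propagator_eq phase_mult_L2 L2_fourier_norm)

lemma propagator_cong_AE:
  assumes "AE x in lborel. f x = g x" "f \<in> L2" "g \<in> L2"
  shows "propagator s t f = propagator s t g"
  unfolding propagator_eq L2_fourier_cong_AE[OF assms] ..

lemma propagator_lincomb:
  assumes f: "f \<in> L2" and g: "g \<in> L2"
  shows "AE x in lborel. propagator s t (\<lambda>x. a * f x + b * g x) x =
    a * propagator s t f x + b * propagator s t g x"
proof -
  let ?F = "\<lambda>\<xi>. phase s t \<xi> * L2_fourier (-1) f \<xi>" and ?G = "\<lambda>\<xi>. phase s t \<xi> * L2_fourier (-1) g \<xi>"
  have F: "?F \<in> L2" and G: "?G \<in> L2" using f g by (simp_all add: phase_mult_L2)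
  have fg: "(\<lambda>x. a * f x + b * g x) \<in> L2" by (intro L2_add L2_cmult f g)
  have ae: "AE \<xi> in lborel. phase s t \<xi> * L2_fourier (-1) (\<lambda>x. a * f x + b * g x) \<xi> = a * ?F \<xi> + b * ?G \<xi>"
    using L2_fourier_lincomb[OF f g, of "-1" a b, simplified] by eventually_elim (simp add: algebra_simps)
  have "propagator s t (\<lambda>x. a * f x + b * g x) = L2_fourier 1 (\<lambda>\<xi>. a * ?F \<xi> + b * ?G \<xi>)"
    unfolding propagator_eq
    by (rule L2_fourier_cong_AE[OF ae]) (use F G fg in \<open>auto intro!: phase_mult_L2 L2_add L2_cmult\<close>)
  then show ?thesis
    using L2_fourier_lincomb[OF F G, of 1 a b] by (simp add: propagator_eq)
qed

lemma L2_fourier_propagator: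
  assumes f: "f \<in> L2"
  shows "AE \<xi> in lborel. L2_fourier (-1) (propagator s t f) \<xi> = phase s t \<xi> * L2_fourier (-1) f \<xi>"
  unfolding propagator_eq using L2_fourier_inverse[of "\<lambda>\<xi>. phase s t \<xi> * L2_fourier (-1) f \<xi>" 1] f
  by (simp add: phase_mult_L2)

lemma propagator_propagator:
  assumes f: "f \<in> L2"
  shows "propagator s a (propagator s b f) = propagator s (a + b) f"
proof -
  have "AE \<xi> in lborel. phase s a \<xi> * L2_fourier (-1) (propagator s b f) \<xi> = phase s (a + b) \<xi> * L2_fourier (-1) f \<xi>"
    using L2_fourier_propagator[OF f, of s b] by eventually_elim (simp add: phase_add)
  then show ?thesis
    unfolding propagator_eq[of s a] propagator_eq[of s "a + b"]
    by (rule L2_fourier_cong_AE) (use f in \<open>auto intro!: phase_mult_L2\<close>)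
qed

lemma propagator_zero:
  assumes f: "f \<in> L2"
  shows "AE x in lborel. propagator s 0 f x = f x"
  unfolding propagator_eq using L2_fourier_inverse[OF f, of "-1"] by simp

lemma propagator_inner:
  assumes f: "f \<in> L2" and g: "g \<in> L2"
  shows "(\<integral>x. propagator s t f x * cnj (g x) \<partial>lborel) =
    (\<integral>\<xi>. phase s t \<xi> * (L2_fourier (-1) f \<xi> * cnj (L2_fourier (-1) g \<xi>)) \<partial>lborel)"
proof -
  note m = L2_measurable[OF L2_fourier_L2[OF f, of "-1", simplified]] L2_measurable[OF L2_fourier_L2[OF g, of "-1", simplified]]
    L2_measurable[OF L2_fourier_L2[OF propagator_L2(1)[OF f, of s t], of "-1", simplified]]
  have "(\<integral>x. propagator s t f x * cnj (g x) \<partial>lborel) =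
      (\<integral>\<xi>. L2_fourier (-1) (propagator s t f) \<xi> * cnj (L2_fourier (-1) g \<xi>) \<partial>lborel)"
    using f g by (intro L2_fourier_parseval[symmetric]) auto
  also have "\<dots> = (\<integral>\<xi>. phase s t \<xi> * (L2_fourier (-1) f \<xi> * cnj (L2_fourier (-1) g \<xi>)) \<partial>lborel)"
  proof (rule integral_cong_AE)
    show "AE \<xi> in lborel. L2_fourier (-1) (propagator s t f) \<xi> * cnj (L2_fourier (-1) g \<xi>) =
        phase s t \<xi> * (L2_fourier (-1) f \<xi> * cnj (L2_fourier (-1) g \<xi>))"
      using L2_fourier_propagator[OF f, of s t] by eventually_elim simp
  qed (use m in auto)
  finally show ?thesis .
qed

section \<open>Integration by parts with difference quotients\<close>

lemma lborel_integral_translate: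
  fixes f :: "'a::euclidean_space \<Rightarrow> 'b::{banach, second_countable_topology}"
  assumes [measurable]: "f \<in> borel_measurable borel"
  shows "(\<integral>x. f (x + v) \<partial>lborel) = (\<integral>x. f x \<partial>lborel)"
  by (subst (2) lborel_distr_plus[symmetric, of v]) (simp add: integral_distr add.commute)

lemma L2_translate:
  assumes f: "f \<in> L2"
  shows "(\<lambda>x. f (x + v)) \<in> L2" "L2_norm (\<lambda>x. f (x + v)) = L2_norm f"
proof -
  note [measurable] = L2_measurable[OF f]
  have "(\<integral>\<^sup>+x. ennreal ((norm (f (v + x)))\<^sup>2) \<partial>lborel) = (\<integral>\<^sup>+x. ennreal ((norm (f x))\<^sup>2) \<partial>lborel)"
    by (rule lborel_nn_integral_translate[of "\<lambda>x. ennreal ((norm (f x))\<^sup>2)"]) measurable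
  then show "(\<lambda>x. f (x + v)) \<in> L2"
    using f by (simp add: L2_iff_nn_integral add.commute)
  show "L2_norm (\<lambda>x. f (x + v)) = L2_norm f"
    unfolding L2_norm_def by (subst lborel_integral_translate[of "\<lambda>x. (norm (f x))\<^sup>2"]) auto
qed

text \<open>
Integration by parts along \<open>v\<close>, with \<open>D\<close> the derivative of \<open>V\<close>. By translation invariance the integral of
\<open>(V(\<xi> + tv) - V(\<xi>)) h k\<close> equals one in which the increments have moved to \<open>h\<close> and \<open>k\<close>, where they cost
\<open>\<bar>t\<bar> r\<close> and \<open>\<bar>t\<bar> R\<close> in norm. Division by \<open>t\<close> and dominated convergence give the bound.
\<close>

lemma translation_derivative_bound:
  fixes h k :: "real^'n \<Rightarrow> complex"
  assumes h: "h \<in> L2" and k: "k \<in> L2"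
    and hv: "\<And>t. L2_norm (\<lambda>\<xi>. h (\<xi> + t *\<^sub>R v) - h \<xi>) \<le> \<bar>t\<bar> * r * H" and H: "L2_norm h \<le> H"
    and kv: "\<And>t. L2_norm (\<lambda>\<xi>. k (\<xi> + t *\<^sub>R v) - k \<xi>) \<le> \<bar>t\<bar> * R * K" and K: "L2_norm k \<le> K"
    and r: "0 \<le> r" "0 \<le> R"
    and V: "V \<in> borel_measurable borel" and B: "\<And>\<xi>. norm (V \<xi>) \<le> B"
    and L: "\<And>\<xi> t. norm (V (\<xi> + t *\<^sub>R v) - V \<xi>) \<le> L * \<bar>t\<bar>"
    and D: "D \<in> borel_measurable borel"
    and lim: "\<And>\<xi>. ((\<lambda>t. (V (\<xi> + t *\<^sub>R v) - V \<xi>) /\<^sub>R t) \<longlongrightarrow> D \<xi>) (at 0)"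
  shows "integrable lborel (\<lambda>\<xi>. D \<xi> * (h \<xi> * k \<xi>))"
    and "norm (\<integral>\<xi>. D \<xi> * (h \<xi> * k \<xi>) \<partial>lborel) \<le> (r + R) * B * (H * K)"
proof -
  note [measurable] = L2_measurable[OF h] L2_measurable[OF k] V D
  have B0: "0 \<le> B" using B[of 0] norm_ge_zero order.trans by blast
  have H0: "0 \<le> H" and K0: "0 \<le> K" using H K L2_norm_nonneg order.trans by blast+
  define P where "P \<xi> = h \<xi> * k \<xi>" for \<xi>
  have P: "integrable lborel P" unfolding P_def by (intro L2_mult_integrable h k)
  have Pm[measurable]: "P \<in> borel_measurable borel" unfolding P_def by measurable
  have step: "norm (\<integral>\<xi>. (V (\<xi> + t *\<^sub>R v) - V \<xi>) * P \<xi> \<partial>lborel) \<le> \<bar>t\<bar> * ((r + R) * B * (H * K))" for t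
  proof -
    let ?\<tau> = "\<lambda>f \<xi>. f (\<xi> + t *\<^sub>R v)"
    have hd: "(\<lambda>\<xi>. ?\<tau> h \<xi> - h \<xi>) \<in> L2" and kd: "(\<lambda>\<xi>. ?\<tau> k \<xi> - k \<xi>) \<in> L2"
      by (intro L2_diff L2_translate h k)+
    have Vm: "?\<tau> V \<in> borel_measurable borel" by measurable
    have V1: "(\<lambda>\<xi>. ?\<tau> V \<xi> * f \<xi>) \<in> L2" "L2_norm (\<lambda>\<xi>. ?\<tau> V \<xi> * f \<xi>) \<le> B * L2_norm f" if "f \<in> L2" for f
      using L2_mult_bounded[OF that Vm B] by auto
    have V0: "(\<lambda>\<xi>. V \<xi> * f \<xi>) \<in> L2" if "f \<in> L2" for f
      by (intro L2_mult_bounded(1)[OF _ _ B] that V)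
    have i1: "integrable lborel (\<lambda>\<xi>. ?\<tau> V \<xi> * h \<xi> * k \<xi>)"
      by (intro L2_mult_integrable V1 h k)
    have i2: "integrable lborel (\<lambda>\<xi>. V \<xi> * h \<xi> * k \<xi>)"
      by (intro L2_mult_integrable V0 h k)
    have i3: "integrable lborel (\<lambda>\<xi>. ?\<tau> V \<xi> * ?\<tau> h \<xi> * (?\<tau> k \<xi> - k \<xi>))"
      by (intro L2_mult_integrable V1 L2_translate h kd)
    have i4: "integrable lborel (\<lambda>\<xi>. ?\<tau> V \<xi> * (?\<tau> h \<xi> - h \<xi>) * k \<xi>)"
      by (intro L2_mult_integrable V1 hd k)
    have i5: "integrable lborel (\<lambda>\<xi>. ?\<tau> V \<xi> * ?\<tau> h \<xi> * ?\<tau> k \<xi>)"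
      by (intro L2_mult_integrable V1 L2_translate h k)
    have tr: "(\<integral>\<xi>. ?\<tau> V \<xi> * ?\<tau> h \<xi> * ?\<tau> k \<xi> \<partial>lborel) = (\<integral>\<xi>. V \<xi> * h \<xi> * k \<xi> \<partial>lborel)"
      by (rule lborel_integral_translate[of "\<lambda>\<xi>. V \<xi> * h \<xi> * k \<xi>"]) measurable
    \<comment> \<open>summation by parts: the unshifted product is replaced by the shifted one, which has the same integral\<close>
    have "(\<integral>\<xi>. (?\<tau> V \<xi> - V \<xi>) * P \<xi> \<partial>lborel) = (\<integral>\<xi>. ?\<tau> V \<xi> * h \<xi> * k \<xi> - V \<xi> * h \<xi> * k \<xi> \<partial>lborel)"
      by (simp add: P_def algebra_simps)
    also have "\<dots> = (\<integral>\<xi>. ?\<tau> V \<xi> * h \<xi> * k \<xi> \<partial>lborel) - (\<integral>\<xi>. ?\<tau> V \<xi> * ?\<tau> h \<xi> * ?\<tau> k \<xi> \<partial>lborel)"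
      unfolding tr by (rule Bochner_Integration.integral_diff[OF i1 i2])
    also have "\<dots> = (\<integral>\<xi>. ?\<tau> V \<xi> * h \<xi> * k \<xi> - ?\<tau> V \<xi> * ?\<tau> h \<xi> * ?\<tau> k \<xi> \<partial>lborel)"
      by (rule Bochner_Integration.integral_diff[OF i1 i5, symmetric])
    also have "\<dots> = (\<integral>\<xi>. - (?\<tau> V \<xi> * ?\<tau> h \<xi> * (?\<tau> k \<xi> - k \<xi>)) - ?\<tau> V \<xi> * (?\<tau> h \<xi> - h \<xi>) * k \<xi> \<partial>lborel)"
      by (intro Bochner_Integration.integral_cong refl) (simp add: algebra_simps)
    also have "\<dots> = - (\<integral>\<xi>. ?\<tau> V \<xi> * ?\<tau> h \<xi> * (?\<tau> k \<xi> - k \<xi>) \<partial>lborel) -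
        (\<integral>\<xi>. ?\<tau> V \<xi> * (?\<tau> h \<xi> - h \<xi>) * k \<xi> \<partial>lborel)"
      using i3 i4 by (subst Bochner_Integration.integral_diff) auto
    finally have eq: "(\<integral>\<xi>. (?\<tau> V \<xi> - V \<xi>) * P \<xi> \<partial>lborel) =
        - (\<integral>\<xi>. ?\<tau> V \<xi> * ?\<tau> h \<xi> * (?\<tau> k \<xi> - k \<xi>) \<partial>lborel) -
        (\<integral>\<xi>. ?\<tau> V \<xi> * (?\<tau> h \<xi> - h \<xi>) * k \<xi> \<partial>lborel)" .
    have t1: "norm (\<integral>\<xi>. ?\<tau> V \<xi> * ?\<tau> h \<xi> * (?\<tau> k \<xi> - k \<xi>) \<partial>lborel) \<le> B * H * (\<bar>t\<bar> * R * K)"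
    proof (rule order.trans[OF L2_mult_le[OF V1(1)[OF L2_translate(1)[OF h]] kd]], rule mult_mono)
      show "L2_norm (\<lambda>\<xi>. ?\<tau> V \<xi> * ?\<tau> h \<xi>) \<le> B * H"
        using V1(2)[OF L2_translate(1)[OF h, of "t *\<^sub>R v"]] L2_translate(2)[OF h] mult_left_mono[OF H B0]
        by simp
    qed (use kv B0 H0 in auto)
    have t2: "norm (\<integral>\<xi>. ?\<tau> V \<xi> * (?\<tau> h \<xi> - h \<xi>) * k \<xi> \<partial>lborel) \<le> B * (\<bar>t\<bar> * r * H) * K"
    proof (rule order.trans[OF L2_mult_le[OF V1(1)[OF hd] k]], rule mult_mono)
      show "L2_norm (\<lambda>\<xi>. ?\<tau> V \<xi> * (?\<tau> h \<xi> - h \<xi>)) \<le> B * (\<bar>t\<bar> * r * H)"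
        using V1(2)[OF hd] mult_left_mono[OF hv[of t] B0] by simp
    qed (use K B0 H0 r in auto)
    have "norm (\<integral>\<xi>. (?\<tau> V \<xi> - V \<xi>) * P \<xi> \<partial>lborel) \<le> B * H * (\<bar>t\<bar> * R * K) + B * (\<bar>t\<bar> * r * H) * K"
      unfolding eq by (rule order.trans[OF norm_triangle_ineq4]) (use t1 t2 in simp)
    then show ?thesis by (simp add: algebra_simps)
  qed
  define t :: "nat \<Rightarrow> real" where "t m = 1 / real (Suc m)" for m
  have t0: "t m > 0" for m by (simp add: t_def)
  have tl: "t \<longlonglongrightarrow> 0"
    unfolding t_def using LIMSEQ_inverse_real_of_nat by (simp add: divide_inverse)
  have tat: "filterlim t (at 0) sequentially"
    using tl t0 by (auto simp: filterlim_at intro!: always_eventually less_imp_neq[THEN not_sym])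
  define Q where "Q m \<xi> = ((V (\<xi> + t m *\<^sub>R v) - V \<xi>) /\<^sub>R t m) * P \<xi>" for m \<xi>
  have L0: "norm ((V (\<xi> + t m *\<^sub>R v) - V \<xi>) /\<^sub>R t m) \<le> L" for m \<xi>
    unfolding norm_scaleR using L[of \<xi> "t m"] t0[of m] by (simp add: field_simps)
  have dc1: "(\<lambda>\<xi>. D \<xi> * P \<xi>) \<in> borel_measurable lborel" "Q m \<in> borel_measurable lborel" for m
    unfolding Q_def by measurable
  have dc2: "integrable lborel (\<lambda>\<xi>. L * norm (P \<xi>))" using P by auto
  have dc3: "AE \<xi> in lborel. (\<lambda>m. Q m \<xi>) \<longlonglongrightarrow> D \<xi> * P \<xi>"
    unfolding Q_def by (intro AE_I2 tendsto_mult tendsto_const filterlim_compose[OF lim tat])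
  have dc4: "AE \<xi> in lborel. norm (Q m \<xi>) \<le> L * norm (P \<xi>)" for m
    unfolding Q_def norm_mult by (intro AE_I2 mult_right_mono L0) auto
  show "integrable lborel (\<lambda>\<xi>. D \<xi> * (h \<xi> * k \<xi>))"
    using integrable_dominated_convergence[OF dc1 dc2 dc3 dc4] by (simp add: P_def)
  have "norm (\<integral>\<xi>. D \<xi> * P \<xi> \<partial>lborel) \<le> (r + R) * B * (H * K)"
  proof (rule LIMSEQ_le_const2)
    show "(\<lambda>m. norm (\<integral>\<xi>. Q m \<xi> \<partial>lborel)) \<longlonglongrightarrow> norm (\<integral>\<xi>. D \<xi> * P \<xi> \<partial>lborel)"
      by (intro tendsto_norm integral_dominated_convergence[OF dc1 dc2 dc3 dc4])
    have "norm (\<integral>\<xi>. Q m \<xi> \<partial>lborel) \<le> (r + R) * B * (H * K)" for m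
    proof -
      have eq: "(\<integral>\<xi>. Q m \<xi> \<partial>lborel) = (\<integral>\<xi>. (V (\<xi> + t m *\<^sub>R v) - V \<xi>) * P \<xi> \<partial>lborel) /\<^sub>R t m"
        unfolding Q_def by (simp only: mult_scaleR_left integral_scaleR_right)
      show ?thesis
        unfolding eq norm_scaleR using step[of "t m"] t0[of m] by (simp add: field_simps)
    qed
    then show "\<exists>N. \<forall>m\<ge>N. norm (\<integral>\<xi>. Q m \<xi> \<partial>lborel) \<le> (r + R) * B * (H * K)" by blast
  qed
  then show "norm (\<integral>\<xi>. D \<xi> * (h \<xi> * k \<xi>) \<partial>lborel) \<le> (r + R) * B * (H * K)"
    by (simp add: P_def)
qed

lemma raw_fourier_translate: "raw_fourier c f (\<xi> + v) = raw_fourier c (\<lambda>x. cis (c * (x \<bullet> v)) * f x) \<xi>"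
  unfolding raw_fourier_def
  by (intro Bochner_Integration.integral_cong refl)
    (simp add: mult.assoc[symmetric] cis_mult inner_add_right distrib_left)

lemma norm_cis_minus_1_le: "norm (cis \<theta> - 1) \<le> \<bar>\<theta>\<bar>"
  using iexp_approx1[of \<theta> 0] by (simp add: cis_conv_exp)

text \<open>
A frequency shift is a modulation in position, and \<open>\<bar>e\<^bsup>i\<theta>\<^esup> - 1\<bar> \<le> \<bar>\<theta>\<bar>\<close> makes it a perturbation of relative size
\<open>\<bar>t\<bar> r\<close> on functions supported in the ball of radius \<open>r\<close>. This is the way in which compact support
enters the escape estimate.
\<close>

lemma raw_fourier_translate_diff:
  fixes f :: "real^'n \<Rightarrow> complex"
  assumes f: "f \<in> L2" and c: "\<bar>c\<bar> = 1" and r: "0 \<le> r" "\<And>x. norm x > r \<Longrightarrow> f x = 0" and v: "norm v \<le> 1"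
  defines "F \<equiv> \<lambda>\<xi>. unitary_factor TYPE('n) *\<^sub>R raw_fourier c f \<xi>"
  shows "L2_norm (\<lambda>\<xi>. F (\<xi> + t *\<^sub>R v) - F \<xi>) \<le> \<bar>t\<bar> * r * L2_norm f"
proof -
  note [measurable] = L2_measurable[OF f]
  have fi: "integrable lborel f"
    using truncation_L2(2)[OF f, of r] truncation_eq[of r f] r by simp
  define g where "g x = (cis (c * (x \<bullet> (t *\<^sub>R v))) - 1) * f x" for x
  have [measurable]: "g \<in> borel_measurable borel" unfolding g_def by measurable
  have "norm (g x) \<le> (\<bar>t\<bar> * r) * norm (f x)" for x
  proof (cases "norm x > r")
    case False
    have "norm (cis (c * (x \<bullet> (t *\<^sub>R v))) - 1) \<le> \<bar>c * (x \<bullet> (t *\<^sub>R v))\<bar>"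
      by (rule norm_cis_minus_1_le)
    also have "\<dots> \<le> norm x * norm (t *\<^sub>R v)"
      using Cauchy_Schwarz_ineq2[of x "t *\<^sub>R v"] c by (simp add: abs_mult)
    also have "\<dots> \<le> r * \<bar>t\<bar>"
      using False v r(1) mult_left_mono[of "norm v" 1 "\<bar>t\<bar>"] by (intro mult_mono) auto
    finally show ?thesis
      unfolding g_def norm_mult by (intro mult_right_mono) (auto simp: mult.commute)
  qed (simp add: g_def r)
  then have g: "g \<in> L2" "L2_norm g \<le> \<bar>t\<bar> * r * L2_norm f"
    using L2_norm_mono[OF f, of g "\<bar>t\<bar> * r"] r(1) by auto
  have gi: "integrable lborel g"
    using truncation_L2(2)[OF g(1), of r] truncation_eq[of r g] r by (simp add: g_def)
  have "F (\<xi> + t *\<^sub>R v) - F \<xi> = unitary_factor TYPE('n) *\<^sub>R raw_fourier c g \<xi>" for \<xi>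
  proof -
    have "(\<lambda>x. cis (c * (x \<bullet> (t *\<^sub>R v))) * f x) = (\<lambda>x. 1 * g x + 1 * f x)"
      by (auto simp: g_def algebra_simps)
    then have "raw_fourier c f (\<xi> + t *\<^sub>R v) = raw_fourier c g \<xi> + raw_fourier c f \<xi>"
      unfolding raw_fourier_translate using raw_fourier_lincomb[OF gi fi, of c 1 1 \<xi>] by simp
    then show ?thesis by (simp add: F_def scaleR_add_right)
  qed
  then show ?thesis
    using raw_fourier_contraction(2)[OF g(1) gi c] g(2) by simp
qed

section \<open>Escape of high frequencies\<close>

text \<open>
The \<open>j\<close>-th component of \<open>v(\<xi>) e\<^bsup>-i\<tau>\<bar>\<xi>\<bar>\<^sup>s\<^esup>\<close> with \<open>v(\<xi>) = \<xi> (\<delta>\<^sup>2 + \<bar>\<xi>\<bar>\<^sup>2)\<^bsup>-s/2\<^esup>\<close>, as a function of the coordinate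
\<open>y = \<xi>\<^sub>j\<close> on a line in direction \<open>j\<close>; \<open>c\<close> is the sum of the squares of the other coordinates.
\<close>

definition radial_field :: "real \<Rightarrow> real \<Rightarrow> real \<Rightarrow> real \<Rightarrow> real \<Rightarrow> complex" where
  "radial_field \<delta> s \<tau> c y = (y * (\<delta>\<^sup>2 + c + y\<^sup>2) powr (- (s/2))) *\<^sub>R cis (- (\<tau> * (c + y\<^sup>2) powr (s/2)))"

definition radial_field_deriv :: "real \<Rightarrow> real \<Rightarrow> real \<Rightarrow> real \<Rightarrow> real \<Rightarrow> complex" where
  "radial_field_deriv \<delta> s \<tau> c y =
    ((\<delta>\<^sup>2 + c + y\<^sup>2) powr (- (s/2)) - s * (y\<^sup>2 * (\<delta>\<^sup>2 + c + y\<^sup>2) powr (- (s/2) - 1))) *\<^sub>R cis (- (\<tau> * (c + y\<^sup>2) powr (s/2)))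
    - (\<tau> * s * (y\<^sup>2 * (c + y\<^sup>2) powr (s/2 - 1) * (\<delta>\<^sup>2 + c + y\<^sup>2) powr (- (s/2)))) *\<^sub>R
      (\<i> * cis (- (\<tau> * (c + y\<^sup>2) powr (s/2))))"

text \<open>
The function \<open>\<bar>\<xi>\<bar>\<^sup>s\<close> need not be differentiable at the origin (take \<open>s = 1\<close>), but the factor \<open>y\<close> is there to help:
on a line through the origin the difference quotient at \<open>y = 0\<close> is the remaining factor, which is continuous.
\<close>

lemma radial_field_has_derivative:
  assumes \<delta>: "\<delta> > 0" and s: "s \<ge> 1" and c: "c \<ge> 0"
  shows "(radial_field \<delta> s \<tau> c has_vector_derivative radial_field_deriv \<delta> s \<tau> c y) (at y)"
proof (cases "c + y\<^sup>2 > 0")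
  case True
  define P where "P = \<delta>\<^sup>2 + c + y\<^sup>2"
  have P: "P > 0" using True \<delta> by (simp add: P_def add_pos_pos add.assoc)
  have d1: "((\<lambda>y. \<delta>\<^sup>2 + c + y\<^sup>2) has_real_derivative 2 * y) (at y)"
    by (auto intro!: derivative_eq_intros)
  have d2: "((\<lambda>y. c + y\<^sup>2) has_real_derivative 2 * y) (at y)"
    by (auto intro!: derivative_eq_intros)
  have A: "((\<lambda>y. y * (\<delta>\<^sup>2 + c + y\<^sup>2) powr (- (s/2))) has_real_derivative
      P powr (- (s/2)) - s * (y\<^sup>2 * P powr (- (s/2) - 1))) (at y)"
    using DERIV_mult[OF DERIV_ident DERIV_fun_powr[OF d1, of "- (s/2)"]] P
    by (simp add: P_def power2_eq_square algebra_simps)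
  have B: "((\<lambda>y. - (\<tau> * (c + y\<^sup>2) powr (s/2))) has_real_derivative
      - (\<tau> * s * y * (c + y\<^sup>2) powr (s/2 - 1))) (at y)"
    using DERIV_minus[OF DERIV_cmult[OF DERIV_fun_powr[OF d2, of "s/2"], of \<tau>]] True
    by (simp add: algebra_simps)
  have C: "((\<lambda>y. cis (- (\<tau> * (c + y\<^sup>2) powr (s/2)))) has_vector_derivative
      (- (\<tau> * s * y * (c + y\<^sup>2) powr (s/2 - 1))) *\<^sub>R (\<i> * cis (- (\<tau> * (c + y\<^sup>2) powr (s/2))))) (at y)"
    using has_derivative_cis[OF B[unfolded has_field_derivative_def]]
    unfolding has_vector_derivative_def by (simp add: mult.commute)
  have "((\<lambda>y. (y * (\<delta>\<^sup>2 + c + y\<^sup>2) powr (- (s/2))) *\<^sub>R cis (- (\<tau> * (c + y\<^sup>2) powr (s/2)))) has_vector_derivative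
     radial_field_deriv \<delta> s \<tau> c y) (at y)"
    by (rule has_vector_derivative_eq_rhs[OF has_vector_derivative_scaleR[OF A C]])
      (simp add: radial_field_deriv_def P_def power2_eq_square mult_ac)
  then show ?thesis unfolding radial_field_def[abs_def] .
next
  case False
  then have "c = 0 \<and> y\<^sup>2 = 0"
    using c zero_le_power2[of y] by linarith
  then have y: "y = 0" and c0: "c = 0" by auto
  define g where "g t = ((\<delta>\<^sup>2 + t\<^sup>2) powr (- (s/2))) *\<^sub>R cis (- (\<tau> * (t\<^sup>2) powr (s/2)))" for t
  have gw: "radial_field \<delta> s \<tau> c t = t *\<^sub>R g t" for t
    by (simp add: radial_field_def g_def c0)
  have g0: "radial_field_deriv \<delta> s \<tau> c y = g 0"
    by (simp add: radial_field_deriv_def g_def c0 y)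
  have "((\<lambda>t. (\<delta>\<^sup>2 + t\<^sup>2) powr (- (s/2))) \<longlongrightarrow> (\<delta>\<^sup>2 + 0\<^sup>2) powr (- (s/2))) (at 0)"
    using \<delta> by (intro tendsto_powr tendsto_intros) auto
  moreover have "((\<lambda>t::real. (t\<^sup>2) powr (s/2)) \<longlongrightarrow> (0\<^sup>2) powr (s/2)) (at 0)"
    using s by (intro tendsto_powr' tendsto_intros) auto
  moreover have "isCont cis (- (\<tau> * (0\<^sup>2) powr (s/2)))"
    unfolding cis_conv_exp by (intro continuous_intros)
  ultimately have "(g \<longlongrightarrow> g 0) (at 0)"
    unfolding g_def by (intro tendsto_scaleR isCont_tendsto_compose[of _ cis] tendsto_minus tendsto_mult_left)
  then have "((\<lambda>h. norm (g h - g 0)) \<longlongrightarrow> 0) (at 0)"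
    using LIM_zero tendsto_norm_zero by blast
  moreover have "\<forall>\<^sub>F h in at 0. norm (g h - g 0) = norm (radial_field \<delta> s \<tau> c (0 + h) - radial_field \<delta> s \<tau> c 0 - h *\<^sub>R g 0) / norm h"
    using eventually_neq_at_within[of 0 0 UNIV]
  proof eventually_elim
    case (elim h)
    have "radial_field \<delta> s \<tau> c (0 + h) - radial_field \<delta> s \<tau> c 0 - h *\<^sub>R g 0 = h *\<^sub>R (g h - g 0)"
      by (simp add: gw scaleR_diff_right)
    then show ?case using elim by simp
  qed
  ultimately have "((\<lambda>h. norm (radial_field \<delta> s \<tau> c (0 + h) - radial_field \<delta> s \<tau> c 0 - h *\<^sub>R g 0) / norm h) \<longlongrightarrow> 0) (at 0)"
    by (rule Lim_transform_eventually)
  then show ?thesis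
    unfolding has_vector_derivative_def y g0[unfolded y] has_derivative_at
    by (simp add: bounded_linear_scaleR_left)
qed

lemma power2_powr_half: "(x\<^sup>2) powr (s/2) = \<bar>x\<bar> powr s" for x s :: real
proof -
  have "(x\<^sup>2) powr (s/2) = (\<bar>x\<bar> powr 2) powr (s/2)"
    by (cases "x = 0") simp_all
  then show ?thesis by (simp only: powr_powr) simp
qed

text \<open>
Since \<open>\<bar>v\<bar> \<le> (\<delta>\<^sup>2 + \<bar>\<xi>\<bar>\<^sup>2)\<^bsup>(1-s)/2\<^esup>\<close>, the field is bounded exactly in the range \<open>s \<ge> 1\<close>, in which the
group velocity does not decrease with the frequency.
\<close>

lemma radial_field_bound:
  assumes \<delta>: "\<delta> > 0" and s: "s \<ge> 1" and c: "c \<ge> 0"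
  shows "norm (radial_field \<delta> s \<tau> c y) \<le> \<delta> powr (1 - s)"
proof -
  define P where "P = \<delta>\<^sup>2 + c + y\<^sup>2"
  have P: "P > 0" "\<delta>\<^sup>2 \<le> P" "y\<^sup>2 \<le> P"
    using c \<delta> by (auto simp: P_def intro!: add_pos_nonneg)
  have "\<bar>y\<bar> \<le> P powr (1/2)"
    using P(1) real_sqrt_le_mono[OF P(3)] by (simp add: powr_half_sqrt)
  then have "\<bar>y\<bar> * P powr (- (s/2)) \<le> P powr (1/2) * P powr (- (s/2))"
    by (intro mult_right_mono) auto
  also have "\<dots> = P powr ((1 - s) / 2)"
    by (simp add: diff_divide_distrib flip: powr_add)
  also have "\<dots> \<le> (\<delta>\<^sup>2) powr ((1 - s) / 2)"
    using s \<delta> P by (intro powr_mono2') auto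
  also have "\<dots> = \<delta> powr (1 - s)"
    using \<delta> power2_powr_half[of \<delta> "1 - s"] by simp
  finally show ?thesis
    by (simp add: radial_field_def P_def abs_mult)
qed

lemma powr_minus_half_bound:
  fixes \<delta> s P :: real
  assumes "\<delta> > 0" "s \<ge> 0" "\<delta>\<^sup>2 \<le> P"
  shows "P powr (- (s/2)) \<le> \<delta> powr (- s)"
proof -
  have "P powr (- (s/2)) \<le> (\<delta>\<^sup>2) powr (- (s/2))"
    using assms by (intro powr_mono2') auto
  also have "\<dots> = \<delta> powr (- s)"
    using assms(1) power2_powr_half[of \<delta> "- s"] by simp
  finally show ?thesis .
qed

lemma powr_minus_half_bound':
  fixes \<delta> s P u :: real
  assumes "\<delta> > 0" "s \<ge> 0" "\<delta>\<^sup>2 \<le> P" "0 \<le> u" "u \<le> P"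
  shows "u * P powr (- (s/2) - 1) \<le> \<delta> powr (- s)"
proof -
  have P: "P > 0" using assms(1,3) by (meson less_le_trans zero_less_power)
  have "u * P powr (- (s/2) - 1) \<le> P * P powr (- (s/2) - 1)"
    using assms by (intro mult_right_mono) auto
  also have "\<dots> = P powr (- (s/2))"
    using P by (simp add: powr_diff)
  also have "\<dots> \<le> \<delta> powr (- s)"
    by (intro powr_minus_half_bound assms)
  finally show ?thesis .
qed

lemma radial_field_deriv_bound:
  assumes \<delta>: "\<delta> > 0" and s: "s \<ge> 1" and c: "c \<ge> 0"
  shows "norm (radial_field_deriv \<delta> s \<tau> c y) \<le> (1 + s) * \<delta> powr (- s) + \<bar>\<tau>\<bar> * s"
proof -
  define P where "P = \<delta>\<^sup>2 + c + y\<^sup>2"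
  have P: "P > 0" "\<delta>\<^sup>2 \<le> P" "y\<^sup>2 \<le> P"
    using c \<delta> by (auto simp: P_def intro!: add_pos_nonneg)
  have 1: "\<bar>P powr (- (s/2)) - s * (y\<^sup>2 * P powr (- (s/2) - 1))\<bar> \<le> (1 + s) * \<delta> powr (- s)"
  proof -
    have "\<bar>P powr (- (s/2)) - s * (y\<^sup>2 * P powr (- (s/2) - 1))\<bar> \<le> P powr (- (s/2)) + s * (y\<^sup>2 * P powr (- (s/2) - 1))"
      using s by (intro abs_triangle_ineq4[THEN order.trans]) (simp add: abs_mult)
    also have "\<dots> \<le> \<delta> powr (- s) + s * \<delta> powr (- s)"
      using s \<delta> P by (intro add_mono mult_left_mono powr_minus_half_bound powr_minus_half_bound') auto
    finally show ?thesis by (simp add: algebra_simps)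
  qed
  have 2: "y\<^sup>2 * (c + y\<^sup>2) powr (s/2 - 1) * P powr (- (s/2)) \<le> 1"
  proof (cases "c + y\<^sup>2 > 0")
    case True
    have "y\<^sup>2 * (c + y\<^sup>2) powr (s/2 - 1) \<le> (c + y\<^sup>2) * (c + y\<^sup>2) powr (s/2 - 1)"
      using c by (intro mult_right_mono) auto
    also have "\<dots> = (c + y\<^sup>2) powr (s/2)"
      using True by (simp add: powr_diff)
    also have "\<dots> \<le> P powr (s/2)"
      using s c by (intro powr_mono2) (auto simp: P_def)
    finally have "y\<^sup>2 * (c + y\<^sup>2) powr (s/2 - 1) * P powr (- (s/2)) \<le> P powr (s/2) * P powr (- (s/2))"
      by (intro mult_right_mono) auto
    also have "\<dots> = 1" using P by (simp flip: powr_add)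
    finally show ?thesis .
  next
    case False
    then have "y\<^sup>2 = 0" using c by (smt (verit) zero_le_power2)
    then show ?thesis by simp
  qed
  have 3: "\<bar>\<tau> * s * (y\<^sup>2 * (c + y\<^sup>2) powr (s/2 - 1) * P powr (- (s/2)))\<bar> \<le> \<bar>\<tau>\<bar> * s"
  proof -
    have "\<bar>\<tau>\<bar> * s * (y\<^sup>2 * (c + y\<^sup>2) powr (s/2 - 1) * P powr (- (s/2))) \<le> \<bar>\<tau>\<bar> * s * 1"
      using s 2 by (intro mult_left_mono) auto
    then show ?thesis using s by (simp add: abs_mult)
  qed
  have "norm (radial_field_deriv \<delta> s \<tau> c y) \<le> \<bar>P powr (- (s/2)) - s * (y\<^sup>2 * P powr (- (s/2) - 1))\<bar> +
     \<bar>\<tau> * s * (y\<^sup>2 * (c + y\<^sup>2) powr (s/2 - 1) * P powr (- (s/2)))\<bar>"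
    unfolding radial_field_deriv_def P_def[symmetric]
    by (rule norm_triangle_ineq4[THEN order.trans]) (simp add: norm_mult)
  with 1 3 show ?thesis by linarith
qed

lemma radial_field_Lipschitz:
  assumes \<delta>: "\<delta> > 0" and s: "s \<ge> 1" and c: "c \<ge> 0"
  shows "norm (radial_field \<delta> s \<tau> c (y + t) - radial_field \<delta> s \<tau> c y) \<le> ((1 + s) * \<delta> powr (- s) + \<bar>\<tau>\<bar> * s) * \<bar>t\<bar>"
proof -
  let ?L = "(1 + s) * \<delta> powr (- s) + \<bar>\<tau>\<bar> * s"
  have *: "norm (radial_field \<delta> s \<tau> c b - radial_field \<delta> s \<tau> c a) \<le> ?L * (b - a)" if "a < b" for a b
  proof -
    have "\<exists>x\<in>{a<..<b}. norm (radial_field \<delta> s \<tau> c b - radial_field \<delta> s \<tau> c a) \<le> norm ((b - a) *\<^sub>R radial_field_deriv \<delta> s \<tau> c x)"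
    proof (rule mvt_general[OF that, of _ "\<lambda>x h. h *\<^sub>R radial_field_deriv \<delta> s \<tau> c x"])
      show "continuous_on {a..b} (radial_field \<delta> s \<tau> c)"
        by (intro continuous_at_imp_continuous_on ballI has_vector_derivative_continuous)
          (rule radial_field_has_derivative[OF assms])
    qed (rule radial_field_has_derivative[OF assms, unfolded has_vector_derivative_def])
    then obtain x where "norm (radial_field \<delta> s \<tau> c b - radial_field \<delta> s \<tau> c a) \<le> norm ((b - a) *\<^sub>R radial_field_deriv \<delta> s \<tau> c x)"
      by blast
    also have "\<dots> \<le> ?L * (b - a)"
      using that mult_left_mono[OF radial_field_deriv_bound[OF assms, of \<tau> x], of "b - a"] by (simp add: mult.commute)
    finally show ?thesis .
  qed
  show ?thesis
  proof (cases t "0 :: real" rule: linorder_cases)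
    case less
    with *[of "y + t" y] show ?thesis by (simp add: norm_minus_commute)
  next
    case greater
    with *[of y "y + t"] show ?thesis by simp
  qed simp
qed

text \<open>
The weight \<open>(\<bar>\<xi>\<bar>\<^sup>2 / (\<delta>\<^sup>2 + \<bar>\<xi>\<bar>\<^sup>2))\<^bsup>s/2\<^esup>\<close>, which measures how fast \<open>v\<close> moves the phase: \<open>v \<cdot> \<nabla>\<bar>\<xi>\<bar>\<^sup>s = s m\<close>. It
vanishes at the origin and tends to 1 at infinity.
\<close>

definition escape_weight :: "real \<Rightarrow> real \<Rightarrow> real^'n \<Rightarrow> real" where
  "escape_weight \<delta> s \<xi> = ((norm \<xi>)\<^sup>2) powr (s/2) * (\<delta>\<^sup>2 + (norm \<xi>)\<^sup>2) powr (- (s/2))"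

lemma escape_weight_measurable [measurable]: "escape_weight \<delta> s \<in> borel_measurable borel"
  unfolding escape_weight_def by measurable

lemma escape_weight_range:
  assumes "\<delta> > 0" "s \<ge> 0"
  shows "0 \<le> escape_weight \<delta> s \<xi>" "escape_weight \<delta> s \<xi> \<le> 1"
proof -
  show "0 \<le> escape_weight \<delta> s \<xi>" by (simp add: escape_weight_def)
  have P: "\<delta>\<^sup>2 + (norm \<xi>)\<^sup>2 > 0" using assms by (intro add_pos_nonneg) auto
  have "escape_weight \<delta> s \<xi> \<le> (\<delta>\<^sup>2 + (norm \<xi>)\<^sup>2) powr (s/2) * (\<delta>\<^sup>2 + (norm \<xi>)\<^sup>2) powr (- (s/2))"
    unfolding escape_weight_def using assms by (intro mult_right_mono powr_mono2) auto
  also have "\<dots> = 1" using assms by (simp flip: powr_add)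
  finally show "escape_weight \<delta> s \<xi> \<le> 1" .
qed

text \<open>
Summing the integrations by parts over the coordinate directions gives
\<open>div (v e\<^bsup>-i\<tau>\<bar>\<xi>\<bar>\<^sup>s\<^esup>) = (div v - i \<tau> s m) e\<^bsup>-i\<tau>\<bar>\<xi>\<bar>\<^sup>s\<^esup>\<close>, and \<open>\<bar>div v\<bar> \<le> (n + s) \<delta>\<^bsup>-s\<^esup>\<close>. Dividing by \<open>\<tau> s\<close> isolates the weighted
oscillatory integral.
\<close>

lemma escape_oscillatory_bound:
  fixes h k :: "real^'n \<Rightarrow> complex"
  assumes h: "h \<in> L2" and k: "k \<in> L2"
    and hv: "\<And>j t. L2_norm (\<lambda>\<xi>. h (\<xi> + t *\<^sub>R axis j 1) - h \<xi>) \<le> \<bar>t\<bar> * r * H" and H: "L2_norm h \<le> H"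
    and kv: "\<And>j t. L2_norm (\<lambda>\<xi>. k (\<xi> + t *\<^sub>R axis j 1) - k \<xi>) \<le> \<bar>t\<bar> * R * K" and K: "L2_norm k \<le> K"
    and r: "0 \<le> r" "0 \<le> R" and \<delta>: "\<delta> > 0" and s: "s \<ge> 1" and \<tau>: "\<tau> > 0"
  shows "norm (\<integral>\<xi>. escape_weight \<delta> s \<xi> *\<^sub>R (phase s \<tau> \<xi> * (h \<xi> * k \<xi>)) \<partial>lborel) \<le>
    (real CARD('n) * (r + R) * \<delta> powr (1 - s) + (real CARD('n) + s) * \<delta> powr (- s)) / (\<tau> * s) * (H * K)"
proof -
  note [measurable] = L2_measurable[OF h] L2_measurable[OF k]
  define c where "c j \<xi> = (norm \<xi>)\<^sup>2 - (\<xi> $ j)\<^sup>2" for j and \<xi> :: "real^'n"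
  have ns: "(norm \<xi>)\<^sup>2 = (\<Sum>j\<in>UNIV. (\<xi> $ j)\<^sup>2)" for \<xi> :: "real^'n"
    by (simp add: norm_eq_sqrt_inner inner_vec_def power2_eq_square sum_nonneg)
  have c: "0 \<le> c j \<xi>" for j \<xi>
    unfolding c_def ns by (simp add: member_le_sum[of j UNIV "\<lambda>j. (\<xi> $ j)\<^sup>2"])
  have cy: "c j \<xi> + (\<xi> $ j)\<^sup>2 = (norm \<xi>)\<^sup>2" "\<delta>\<^sup>2 + c j \<xi> + (\<xi> $ j)\<^sup>2 = \<delta>\<^sup>2 + (norm \<xi>)\<^sup>2" for j \<xi>
    by (simp_all add: c_def)
  have ct: "c j (\<xi> + t *\<^sub>R axis j 1) = c j \<xi>" for j \<xi> t
  proof -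
    have "(norm (\<xi> + t *\<^sub>R axis j 1))\<^sup>2 = (norm \<xi>)\<^sup>2 + 2 * t * \<xi> $ j + t\<^sup>2"
      unfolding power2_norm_eq_inner
      by (simp add: inner_add_left inner_add_right inner_axis inner_axis' power2_eq_square algebra_simps)
    then show ?thesis by (simp add: c_def power2_eq_square algebra_simps)
  qed
  have [measurable]: "c j \<in> borel_measurable borel" for j
    unfolding c_def by measurable
  define V where "V j \<xi> = radial_field \<delta> s \<tau> (c j \<xi>) (\<xi> $ j)" for j \<xi>
  define D where "D j \<xi> = radial_field_deriv \<delta> s \<tau> (c j \<xi>) (\<xi> $ j)" for j \<xi>
  have [measurable]: "V j \<in> borel_measurable borel" "D j \<in> borel_measurable borel" for j
    unfolding V_def D_def radial_field_def radial_field_deriv_def by measurable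
  have Vt: "V j (\<xi> + t *\<^sub>R axis j 1) = radial_field \<delta> s \<tau> (c j \<xi>) (\<xi> $ j + t)" for j \<xi> t
    unfolding V_def ct by simp
  let ?B = "\<delta> powr (1 - s)"
  have td: "integrable lborel (\<lambda>\<xi>. D j \<xi> * (h \<xi> * k \<xi>)) \<and>
      norm (\<integral>\<xi>. D j \<xi> * (h \<xi> * k \<xi>) \<partial>lborel) \<le> (r + R) * ?B * (H * K)" for j
  proof -
    have 1: "norm (V j \<xi>) \<le> ?B" for \<xi>
      unfolding V_def by (intro radial_field_bound \<delta> s c)
    have 2: "norm (V j (\<xi> + t *\<^sub>R axis j 1) - V j \<xi>) \<le> ((1 + s) * \<delta> powr (- s) + \<bar>\<tau>\<bar> * s) * \<bar>t\<bar>" for \<xi> t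
      unfolding Vt unfolding V_def by (intro radial_field_Lipschitz \<delta> s c)
    have 3: "((\<lambda>t. (V j (\<xi> + t *\<^sub>R axis j 1) - V j \<xi>) /\<^sub>R t) \<longlongrightarrow> D j \<xi>) (at 0)" for \<xi>
    proof -
      let ?y = "\<xi> $ j" and ?w = "radial_field \<delta> s \<tau> (c j \<xi>)"
      have "((\<lambda>t. norm (?w (?y + t) - ?w ?y - t *\<^sub>R D j \<xi>) / norm t) \<longlongrightarrow> 0) (at 0)"
        using radial_field_has_derivative[OF \<delta> s c, of \<tau> j \<xi> ?y]
        unfolding has_vector_derivative_def has_derivative_at D_def by blast
      moreover have "\<forall>\<^sub>F t in at 0. norm (?w (?y + t) - ?w ?y - t *\<^sub>R D j \<xi>) / norm t =
          norm ((?w (?y + t) - ?w ?y) /\<^sub>R t - D j \<xi>)"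
        using eventually_neq_at_within[of 0 0 UNIV]
      proof eventually_elim
        case (elim t)
        have "(?w (?y + t) - ?w ?y) /\<^sub>R t - D j \<xi> = (?w (?y + t) - ?w ?y - t *\<^sub>R D j \<xi>) /\<^sub>R t"
          using elim by (simp add: scaleR_diff_right)
        then show ?case by (simp only: norm_scaleR) (simp add: divide_inverse_commute)
      qed
      ultimately have "((\<lambda>t. norm ((?w (?y + t) - ?w ?y) /\<^sub>R t - D j \<xi>)) \<longlongrightarrow> 0) (at 0)"
        by (rule Lim_transform_eventually)
      then show ?thesis
        unfolding Vt unfolding V_def by (rule LIM_zero_cancel[OF tendsto_norm_zero_cancel])
    qed
    have "V j \<in> borel_measurable borel" "D j \<in> borel_measurable borel" by measurable
    from translation_derivative_bound[OF h k hv[where j=j] H kv[where j=j] K r this(1) 1 2 this(2) 3]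
    show ?thesis by blast
  qed
  define P where "P \<xi> = phase s \<tau> \<xi> * (h \<xi> * k \<xi>)" for \<xi>
  have P: "integrable lborel P"
  proof -
    have "P = (\<lambda>\<xi>. (phase s \<tau> \<xi> * h \<xi>) * k \<xi>)" by (simp add: P_def fun_eq_iff)
    then show ?thesis by (simp only:) (intro L2_mult_integrable phase_mult_L2 h k)
  qed
  note [measurable] = borel_measurable_integrable[OF P]
  have intP: "(\<integral>\<xi>. norm (P \<xi>) \<partial>lborel) \<le> H * K"
  proof -
    have "(\<integral>\<xi>. norm (P \<xi>) \<partial>lborel) = (\<integral>\<xi>. norm (h \<xi>) * norm (k \<xi>) \<partial>lborel)"
      by (simp add: P_def norm_mult)
    also have "\<dots> \<le> L2_norm h * L2_norm k" by (rule L2_mult_norm_le[OF h k])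
    also have "\<dots> \<le> H * K" using H K order.trans[OF L2_norm_nonneg H] by (intro mult_mono) auto
    finally show ?thesis .
  qed
  define n where "n = real CARD('n)"
  define G where "G \<xi> = n * (\<delta>\<^sup>2 + (norm \<xi>)\<^sup>2) powr (- (s/2)) -
    s * ((norm \<xi>)\<^sup>2 * (\<delta>\<^sup>2 + (norm \<xi>)\<^sup>2) powr (- (s/2) - 1))" for \<xi> :: "real^'n"
  have [measurable]: "G \<in> borel_measurable borel" unfolding G_def by measurable
  have Gb: "\<bar>G \<xi>\<bar> \<le> (n + s) * \<delta> powr (- s)" for \<xi>
  proof -
    have "\<bar>G \<xi>\<bar> \<le> n * (\<delta>\<^sup>2 + (norm \<xi>)\<^sup>2) powr (- (s/2)) + s * ((norm \<xi>)\<^sup>2 * (\<delta>\<^sup>2 + (norm \<xi>)\<^sup>2) powr (- (s/2) - 1))"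
      unfolding G_def using s by (intro abs_triangle_ineq4[THEN order.trans]) (simp add: abs_mult n_def)
    also have "\<dots> \<le> n * \<delta> powr (- s) + s * \<delta> powr (- s)"
      using s \<delta> by (intro add_mono mult_left_mono powr_minus_half_bound powr_minus_half_bound') (auto simp: n_def)
    finally show ?thesis by (simp add: algebra_simps)
  qed
  have sumD: "(\<Sum>j\<in>UNIV. D j \<xi> * (h \<xi> * k \<xi>)) = G \<xi> *\<^sub>R P \<xi> - (\<tau> * s * escape_weight \<delta> s \<xi>) *\<^sub>R (\<i> * P \<xi>)" for \<xi>
  proof -
    let ?q = "(\<delta>\<^sup>2 + (norm \<xi>)\<^sup>2) powr (- (s/2))" and ?q1 = "(\<delta>\<^sup>2 + (norm \<xi>)\<^sup>2) powr (- (s/2) - 1)"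
    let ?p = "((norm \<xi>)\<^sup>2) powr (s/2 - 1)"
    have ph: "cis (- (\<tau> * ((norm \<xi>)\<^sup>2) powr (s/2))) = phase s \<tau> \<xi>"
      by (simp add: phase_def power2_powr_half)
    have "D j \<xi> = (?q - s * ((\<xi> $ j)\<^sup>2 * ?q1)) *\<^sub>R phase s \<tau> \<xi> - (\<tau> * s * ((\<xi> $ j)\<^sup>2 * ?p * ?q)) *\<^sub>R (\<i> * phase s \<tau> \<xi>)" for j
      unfolding D_def radial_field_deriv_def cy ph ..
    then have "(\<Sum>j\<in>UNIV. D j \<xi>) = (\<Sum>j\<in>UNIV. ?q - s * ((\<xi> $ j)\<^sup>2 * ?q1)) *\<^sub>R phase s \<tau> \<xi> -
        (\<Sum>j\<in>UNIV. \<tau> * s * ((\<xi> $ j)\<^sup>2 * ?p * ?q)) *\<^sub>R (\<i> * phase s \<tau> \<xi>)"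
      by (simp only: sum_subtractf scaleR_sum_left[symmetric])
    also have "(\<Sum>j\<in>UNIV. ?q - s * ((\<xi> $ j)\<^sup>2 * ?q1)) = G \<xi>"
      unfolding G_def ns[of \<xi>] n_def sum_subtractf by (simp add: sum_distrib_left sum_distrib_right)
    also have "(\<Sum>j\<in>UNIV. \<tau> * s * ((\<xi> $ j)\<^sup>2 * ?p * ?q)) = \<tau> * s * ((norm \<xi>)\<^sup>2 * ?p * ?q)"
      by (subst ns) (simp only: sum_distrib_left sum_distrib_right)
    also have "(norm \<xi>)\<^sup>2 * ?p * ?q = escape_weight \<delta> s \<xi>"
      unfolding escape_weight_def by (cases "\<xi> = 0") (simp_all add: powr_diff)
    finally have "(\<Sum>j\<in>UNIV. D j \<xi>) = G \<xi> *\<^sub>R phase s \<tau> \<xi> - (\<tau> * s * escape_weight \<delta> s \<xi>) *\<^sub>R (\<i> * phase s \<tau> \<xi>)" .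
    then have "(\<Sum>j\<in>UNIV. D j \<xi> * (h \<xi> * k \<xi>)) =
        (G \<xi> *\<^sub>R phase s \<tau> \<xi> - (\<tau> * s * escape_weight \<delta> s \<xi>) *\<^sub>R (\<i> * phase s \<tau> \<xi>)) * (h \<xi> * k \<xi>)"
      by (simp only: sum_distrib_right[symmetric])
    then show ?thesis
      by (simp only:) (simp add: P_def scaleR_conv_of_real algebra_simps)
  qed
  have iG: "integrable lborel (\<lambda>\<xi>. G \<xi> *\<^sub>R P \<xi>)"
  proof (rule Bochner_Integration.integrable_bound)
    show "integrable lborel (\<lambda>\<xi>. (n + s) * \<delta> powr (- s) * norm (P \<xi>))" using P by auto
    show "AE \<xi> in lborel. norm (G \<xi> *\<^sub>R P \<xi>) \<le> norm ((n + s) * \<delta> powr (- s) * norm (P \<xi>))"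
      using s mult_right_mono[OF Gb norm_ge_zero] by (intro AE_I2) (simp add: abs_mult n_def)
  qed measurable
  have iE: "integrable lborel (\<lambda>\<xi>. escape_weight \<delta> s \<xi> *\<^sub>R P \<xi>)"
  proof (rule Bochner_Integration.integrable_bound[OF P])
    show "AE \<xi> in lborel. norm (escape_weight \<delta> s \<xi> *\<^sub>R P \<xi>) \<le> norm (P \<xi>)"
    proof (intro AE_I2)
      fix \<xi> :: "real^'n"
      have e: "0 \<le> escape_weight \<delta> s \<xi>" "escape_weight \<delta> s \<xi> \<le> 1" using escape_weight_range[OF \<delta>, of s \<xi>] s by auto
      then show "norm (escape_weight \<delta> s \<xi> *\<^sub>R P \<xi>) \<le> norm (P \<xi>)"
        using mult_left_le_one_le[of "norm (P \<xi>)" "escape_weight \<delta> s \<xi>"] by simp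
    qed
  qed measurable
  let ?IE = "\<integral>\<xi>. escape_weight \<delta> s \<xi> *\<^sub>R P \<xi> \<partial>lborel"
  have "(\<Sum>j\<in>UNIV. \<integral>\<xi>. D j \<xi> * (h \<xi> * k \<xi>) \<partial>lborel) = (\<integral>\<xi>. (\<Sum>j\<in>UNIV. D j \<xi> * (h \<xi> * k \<xi>)) \<partial>lborel)"
    using td by (intro Bochner_Integration.integral_sum[symmetric]) auto
  also have "\<dots> = (\<integral>\<xi>. G \<xi> *\<^sub>R P \<xi> - (\<i> * of_real (\<tau> * s)) * (escape_weight \<delta> s \<xi> *\<^sub>R P \<xi>) \<partial>lborel)"
    unfolding sumD by (intro Bochner_Integration.integral_cong refl) (simp add: scaleR_conv_of_real mult_ac)
  also have "\<dots> = (\<integral>\<xi>. G \<xi> *\<^sub>R P \<xi> \<partial>lborel) - (\<i> * of_real (\<tau> * s)) * ?IE"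
    by (simp only: Bochner_Integration.integral_diff[OF iG integrable_mult_right[OF iE]] integral_mult_right_zero)
  finally have eq: "(\<i> * of_real (\<tau> * s)) * ?IE =
      (\<integral>\<xi>. G \<xi> *\<^sub>R P \<xi> \<partial>lborel) - (\<Sum>j\<in>UNIV. \<integral>\<xi>. D j \<xi> * (h \<xi> * k \<xi>) \<partial>lborel)"
    by simp
  have "\<tau> * s * norm ?IE = norm ((\<i> * of_real (\<tau> * s)) * ?IE)"
    using \<tau> s by (simp add: norm_mult)
  also have "\<dots> \<le> norm (\<integral>\<xi>. G \<xi> *\<^sub>R P \<xi> \<partial>lborel) + norm (\<Sum>j\<in>UNIV. \<integral>\<xi>. D j \<xi> * (h \<xi> * k \<xi>) \<partial>lborel)"
    unfolding eq by (rule norm_triangle_ineq4)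
  also have "\<dots> \<le> (n + s) * \<delta> powr (- s) * (H * K) + n * ((r + R) * ?B * (H * K))"
  proof (rule add_mono)
    have "norm (\<integral>\<xi>. G \<xi> *\<^sub>R P \<xi> \<partial>lborel) \<le> (\<integral>\<xi>. norm (G \<xi> *\<^sub>R P \<xi>) \<partial>lborel)"
      by (rule integral_norm_bound)
    also have "\<dots> \<le> (\<integral>\<xi>. (n + s) * \<delta> powr (- s) * norm (P \<xi>) \<partial>lborel)"
    proof (rule integral_mono)
      show "integrable lborel (\<lambda>\<xi>. norm (G \<xi> *\<^sub>R P \<xi>))" by (rule integrable_norm[OF iG])
      show "integrable lborel (\<lambda>\<xi>. (n + s) * \<delta> powr (- s) * norm (P \<xi>))" using P by auto
      show "norm (G \<xi> *\<^sub>R P \<xi>) \<le> (n + s) * \<delta> powr (- s) * norm (P \<xi>)" for \<xi>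
        unfolding norm_scaleR real_norm_def by (rule mult_right_mono[OF Gb norm_ge_zero])
    qed
    also have "\<dots> \<le> (n + s) * \<delta> powr (- s) * (H * K)"
      using intP s by (simp add: mult_left_mono n_def)
    finally show "norm (\<integral>\<xi>. G \<xi> *\<^sub>R P \<xi> \<partial>lborel) \<le> (n + s) * \<delta> powr (- s) * (H * K)" .
    show "norm (\<Sum>j\<in>UNIV. \<integral>\<xi>. D j \<xi> * (h \<xi> * k \<xi>) \<partial>lborel) \<le> n * ((r + R) * ?B * (H * K))"
      unfolding n_def using td by (intro sum_norm_bound[THEN order.trans, of _ _ "(r + R) * ?B * (H * K)"]) auto
  qed
  finally have "\<tau> * s * norm ?IE \<le> (n * (r + R) * ?B + (n + s) * \<delta> powr (- s)) * (H * K)"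
    by (simp add: algebra_simps)
  then have "norm ?IE \<le> (n * (r + R) * ?B + (n + s) * \<delta> powr (- s)) * (H * K) / (\<tau> * s)"
    using \<tau> s by (simp add: pos_le_divide_eq mult.commute)
  then show ?thesis by (simp add: P_def n_def)
qed

section \<open>Low frequencies and the escape estimate\<close>

lemma L2_norm_indicator_cball:
  assumes "r \<ge> 0"
  shows "(\<lambda>x. indicator (cball 0 r) (x :: real^'n)) \<in> L2"
    and "(L2_norm (\<lambda>x. indicator (cball 0 r) (x :: real^'n)))\<^sup>2 = unit_ball_vol (real CARD('n)) * r ^ CARD('n)"
proof -
  have b: "cball 0 r \<in> sets (borel :: (real^'n) measure)" "emeasure lborel (cball 0 r :: (real^'n) set) < \<infinity>"
    using emeasure_bounded_finite[of "cball 0 r :: (real^'n) set"] by auto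
  show "(\<lambda>x. indicator (cball 0 r) (x :: real^'n)) \<in> L2" by (rule L2_indicator(1)[OF b])
  show "(L2_norm (\<lambda>x. indicator (cball 0 r) (x :: real^'n)))\<^sup>2 = unit_ball_vol (real CARD('n)) * r ^ CARD('n)"
    unfolding L2_indicator(2)[OF b] using content_cball[OF assms, of "0 :: real^'n"] by simp
qed

text \<open>
The uncertainty principle in its crudest form: the transform of a function supported in a ball is bounded
pointwise by Cauchy--Schwarz, so a ball of frequencies of small volume carries little of the norm.
\<close>

lemma raw_fourier_low_frequency:
  fixes f :: "real^'n \<Rightarrow> complex" and c :: real
  assumes f: "f \<in> L2" and r: "0 \<le> r" "\<And>x. norm x > r \<Longrightarrow> f x = 0" and \<rho>: "0 \<le> \<rho>"
  defines "F \<equiv> \<lambda>\<xi>. unitary_factor TYPE('n) *\<^sub>R raw_fourier c f \<xi>"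
  shows "(\<lambda>\<xi>. indicator (cball 0 \<rho>) \<xi> * F \<xi>) \<in> L2"
    and "L2_norm (\<lambda>\<xi>. indicator (cball 0 \<rho>) \<xi> * F \<xi>) \<le>
      (unitary_factor TYPE('n) * unit_ball_vol (real CARD('n)) * sqrt ((r * \<rho>) ^ CARD('n))) * L2_norm f"
proof -
  note [measurable] = L2_measurable[OF f]
  let ?k = "unitary_factor TYPE('n)"
  let ?i = "\<lambda>R x. indicator (cball 0 R) (x :: real^'n) :: complex"
  have ball[measurable]: "cball (0 :: real^'n) \<rho> \<in> sets borel" by simp
  have n1: "(\<integral>x. norm (f x) \<partial>lborel) \<le> L2_norm (?i r) * L2_norm f"
  proof -
    have "(\<integral>x. norm (f x) \<partial>lborel) = (\<integral>x. norm (?i r x) * norm (f x) \<partial>lborel)"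
      using r(2) by (intro Bochner_Integration.integral_cong refl) (force simp: indicator_def not_le)
    also have "\<dots> \<le> L2_norm (?i r) * L2_norm f"
      by (intro L2_mult_norm_le L2_norm_indicator_cball r f)
    finally show ?thesis .
  qed
  have [measurable]: "F \<in> borel_measurable borel" unfolding F_def by measurable
  have F: "norm (F \<xi>) \<le> ?k * (L2_norm (?i r) * L2_norm f)" for \<xi>
    unfolding F_def using order.trans[OF raw_fourier_le n1] by (simp add: mult_left_mono)
  have m: "(\<lambda>\<xi>. ?i \<rho> \<xi> * F \<xi>) \<in> borel_measurable borel"
    by (intro borel_measurable_times borel_measurable_indicator ball) measurable
  have "norm (?i \<rho> \<xi> * F \<xi>) \<le> (?k * (L2_norm (?i r) * L2_norm f)) * norm (?i \<rho> \<xi>)" for \<xi>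
    using F by (simp add: indicator_def)
  note * = L2_norm_mono[OF L2_norm_indicator_cball(1)[OF \<rho>] m _ AE_I2[OF this]]
  show "(\<lambda>\<xi>. ?i \<rho> \<xi> * F \<xi>) \<in> L2" by (rule *(1)) simp
  have "L2_norm (?i R) = sqrt (unit_ball_vol (real CARD('n)) * R ^ CARD('n))" if "0 \<le> R" for R
    using L2_norm_indicator_cball(2)[OF that, where 'n='n] by (metis L2_norm_nonneg real_sqrt_unique)
  then have "L2_norm (?i r) * L2_norm (?i \<rho>) = unit_ball_vol (real CARD('n)) * sqrt ((r * \<rho>) ^ CARD('n))"
    using r \<rho> by (simp add: real_sqrt_mult power_mult_distrib)
  moreover have "L2_norm (\<lambda>\<xi>. ?i \<rho> \<xi> * F \<xi>) \<le> ?k * (L2_norm (?i r) * L2_norm (?i \<rho>)) * L2_norm f"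
    using *(2) by (simp add: mult_ac)
  ultimately show "L2_norm (\<lambda>\<xi>. ?i \<rho> \<xi> * F \<xi>) \<le>
      (?k * unit_ball_vol (real CARD('n)) * sqrt ((r * \<rho>) ^ CARD('n))) * L2_norm f"
    by (simp add: mult_ac)
qed

lemma escape_weight_ge:
  assumes \<delta>: "\<delta> > 0" and s: "s > 0" and \<beta>: "0 < \<beta>" "\<beta> < 1" and \<xi>: "norm \<xi> \<ge> sqrt (\<beta> / (1 - \<beta>)) * \<delta>"
  shows "\<beta> powr (s/2) \<le> escape_weight \<delta> s \<xi>"
proof -
  define u where "u = (norm \<xi>)\<^sup>2"
  have "(sqrt (\<beta> / (1 - \<beta>)) * \<delta>)\<^sup>2 \<le> u"
    unfolding u_def using \<delta> \<beta> by (intro power_mono \<xi>) auto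
  then have "\<beta> / (1 - \<beta>) * \<delta>\<^sup>2 \<le> u"
    using \<beta> by (simp add: power_mult_distrib)
  then have u: "\<beta> * (\<delta>\<^sup>2 + u) \<le> u"
    using \<beta> by (simp add: field_simps)
  have P: "\<delta>\<^sup>2 + u > 0" using \<delta> by (simp add: u_def add_pos_nonneg)
  have "\<beta> powr (s/2) = (\<beta> * (\<delta>\<^sup>2 + u)) powr (s/2) * (\<delta>\<^sup>2 + u) powr (- (s/2))"
    using P \<beta> by (simp add: powr_mult powr_minus)
  also have "\<dots> \<le> u powr (s/2) * (\<delta>\<^sup>2 + u) powr (- (s/2))"
    using s \<beta> P u by (intro mult_right_mono powr_mono2) auto
  finally show ?thesis by (simp add: escape_weight_def u_def)
qed

text \<open>
Scale invariance dictates the choices. Frequencies below \<open>\<rho> = a / r\<close> contribute \<open>1/4\<close>; the weight of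
scale \<open>\<delta> = d / r\<close>, with \<open>d\<close> so small that it is at least \<open>3/4\<close> beyond \<open>\<rho>\<close>, leaves another \<open>1/4\<close>; and the
oscillatory integral is at most \<open>1/8\<close> from the terms with \<open>R\<close>, by the choice of \<open>\<sigma>\<close>, plus \<open>1/8\<close> from the others,
by the choice of \<open>T0\<close>.
\<close>

theorem propagator_escape:
  fixes s :: real
  assumes s: "s \<ge> 1"
  obtains \<sigma> T0 :: real where "\<sigma> > 0" "T0 > 0"
    "\<And>r \<tau> (f :: real^'n \<Rightarrow> complex) g. r > 0 \<Longrightarrow> \<tau> > r powr s * T0 \<Longrightarrow> f \<in> L2 \<Longrightarrow> g \<in> L2 \<Longrightarrow>
      (\<And>x. norm x > r \<Longrightarrow> f x = 0) \<Longrightarrow> (\<And>x. norm x > \<sigma> * \<tau> / r powr (s - 1) \<Longrightarrow> g x = 0) \<Longrightarrow>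
      norm (\<integral>x. propagator s \<tau> f x * cnj (g x) \<partial>lborel) \<le> 3/4 * (L2_norm f * L2_norm g)"
proof -
  define n where "n = real CARD('n)"
  have n: "n \<ge> 1" unfolding n_def by (simp add: Suc_leI)
  let ?k = "unitary_factor TYPE('n)"
  define \<omega> where "\<omega> = ?k * unit_ball_vol n"
  have \<omega>: "\<omega> \<ge> 0" unfolding \<omega>_def using n by simp
  \<comment> \<open>\<open>a\<close> makes the low frequency factor \<open>\<omega> \<surd>(a\<^sup>n) \<le> \<omega> \<surd>a\<close> at most \<open>1/4\<close>\<close>
  define a where "a = 1 / (1 + 16 * \<omega>\<^sup>2)"
  have a: "0 < a" "a \<le> 1" by (auto simp: a_def add_pos_nonneg)
  have a\<omega>: "\<omega>\<^sup>2 * a \<le> (1/4)\<^sup>2"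
    by (simp add: a_def divide_simps power2_eq_square add_pos_nonneg)
  \<comment> \<open>the weight is at least \<open>\<beta>\<^bsup>s/2\<^esup> = 3/4\<close> at frequencies above \<open>M \<delta>\<close>\<close>
  define \<beta> where "\<beta> = (3/4 :: real) powr (2 / s)"
  have \<beta>: "0 < \<beta>" "\<beta> < 1" "\<beta> powr (s/2) = 3/4"
    using s powr_less_mono2[of "2 / s" "3/4" 1] by (auto simp: \<beta>_def powr_powr)
  define M where "M = sqrt (\<beta> / (1 - \<beta>))"
  have M: "M > 0" using \<beta> by (simp add: M_def)
  define d where "d = a / M"
  have d: "d > 0" using a M by (simp add: d_def)
  define A where "A = n * d powr (1 - s) + (n + s) * d powr (- s)"
  have A: "A > 0" unfolding A_def using n s d by (intro add_pos_pos mult_pos_pos) auto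
  define \<sigma> where "\<sigma> = 1 / (8 * n * d powr (1 - s))"
  have \<sigma>: "\<sigma> > 0" using n d by (simp add: \<sigma>_def)
  have main: "norm (\<integral>x. propagator s \<tau> f x * cnj (g (x :: real^'n)) \<partial>lborel) \<le> 3/4 * (L2_norm f * L2_norm g)"
    if r: "r > 0" and \<tau>: "\<tau> > r powr s * (8 * A)" and f: "f \<in> L2" and g: "g \<in> L2"
      and fr: "\<And>x. norm x > r \<Longrightarrow> f x = 0"
      and gR: "\<And>x. norm x > \<sigma> * \<tau> / r powr (s - 1) \<Longrightarrow> g x = 0" for r \<tau> f g
  proof -
    define R where "R = \<sigma> * \<tau> / r powr (s - 1)"
    have "0 < r powr s * (8 * A)" using r A by simp
    then have \<tau>0: "\<tau> > 0" using \<tau> by linarith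
    have R: "R \<ge> 0" using \<sigma> \<tau>0 by (simp add: R_def)
    define \<delta> where "\<delta> = d / r"
    have \<delta>: "\<delta> > 0" using d r by (simp add: \<delta>_def)
    have cg: "(\<lambda>x. cnj (g x)) \<in> L2" "L2_norm (\<lambda>x. cnj (g x)) = L2_norm g"
      by (intro L2_cnj g)+
    define h where "h \<xi> = ?k *\<^sub>R raw_fourier (-1) f \<xi>" for \<xi>
    define k where "k \<xi> = ?k *\<^sub>R raw_fourier 1 (\<lambda>x. cnj (g x)) \<xi>" for \<xi>
    have fi: "integrable lborel f" using truncation_L2(2)[OF f, of r] truncation_eq[of r f] fr by simp
    have gi: "integrable lborel (\<lambda>x. cnj (g x))"
      using truncation_L2(2)[OF cg(1), of R] truncation_eq[of R "\<lambda>x. cnj (g x)"] gR by (simp add: R_def)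
    have h: "h \<in> L2" "L2_norm h \<le> L2_norm f"
      unfolding h_def by (intro raw_fourier_contraction f fi; simp)+
    have k: "k \<in> L2" "L2_norm k \<le> L2_norm g"
      unfolding k_def using raw_fourier_contraction[OF cg(1) gi, of 1] cg(2) by simp_all
    have hv: "L2_norm (\<lambda>\<xi>. h (\<xi> + t *\<^sub>R axis j 1) - h \<xi>) \<le> \<bar>t\<bar> * r * L2_norm f" for j t
      unfolding h_def using r by (intro raw_fourier_translate_diff f fr) auto
    have kv: "L2_norm (\<lambda>\<xi>. k (\<xi> + t *\<^sub>R axis j 1) - k \<xi>) \<le> \<bar>t\<bar> * R * L2_norm g" for j t
      unfolding k_def cg(2)[symmetric] using R gR by (intro raw_fourier_translate_diff cg(1)) (auto simp: R_def)
    have fh: "AE \<xi> in lborel. L2_fourier (-1) f \<xi> = h \<xi>"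
      unfolding h_def by (rule L2_fourier_bounded_support[OF f _ fr]) simp
    have gk: "AE \<xi> in lborel. cnj (L2_fourier (-1) g \<xi>) = k \<xi>"
    proof -
      have "AE \<xi> in lborel. L2_fourier 1 (\<lambda>x. cnj (g x)) \<xi> = k \<xi>"
        unfolding k_def by (rule L2_fourier_bounded_support[OF cg(1), of 1 R]) (use gR in \<open>auto simp: R_def\<close>)
      moreover have "AE \<xi> in lborel. L2_fourier 1 (\<lambda>x. cnj (g x)) \<xi> = cnj (L2_fourier (-1) g \<xi>)"
        using L2_fourier_cnj[OF g, of "-1"] by simp
      ultimately show ?thesis by eventually_elim simp
    qed
    note [measurable] = L2_measurable[OF h(1)] L2_measurable[OF k(1)]
    note ftm = L2_measurable[OF L2_fourier_L2[OF f, of "-1", simplified]] L2_measurable[OF L2_fourier_L2[OF g, of "-1", simplified]]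
    have "(\<integral>x. propagator s \<tau> f x * cnj (g x) \<partial>lborel) = (\<integral>\<xi>. phase s \<tau> \<xi> * (L2_fourier (-1) f \<xi> * cnj (L2_fourier (-1) g \<xi>)) \<partial>lborel)"
      by (rule propagator_inner[OF f g])
    also have "\<dots> = (\<integral>\<xi>. phase s \<tau> \<xi> * (h \<xi> * k \<xi>) \<partial>lborel)"
    proof (rule integral_cong_AE)
      show "AE \<xi> in lborel. phase s \<tau> \<xi> * (L2_fourier (-1) f \<xi> * cnj (L2_fourier (-1) g \<xi>)) = phase s \<tau> \<xi> * (h \<xi> * k \<xi>)"
        using fh gk by eventually_elim simp
    qed (use ftm in measurable)
    also have "\<dots> = (\<integral>\<xi>. escape_weight \<delta> s \<xi> *\<^sub>R (phase s \<tau> \<xi> * (h \<xi> * k \<xi>)) + (phase s \<tau> \<xi> * ((1 - escape_weight \<delta> s \<xi>) * h \<xi>)) * k \<xi> \<partial>lborel)"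
      by (intro Bochner_Integration.integral_cong refl) (simp add: scaleR_conv_of_real algebra_simps)
    finally have eq1: "(\<integral>x. propagator s \<tau> f x * cnj (g x) \<partial>lborel) = \<dots>" .
    have er: "0 \<le> escape_weight \<delta> s \<xi>" "escape_weight \<delta> s \<xi> \<le> 1" for \<xi> :: "real^'n"
      using escape_weight_range[OF \<delta>, of s \<xi>] s by auto
    \<comment> \<open>the complementary weight \<open>1 - m\<close> is at most 1, and at most \<open>1/4\<close> outside the ball of radius \<open>\<rho>\<close>\<close>
    have i1: "integrable lborel (\<lambda>\<xi>. escape_weight \<delta> s \<xi> *\<^sub>R (phase s \<tau> \<xi> * (h \<xi> * k \<xi>)))"
    proof -
      have "(\<lambda>\<xi>. (of_real (escape_weight \<delta> s \<xi>) * phase s \<tau> \<xi>) * h \<xi>) \<in> L2"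
        using er by (intro L2_mult_bounded(1)[OF h(1), of _ 1]) (auto simp: norm_mult)
      from L2_mult_integrable[OF this k(1)] show ?thesis
        by (simp add: scaleR_conv_of_real mult.assoc)
    qed
    define \<rho> where "\<rho> = a / r"
    have \<rho>: "\<rho> \<ge> 0" using a r by (simp add: \<rho>_def)
    define H where "H = (\<lambda>\<xi>. indicator (cball 0 \<rho>) \<xi> * h \<xi>)"
    have H: "H \<in> L2" "L2_norm H \<le> 1/4 * L2_norm f"
    proof -
      have *: "H \<in> L2" "L2_norm H \<le> (?k * unit_ball_vol n * sqrt ((r * \<rho>) ^ CARD('n))) * L2_norm f"
        unfolding H_def h_def n_def using r \<rho> by (intro raw_fourier_low_frequency f fr; simp)+
      show "H \<in> L2" by (rule *(1))
      have "a ^ CARD('n) \<le> a"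
        using power_decreasing[of 1 "CARD('n)" a] a by (simp add: Suc_leI)
      then have "(\<omega> * sqrt (a ^ CARD('n)))\<^sup>2 \<le> \<omega>\<^sup>2 * a"
        using a by (simp add: power_mult_distrib mult_left_mono)
      from order.trans[OF this a\<omega>] have "\<omega> * sqrt (a ^ CARD('n)) \<le> 1/4"
        by (rule power2_le_imp_le) simp
      moreover have "r * \<rho> = a" using r by (simp add: \<rho>_def)
      ultimately have "(?k * unit_ball_vol n * sqrt ((r * \<rho>) ^ CARD('n))) * L2_norm f \<le> 1/4 * L2_norm f"
        by (intro mult_right_mono) (simp_all add: \<omega>_def)
      with *(2) show "L2_norm H \<le> 1/4 * L2_norm f" by linarith
    qed
    define G where "G \<xi> = phase s \<tau> \<xi> * ((1 - escape_weight \<delta> s \<xi>) * h \<xi>)" for \<xi>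
    have G: "G \<in> L2" "L2_norm G \<le> 1/2 * L2_norm f"
    proof -
      have [measurable]: "G \<in> borel_measurable borel" unfolding G_def by measurable
      have q: "(\<lambda>\<xi>. H \<xi> + 1/4 * h \<xi>) \<in> L2" by (intro L2_add L2_cmult H h)
      have "norm (G \<xi>) \<le> 1 * norm (H \<xi> + 1/4 * h \<xi>)" for \<xi>
      proof -
        have e: "norm (1 - complex_of_real (escape_weight \<delta> s \<xi>)) = 1 - escape_weight \<delta> s \<xi>"
          using er[of \<xi>] by (metis abs_of_nonneg diff_ge_0_iff_ge norm_of_real of_real_1 of_real_diff)
        have nG: "norm (G \<xi>) = (1 - escape_weight \<delta> s \<xi>) * norm (h \<xi>)"
          by (simp add: G_def norm_mult e)
        show ?thesis
        proof (cases "norm \<xi> \<le> \<rho>")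
          case True
          then have "norm (H \<xi> + 1/4 * h \<xi>) = norm ((5/4) * h \<xi>)" by (simp add: H_def algebra_simps)
          then have "norm (H \<xi> + 1/4 * h \<xi>) = 5/4 * norm (h \<xi>)" by (simp add: norm_mult)
          moreover have "(1 - escape_weight \<delta> s \<xi>) * norm (h \<xi>) \<le> 5/4 * norm (h \<xi>)"
            using er[of \<xi>] by (intro mult_right_mono) auto
          ultimately show ?thesis using nG by simp
        next
          case False
          \<comment> \<open>by the choice \<open>d = a / M\<close>, frequencies outside the ball of radius \<open>\<rho>\<close> have weight at least \<open>3/4\<close>\<close>
          have "M * \<delta> = \<rho>" using M r by (simp add: \<delta>_def d_def \<rho>_def)
          then have "\<beta> powr (s/2) \<le> escape_weight \<delta> s \<xi>"
            using False \<beta> s by (intro escape_weight_ge \<delta>) (auto simp: M_def)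
          then have "(1 - escape_weight \<delta> s \<xi>) * norm (h \<xi>) \<le> 1/4 * norm (h \<xi>)"
            using \<beta>(3) by (intro mult_right_mono) auto
          moreover have "norm (H \<xi> + 1/4 * h \<xi>) = 1/4 * norm (h \<xi>)"
            using False by (simp add: H_def norm_divide)
          ultimately show ?thesis using nG by simp
        qed
      qed
      note * = L2_norm_mono[OF q _ zero_le_one AE_I2[OF this]]
      show "G \<in> L2" by (rule *(1)) measurable
      have "L2_norm G \<le> L2_norm (\<lambda>\<xi>. H \<xi> + 1/4 * h \<xi>)" using *(2) by simp
      also have "\<dots> \<le> L2_norm H + 1/4 * L2_norm h"
        using L2_norm_triangle[OF H(1) L2_cmult(1)[OF h(1), of "1/4"]] L2_cmult(2)[OF h(1), of "1/4"]
        by (simp add: norm_divide)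
      finally show "L2_norm G \<le> 1/2 * L2_norm f" using H(2) h(2) by simp
    qed
    have part1: "norm (\<integral>\<xi>. escape_weight \<delta> s \<xi> *\<^sub>R (phase s \<tau> \<xi> * (h \<xi> * k \<xi>)) \<partial>lborel) \<le> 1/4 * (L2_norm f * L2_norm g)"
    proof -
      have "(n * (r + R) * \<delta> powr (1 - s) + (n + s) * \<delta> powr (- s)) / (\<tau> * s) \<le> 1/4"
      proof -
        have e1: "\<delta> powr (1 - s) = d powr (1 - s) * r powr (s - 1)"
          using d r by (simp add: \<delta>_def powr_divide powr_diff)
        have e2: "\<delta> powr (- s) = d powr (- s) * r powr s"
          using d r by (simp add: \<delta>_def powr_divide powr_minus field_simps)
        have e3: "r * r powr (s - 1) = r powr s"
          using r by (simp add: powr_diff)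
        have "n * (r + R) * \<delta> powr (1 - s) = n * d powr (1 - s) * (r * r powr (s - 1)) + n * d powr (1 - s) * (R * r powr (s - 1))"
          unfolding e1 by (simp add: algebra_simps)
        also have "R * r powr (s - 1) = \<sigma> * \<tau>" using r by (simp add: R_def)
        also have "n * d powr (1 - s) * (\<sigma> * \<tau>) = \<tau> / 8"
          using n d by (simp add: \<sigma>_def)
        finally have "n * (r + R) * \<delta> powr (1 - s) + (n + s) * \<delta> powr (- s) = r powr s * A + \<tau> / 8"
          unfolding e2 e3 A_def by (simp add: algebra_simps)
        also have "\<dots> \<le> \<tau> / 4" using \<tau> by simp
        also have "\<dots> \<le> 1/4 * (\<tau> * s)" using \<tau>0 s by simp
        finally show ?thesis using \<tau>0 s by (simp add: pos_divide_le_eq)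
      qed
      from mult_right_mono[OF this, of "L2_norm f * L2_norm g"]
      show ?thesis
        by (intro order.trans[OF escape_oscillatory_bound[OF h(1) k(1) hv h(2) kv k(2) less_imp_le[OF r] R \<delta> s \<tau>0]])
          (simp add: n_def)
    qed
    have part2: "norm (\<integral>\<xi>. G \<xi> * k \<xi> \<partial>lborel) \<le> 1/2 * (L2_norm f * L2_norm g)"
    proof -
      have "norm (\<integral>\<xi>. G \<xi> * k \<xi> \<partial>lborel) \<le> L2_norm G * L2_norm k"
        by (rule L2_mult_le[OF G(1) k(1)])
      also have "\<dots> \<le> (1/2 * L2_norm f) * L2_norm g"
        by (intro mult_mono G k) auto
      finally show ?thesis by simp
    qed
    have i2: "integrable lborel (\<lambda>\<xi>. G \<xi> * k \<xi>)" by (rule L2_mult_integrable[OF G(1) k(1)])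
    have "norm (\<integral>x. propagator s \<tau> f x * cnj (g x) \<partial>lborel) \<le>
        norm (\<integral>\<xi>. escape_weight \<delta> s \<xi> *\<^sub>R (phase s \<tau> \<xi> * (h \<xi> * k \<xi>)) \<partial>lborel) + norm (\<integral>\<xi>. G \<xi> * k \<xi> \<partial>lborel)"
      unfolding eq1 G_def[symmetric] Bochner_Integration.integral_add[OF i1 i2] by (rule norm_triangle_ineq)
    with part1 part2 show ?thesis by simp
  qed
  show thesis
    by (rule that[OF \<sigma> _ main, of "8 * A"]) (use A in simp_all)
qed

section \<open>Control by two impulses\<close>

lemma restrict_to_L2:
  assumes f: "f \<in> L2" and A: "A \<in> sets borel"
  shows "restrict_to A f \<in> L2" "L2_norm (restrict_to A f) \<le> L2_norm f"
proof -
  have m: "indicator A \<in> borel_measurable borel" using A by simp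
  have "norm (indicator A x :: complex) \<le> 1" for x by (simp add: indicator_def)
  from L2_mult_bounded[OF f m this] show "restrict_to A f \<in> L2" "L2_norm (restrict_to A f) \<le> L2_norm f"
    by (simp_all add: restrict_to_def)
qed

text \<open>
The operator norm of the localized propagator is read off from its matrix elements, by testing against its own value.
\<close>

lemma localized_propagator_norm:
  fixes A1 A2 :: "(real^'n) set"
  assumes A: "A1 \<in> sets borel" "A2 \<in> sets borel"
    and bound: "\<And>f g :: real^'n \<Rightarrow> complex. f \<in> L2 \<Longrightarrow> g \<in> L2 \<Longrightarrow> (\<And>x. x \<in> A1 \<Longrightarrow> f x = 0) \<Longrightarrow>
      (\<And>x. x \<in> A2 \<Longrightarrow> g x = 0) \<Longrightarrow>
      norm (\<integral>x. propagator s \<tau> f x * cnj (g x) \<partial>lborel) \<le> q * (L2_norm f * L2_norm g)"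
    and q: "0 \<le> q" and f: "f \<in> L2"
  shows "L2_norm (restrict_to (- A2) (propagator s \<tau> (restrict_to (- A1) f))) \<le> q * L2_norm f"
proof -
  have A': "- A1 \<in> sets borel" "- A2 \<in> sets borel" using A by auto
  define f' where "f' = restrict_to (- A1) f"
  define w where "w = restrict_to (- A2) (propagator s \<tau> f')"
  have f': "f' \<in> L2" "L2_norm f' \<le> L2_norm f"
    unfolding f'_def by (rule restrict_to_L2[OF f A'(1)])+
  have w: "w \<in> L2" unfolding w_def using f' A' by (intro restrict_to_L2) auto
  have "complex_of_real ((L2_norm w)\<^sup>2) = (\<integral>x. complex_of_real ((norm (w x))\<^sup>2) \<partial>lborel)"
    by (simp only: L2_norm_sq integral_complex_of_real)
  also have "\<dots> = (\<integral>x. propagator s \<tau> f' x * cnj (w x) \<partial>lborel)"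
    by (intro Bochner_Integration.integral_cong refl)
      (auto simp: complex_norm_square w_def restrict_to_def indicator_def simp del: of_real_power)
  finally have "(L2_norm w)\<^sup>2 = norm (\<integral>x. propagator s \<tau> f' x * cnj (w x) \<partial>lborel)"
    by (metis abs_of_nonneg norm_of_real zero_le_power2)
  also have "\<dots> \<le> q * (L2_norm f' * L2_norm w)"
    by (intro bound f' w) (auto simp: f'_def w_def restrict_to_def)
  finally have "L2_norm w * L2_norm w \<le> (q * L2_norm f') * L2_norm w"
    by (simp add: power2_eq_square mult.assoc)
  then have "L2_norm w \<le> q * L2_norm f'"
    using L2_norm_nonneg[of w] L2_norm_nonneg[of f'] q
    by (cases "L2_norm w = 0") (auto simp: mult_le_cancel_right)
  also have "\<dots> \<le> q * L2_norm f" using f' q by (intro mult_left_mono)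
  finally show ?thesis by (simp add: w_def f'_def)
qed

text \<open>
With \<open>y\<close> cut off to the complement of \<open>A2\<close>, the fixed point equation of the introduction says that \<open>U\<close> applied
to the part \<open>h1\<close> of \<open>U\<^sup>* y\<close> in \<open>A1\<close> agrees with \<open>z\<close> on the complement of \<open>A2\<close>; then \<open>h2\<close> corrects the value on
\<open>A2\<close>.
\<close>

lemma two_point_control:
  fixes A1 A2 :: "(real^'n) set" and z :: "real^'n \<Rightarrow> complex"
  assumes A: "A1 \<in> sets borel" "A2 \<in> sets borel"
    and bound: "\<And>f :: real^'n \<Rightarrow> complex. f \<in> L2 \<Longrightarrow>
      L2_norm (restrict_to (- A2) (propagator s \<tau> (restrict_to (- A1) f))) \<le> q * L2_norm f"
    and q: "0 \<le> q" "q < 1" and z: "z \<in> L2"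
  shows "\<exists>h1\<in>L2. \<exists>h2\<in>L2.
    (AE x in lborel. propagator s \<tau> (restrict_to A1 h1) x + restrict_to A2 h2 x = z x) \<and>
    L2_norm h1 \<le> L2_norm z / (1 - q) \<and> L2_norm h2 \<le> L2_norm z + L2_norm z / (1 - q)"
proof -
  have A': "- A1 \<in> sets borel" "- A2 \<in> sets borel" using A by auto
  let ?U = "propagator s \<tau>" and ?V = "propagator s (- \<tau>)"
  define N where "N y = restrict_to (- A2) (?U (restrict_to (- A1) (?V (restrict_to (- A2) y))))" for y
  have R: "restrict_to B f \<in> L2" "L2_norm (restrict_to B f) \<le> L2_norm f"
    if "f \<in> L2" "B \<in> {A1, A2, - A1, - A2}" for B f
    using that A A' by (auto intro: restrict_to_L2)
  have N: "N y \<in> L2" if "y \<in> L2" for y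
    unfolding N_def using that by (intro R propagator_L2) auto
  have Nle: "L2_norm (N y) \<le> q * L2_norm y" if y: "y \<in> L2" for y
  proof -
    have "L2_norm (N y) \<le> q * L2_norm (?V (restrict_to (- A2) y))"
      unfolding N_def by (intro bound propagator_L2 R y) auto
    also have "\<dots> \<le> q * L2_norm y"
      using R(2)[OF y, of "- A2"] propagator_L2(2)[OF R(1)[OF y, of "- A2"]] q
      by (intro mult_left_mono) auto
    finally show ?thesis .
  qed
  have Rd: "restrict_to B (\<lambda>x. f x - g x) = (\<lambda>x. restrict_to B f x - restrict_to B g x)" for B and f g :: "real^'n \<Rightarrow> complex"
    by (auto simp: restrict_to_def algebra_simps)
  have Rc: "restrict_to (- B) u x = (if x \<in> B then 0 else u x)" for B and u :: "real^'n \<Rightarrow> complex" and x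
    by (simp add: restrict_to_def)
  have Pd: "AE x in lborel. propagator s t (\<lambda>x. f x - g x) x = propagator s t f x - propagator s t g x"
    if "f \<in> L2" "g \<in> L2" for f g :: "real^'n \<Rightarrow> complex" and t
    using propagator_lincomb[OF that, of s t 1 "-1"] by simp
  have Nd: "AE x in lborel. N (\<lambda>x. f x - g x) x = N f x - N g x" if f: "f \<in> L2" and g: "g \<in> L2" for f g
  proof -
    let ?f = "restrict_to (- A2) f" and ?g = "restrict_to (- A2) g"
    have fg: "?f \<in> L2" "?g \<in> L2" using f g by (auto intro: R)
    let ?f' = "restrict_to (- A1) (?V ?f)" and ?g' = "restrict_to (- A1) (?V ?g)"
    have fg': "?f' \<in> L2" "?g' \<in> L2" using fg by (auto intro!: R propagator_L2)
    have "AE x in lborel. restrict_to (- A1) (?V (\<lambda>x. ?f x - ?g x)) x = ?f' x - ?g' x"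
      using Pd[OF fg, of "- \<tau>"] by eventually_elim (simp add: Rc)
    then have "?U (restrict_to (- A1) (?V (\<lambda>x. ?f x - ?g x))) = ?U (\<lambda>x. ?f' x - ?g' x)"
      by (rule propagator_cong_AE) (use fg fg' in \<open>auto intro!: R propagator_L2 L2_diff\<close>)
    then have eqN: "N (\<lambda>x. f x - g x) = restrict_to (- A2) (?U (\<lambda>x. ?f' x - ?g' x))"
      unfolding N_def Rd by simp
    show ?thesis
      unfolding eqN using Pd[OF fg', of \<tau>] by eventually_elim (simp add: N_def Rc)
  qed
  define \<Phi> where "\<Phi> y = (\<lambda>x. restrict_to (- A2) z x + N y x)" for y
  have "\<exists>y\<in>L2. (AE x in lborel. \<Phi> y x = y x) \<and> L2_norm y \<le> L2_norm (\<Phi> (\<lambda>x. 0)) / (1 - q)"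
  proof (rule L2_contraction_fixpoint)
    show "\<Phi> f \<in> L2" if "f \<in> L2" for f
      unfolding \<Phi>_def by (intro L2_add N R z that) auto
    show "L2_norm (\<lambda>x. \<Phi> f x - \<Phi> g x) \<le> q * L2_norm (\<lambda>x. f x - g x)" if f: "f \<in> L2" and g: "g \<in> L2" for f g
    proof -
      have d: "(\<lambda>x. f x - g x) \<in> L2" by (intro L2_diff f g)
      have "(\<lambda>x. \<Phi> f x - \<Phi> g x) = (\<lambda>x. N f x - N g x)" by (simp add: \<Phi>_def)
      moreover have "L2_norm (\<lambda>x. N f x - N g x) = L2_norm (N (\<lambda>x. f x - g x))"
        by (rule L2_norm_cong_AE(2)[OF N[OF d] L2_measurable[OF L2_diff[OF N[OF f] N[OF g]]] Nd[OF f g]])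
      ultimately show ?thesis using Nle[OF d] by simp
    qed
  qed (use q in auto)
  then obtain y where y: "y \<in> L2" and fp: "AE x in lborel. \<Phi> y x = y x"
    and yn: "L2_norm y \<le> L2_norm (\<Phi> (\<lambda>x. 0)) / (1 - q)" by blast
  have "L2_norm (\<Phi> (\<lambda>x. 0)) \<le> L2_norm z"
  proof -
    have "L2_norm (N (\<lambda>x. 0)) \<le> 0" using Nle[of "\<lambda>x. 0"] by simp
    moreover have "L2_norm (\<Phi> (\<lambda>x. 0)) \<le> L2_norm (restrict_to (- A2) z) + L2_norm (N (\<lambda>x. 0))"
      unfolding \<Phi>_def by (intro L2_norm_triangle R N z) auto
    ultimately show ?thesis using R(2)[OF z, of "- A2"] by simp
  qed
  then have yz: "L2_norm y \<le> L2_norm z / (1 - q)"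
    using yn q by (meson divide_right_mono diff_ge_0_iff_ge less_imp_le order.trans)
  define v where "v = ?V (restrict_to (- A2) y)"
  have v: "v \<in> L2" "L2_norm v \<le> L2_norm y"
    unfolding v_def using R[OF y, of "- A2"] by simp_all
  \<comment> \<open>\<open>v\<close> is \<open>U\<^sup>*\<close> applied to the cut off \<open>y\<close>; of it, \<open>h1\<close> is the part that a control may use\<close>
  define h1 where "h1 = restrict_to A1 v"
  have h1: "h1 \<in> L2" "L2_norm h1 \<le> L2_norm z / (1 - q)"
    unfolding h1_def using R[OF v(1), of A1] v(2) yz by auto
  have h1r: "restrict_to A1 h1 = h1"
    by (auto simp: h1_def restrict_to_def indicator_def)
  define h2 where "h2 = restrict_to A2 (\<lambda>x. z x - ?U h1 x)"
  have zu: "(\<lambda>x. z x - ?U h1 x) \<in> L2" by (intro L2_diff z propagator_L2 h1)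
  have h2: "h2 \<in> L2" "L2_norm h2 \<le> L2_norm z + L2_norm z / (1 - q)"
  proof -
    show "h2 \<in> L2" unfolding h2_def by (intro R zu) auto
    have "L2_norm h2 \<le> L2_norm (\<lambda>x. z x - ?U h1 x)"
      unfolding h2_def by (intro R zu) auto
    also have "\<dots> \<le> L2_norm z + L2_norm h1"
      using L2_norm_triangle_diff[OF z propagator_L2(1)[OF h1(1), of s \<tau>]] propagator_L2(2)[OF h1(1)] by simp
    finally show "L2_norm h2 \<le> L2_norm z + L2_norm z / (1 - q)" using h1(2) by linarith
  qed
  have c: "restrict_to (- A1) v \<in> L2" by (intro R v) auto
  have h1eq: "h1 = (\<lambda>x. v x - restrict_to (- A1) v x)"
    by (auto simp: h1_def restrict_to_def indicator_def)
  have U1: "AE x in lborel. ?U h1 x = ?U v x - ?U (restrict_to (- A1) v) x"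
    unfolding h1eq by (rule Pd[OF v(1) c])
  have U2: "AE x in lborel. ?U v x = restrict_to (- A2) y x"
    unfolding v_def using propagator_propagator[OF R(1)[OF y, of "- A2"], of s \<tau> "- \<tau>"]
      propagator_zero[OF R(1)[OF y, of "- A2"], of s] by simp
  have "AE x in lborel. ?U (restrict_to A1 h1) x + restrict_to A2 h2 x = z x"
    using U1 U2 fp unfolding h1r
  proof eventually_elim
    case (elim x)
    show ?case
    proof (cases "x \<in> A2")
      case True
      then show ?thesis by (simp add: h2_def restrict_to_def)
    next
      case False
      then have "y x = z x + ?U (restrict_to (- A1) v) x"
        using elim(3) by (simp add: \<Phi>_def N_def v_def restrict_to_def)
      then show ?thesis
        using False elim(1,2) by (simp add: restrict_to_def)
    qed
  qed
  with h1 h2 show ?thesis by blast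
qed

theorem theorem4p5:
  fixes s :: real
  assumes "s \<ge> 1"
  shows "\<exists>\<sigma>>0. \<exists>T0>0. \<forall>r \<tau>1 \<tau>2 T :: real.
    r > 0 \<and> 0 < \<tau>1 \<and> \<tau>1 < \<tau>2 \<and> \<tau>2 < T \<and> \<tau>2 - \<tau>1 > r powr s * T0 \<longrightarrow>
    (\<exists>C>0. \<forall>u0 \<in> L2. \<forall>uT \<in> L2. \<exists>h1 \<in> L2. \<exists>h2 \<in> L2.
      (AE x in lborel.
        impulse_solution s \<tau>1 {x. norm x \<ge> r} \<tau>2 {x. norm x \<ge> \<sigma> * (\<tau>2 - \<tau>1) / r powr (s - 1)}
          u0 h1 h2 T x = uT (x :: real^'n)) \<and>
      (L2_norm h1)\<^sup>2 + (L2_norm h2)\<^sup>2 \<le> C * (L2_norm (\<lambda>x. uT x - propagator s T u0 x))\<^sup>2)"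
proof (rule propagator_escape[OF assms, where 'n='n])
  fix \<sigma> T0 :: real
  assume \<sigma>: "\<sigma> > 0" and T0: "T0 > 0" and
    escape: "\<And>r \<tau> (f :: real^'n \<Rightarrow> complex) g. r > 0 \<Longrightarrow> \<tau> > r powr s * T0 \<Longrightarrow> f \<in> L2 \<Longrightarrow> g \<in> L2 \<Longrightarrow>
      (\<And>x. norm x > r \<Longrightarrow> f x = 0) \<Longrightarrow> (\<And>x. norm x > \<sigma> * \<tau> / r powr (s - 1) \<Longrightarrow> g x = 0) \<Longrightarrow>
      norm (\<integral>x. propagator s \<tau> f x * cnj (g x) \<partial>lborel) \<le> 3/4 * (L2_norm f * L2_norm g)"
  have main: "\<exists>h1 \<in> L2. \<exists>h2 \<in> L2.
      (AE x in lborel.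
        impulse_solution s \<tau>1 {x. norm x \<ge> r} \<tau>2 {x. norm x \<ge> \<sigma> * (\<tau>2 - \<tau>1) / r powr (s - 1)}
          u0 h1 h2 T x = uT (x :: real^'n)) \<and>
      (L2_norm h1)\<^sup>2 + (L2_norm h2)\<^sup>2 \<le> 41 * (L2_norm (\<lambda>x. uT x - propagator s T u0 x))\<^sup>2"
    if r: "r > 0" and \<tau>: "\<tau>1 < \<tau>2" "\<tau>2 < T" "\<tau>2 - \<tau>1 > r powr s * T0"
      and u0: "u0 \<in> L2" and uT: "uT \<in> L2" for r \<tau>1 \<tau>2 T u0 uT
  proof -
    define A1 where "A1 = {x :: real^'n. norm x \<ge> r}"
    define A2 where "A2 = {x :: real^'n. norm x \<ge> \<sigma> * (\<tau>2 - \<tau>1) / r powr (s - 1)}"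
    have A: "A1 \<in> sets borel" "A2 \<in> sets borel"
      unfolding A1_def A2_def by (intro borel_closed closed_Collect_le continuous_intros)+
    have loc: "L2_norm (restrict_to (- A2) (propagator s (\<tau>2 - \<tau>1) (restrict_to (- A1) f))) \<le> 3/4 * L2_norm f"
      if "f \<in> L2" for f
    proof (rule localized_propagator_norm[OF A _ _ that])
      show "norm (\<integral>x. propagator s (\<tau>2 - \<tau>1) f x * cnj (g x) \<partial>lborel) \<le> 3/4 * (L2_norm f * L2_norm g)"
        if "f \<in> L2" "g \<in> L2" "\<And>x. x \<in> A1 \<Longrightarrow> f x = 0" "\<And>x. x \<in> A2 \<Longrightarrow> g x = 0" for f g
        using that by (intro escape[OF r \<tau>(3)]) (auto simp: A1_def A2_def)
    qed simp
    define w where "w x = uT x - propagator s T u0 x" for x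
    have w: "w \<in> L2" unfolding w_def by (intro L2_diff uT propagator_L2 u0)
    \<comment> \<open>the target seen from time \<open>\<tau>2\<close>; the factor \<open>\<i>\<close> cancels the \<open>- \<i>\<close> of Duhamel's formula\<close>
    define z where "z x = \<i> * propagator s (- (T - \<tau>2)) w x" for x
    have z: "z \<in> L2" "L2_norm z = L2_norm w"
      unfolding z_def using L2_cmult[OF propagator_L2(1)[OF w], of \<i>] propagator_L2(2)[OF w] by simp_all
    obtain h1 h2 where h1: "h1 \<in> L2" "L2_norm h1 \<le> L2_norm z / (1 - 3/4)"
      and h2: "h2 \<in> L2" "L2_norm h2 \<le> L2_norm z + L2_norm z / (1 - 3/4)"
      and hz: "AE x in lborel. propagator s (\<tau>2 - \<tau>1) (restrict_to A1 h1) x + restrict_to A2 h2 x = z x"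
      using two_point_control[OF A loc _ _ z(1)] by auto
    let ?P = "propagator s (\<tau>2 - \<tau>1) (restrict_to A1 h1)" and ?Q = "restrict_to A2 h2"
    have R1: "restrict_to A1 h1 \<in> L2" by (intro restrict_to_L2 h1 A)
    have P: "?P \<in> L2" and Q: "?Q \<in> L2" by (intro propagator_L2 restrict_to_L2 h1 h2 A)+
    have c1: "propagator s (T - \<tau>2) ?P = propagator s (T - \<tau>1) (restrict_to A1 h1)"
      using propagator_propagator[OF R1, of s "T - \<tau>2" "\<tau>2 - \<tau>1"] by simp
    have c2: "AE x in lborel. propagator s (T - \<tau>2) (\<lambda>x. ?P x + ?Q x) x =
        propagator s (T - \<tau>2) ?P x + propagator s (T - \<tau>2) ?Q x"
      using propagator_lincomb[OF P Q, of s "T - \<tau>2" 1 1] by simp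
    have c3: "propagator s (T - \<tau>2) (\<lambda>x. ?P x + ?Q x) = propagator s (T - \<tau>2) z"
      by (rule propagator_cong_AE[OF hz L2_add[OF P Q] z(1)])
    have c4: "AE x in lborel. propagator s (T - \<tau>2) z x = \<i> * propagator s 0 w x"
      using propagator_lincomb[OF propagator_L2(1)[OF w, of s "- (T - \<tau>2)"] L2_zero(1),
          where s = s and t = "T - \<tau>2" and a = \<i> and b = 0]
        propagator_propagator[OF w, of s "T - \<tau>2" "- (T - \<tau>2)"]
      by (simp add: z_def[abs_def])
    have "AE x in lborel. impulse_solution s \<tau>1 A1 \<tau>2 A2 u0 h1 h2 T x = uT x"
      using c2 c4 propagator_zero[OF w, of s]
    proof eventually_elim
      case (elim x)
      have "propagator s (T - \<tau>1) (restrict_to A1 h1) x + propagator s (T - \<tau>2) ?Q x = \<i> * w x"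
        using elim unfolding c1 c3 by simp
      then show ?case
        using \<tau> by (simp add: impulse_solution_def w_def)
    qed
    moreover have "(L2_norm h1)\<^sup>2 + (L2_norm h2)\<^sup>2 \<le> 41 * (L2_norm w)\<^sup>2"
    proof -
      have "L2_norm h1 \<le> 4 * L2_norm w" "L2_norm h2 \<le> 5 * L2_norm w"
        using h1(2) h2(2) z(2) by simp_all
      then have "(L2_norm h1)\<^sup>2 + (L2_norm h2)\<^sup>2 \<le> (4 * L2_norm w)\<^sup>2 + (5 * L2_norm w)\<^sup>2"
        by (intro add_mono power_mono L2_norm_nonneg)
      then show ?thesis by (simp add: power_mult_distrib)
    qed
    ultimately show ?thesis
      using h1(1) h2(1) unfolding A1_def A2_def w_def by blast
  qed
  show ?thesis
  proof (rule exI[of _ \<sigma>], rule conjI[OF \<sigma>], rule exI[of _ T0], rule conjI[OF T0], intro allI impI)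
    fix r \<tau>1 \<tau>2 T :: real
    assume "r > 0 \<and> 0 < \<tau>1 \<and> \<tau>1 < \<tau>2 \<and> \<tau>2 < T \<and> \<tau>2 - \<tau>1 > r powr s * T0"
    then show "\<exists>C>0. \<forall>u0 \<in> L2. \<forall>uT \<in> L2. \<exists>h1 \<in> L2. \<exists>h2 \<in> L2.
      (AE x in lborel.
        impulse_solution s \<tau>1 {x. norm x \<ge> r} \<tau>2 {x. norm x \<ge> \<sigma> * (\<tau>2 - \<tau>1) / r powr (s - 1)}
          u0 h1 h2 T x = uT (x :: real^'n)) \<and>
      (L2_norm h1)\<^sup>2 + (L2_norm h2)\<^sup>2 \<le> C * (L2_norm (\<lambda>x. uT x - propagator s T u0 x))\<^sup>2"
      by (intro exI[of _ "41 :: real"] conjI ballI main) auto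
  qed
qed

end
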